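(* Let $G=C_8\times C_2$ and $H=C_4\times C_4$. Then (1) there exist fields $F$ (for instance every finite field $\mathbb{F}_q$ with $q\equiv 3\pmod 4$) such that $FG\cong FH$ and $H^2(G,F^* )\cong H^2(H,F^* )$; but (2) for every field $F$ the relation $G\sim_F H$ does not hold.
   Context: $C_n$ is the cyclic group of order $n$. For a field $F$ and finite group $G$, $H^2(G,F^* )$ is the second cohomology group with trivial action; for $\alpha\in Z^2(G,F^* )$ the twisted group algebra $F^\alpha G$ has $F$-basis $\{u_g\}$, $F$ central, $u_gu_h=\alpha(g,h)u_{gh}$. $G\sim_F H$ means there is a group isomorphism $\psi:H^2(G,F^* )\to H^2(H,F^* )$ with $F^\alpha G\cong F^{\psi(\alpha)}H$ as rings for all $[\alpha]\in H^2(G,F^* )$. *)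

theory Defs
  imports "HOL-Algebra.Algebra"
begin

text \<open>Normalised 2-cocycles Z^2(G,F^*) with trivial action.  Outside carrier G \<times> carrier G
  a cocycle is fixed to be the unit, so that cocycles are determined by their values on G.\<close>
definition cocycles :: "('g, 'c) monoid_scheme \<Rightarrow> ('a, 'b) ring_scheme \<Rightarrow> ('g \<Rightarrow> 'g \<Rightarrow> 'a) set" where
  "cocycles G F = {\<alpha>.
      (\<forall>g\<in>carrier G. \<forall>h\<in>carrier G. \<alpha> g h \<in> Units F) \<and>
      (\<forall>g\<in>carrier G. \<forall>h\<in>carrier G. \<forall>k\<in>carrier G.
          \<alpha> g h \<otimes>\<^bsub>F\<^esub> \<alpha> (g \<otimes>\<^bsub>G\<^esub> h) k = \<alpha> h k \<otimes>\<^bsub>F\<^esub> \<alpha> g (h \<otimes>\<^bsub>G\<^esub> k)) \<and>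
      (\<forall>g h. \<not> (g \<in> carrier G \<and> h \<in> carrier G) \<longrightarrow> \<alpha> g h = \<one>\<^bsub>F\<^esub>)}"

definition Z2_group :: "('g, 'c) monoid_scheme \<Rightarrow> ('a, 'b) ring_scheme \<Rightarrow> ('g \<Rightarrow> 'g \<Rightarrow> 'a) monoid" where
  "Z2_group G F = \<lparr> carrier = cocycles G F,
                    monoid.mult = (\<lambda>\<alpha> \<beta> g h. \<alpha> g h \<otimes>\<^bsub>F\<^esub> \<beta> g h),
                    one = (\<lambda>g h. \<one>\<^bsub>F\<^esub>) \<rparr>"

definition coboundaries :: "('g, 'c) monoid_scheme \<Rightarrow> ('a, 'b) ring_scheme \<Rightarrow> ('g \<Rightarrow> 'g \<Rightarrow> 'a) set" where
  "coboundaries G F = {\<alpha>. \<exists>f. (\<forall>g\<in>carrier G. f g \<in> Units F) \<and>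
      (\<forall>g h. \<alpha> g h = (if g \<in> carrier G \<and> h \<in> carrier G
                        then f g \<otimes>\<^bsub>F\<^esub> f h \<otimes>\<^bsub>F\<^esub> inv\<^bsub>F\<^esub> (f (g \<otimes>\<^bsub>G\<^esub> h))
                        else \<one>\<^bsub>F\<^esub>))}"

definition H2 :: "('g, 'c) monoid_scheme \<Rightarrow> ('a, 'b) ring_scheme \<Rightarrow> ('g \<Rightarrow> 'g \<Rightarrow> 'a) set monoid" where
  "H2 G F = Z2_group G F Mod coboundaries G F"

text \<open>Twisted group algebra F^\<alpha> G: elements are coefficient functions
  x = \<Sum>_g x(g) u_g (zero outside G), with u_g u_h = \<alpha>(g,h) u_{gh}; its identity is
  \<alpha>(1,1)^{-1} u_1.\<close>
definition twisted_group_algebra ::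
  "('a, 'b) ring_scheme \<Rightarrow> ('g, 'c) monoid_scheme \<Rightarrow> ('g \<Rightarrow> 'g \<Rightarrow> 'a) \<Rightarrow> ('g \<Rightarrow> 'a) ring" where
  "twisted_group_algebra F G \<alpha> =
     \<lparr> carrier = {x. (\<forall>g\<in>carrier G. x g \<in> carrier F) \<and> (\<forall>g. g \<notin> carrier G \<longrightarrow> x g = \<zero>\<^bsub>F\<^esub>)},
       monoid.mult = (\<lambda>x y k. if k \<in> carrier G
           then (\<Oplus>\<^bsub>F\<^esub> g\<in>carrier G. x g \<otimes>\<^bsub>F\<^esub> y (inv\<^bsub>G\<^esub> g \<otimes>\<^bsub>G\<^esub> k) \<otimes>\<^bsub>F\<^esub> \<alpha> g (inv\<^bsub>G\<^esub> g \<otimes>\<^bsub>G\<^esub> k))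
           else \<zero>\<^bsub>F\<^esub>),
       one = (\<lambda>g. if g = \<one>\<^bsub>G\<^esub> then inv\<^bsub>F\<^esub> (\<alpha> \<one>\<^bsub>G\<^esub> \<one>\<^bsub>G\<^esub>) else \<zero>\<^bsub>F\<^esub>),
       ring.zero = (\<lambda>g. \<zero>\<^bsub>F\<^esub>),
       ring.add = (\<lambda>x y g. x g \<oplus>\<^bsub>F\<^esub> y g) \<rparr>"

definition group_algebra :: "('a, 'b) ring_scheme \<Rightarrow> ('g, 'c) monoid_scheme \<Rightarrow> ('g \<Rightarrow> 'a) ring" where
  "group_algebra F G = twisted_group_algebra F G (\<lambda>g h. \<one>\<^bsub>F\<^esub>)"

definition twisted_equiv ::
  "('a, 'b) ring_scheme \<Rightarrow> ('g, 'c) monoid_scheme \<Rightarrow> ('h, 'd) monoid_scheme \<Rightarrow> bool" where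
  "twisted_equiv F G H \<longleftrightarrow>
     (\<exists>\<psi> \<in> iso (H2 G F) (H2 H F).
        \<forall>A \<in> carrier (H2 G F). \<forall>\<alpha> \<in> A. \<forall>\<beta> \<in> \<psi> A.
          twisted_group_algebra F G \<alpha> \<simeq> twisted_group_algebra F H \<beta>)"

definition C8xC2 :: "(int \<times> int) monoid" where
  "C8xC2 = integer_mod_group 8 \<times>\<times> integer_mod_group 2"

definition C4xC4 :: "(int \<times> int) monoid" where
  "C4xC4 = integer_mod_group 4 \<times>\<times> integer_mod_group 4"

end

(*
  Over a field of order q = 3 mod 4 the class of a cocycle on C_m x C_n (m, n powers of 2, n dividing 4)
  is determined by three signs: the quadratic characters of the constants u_x^m and u_y^n and
  the commutator of u_x and u_y; hence both cohomology groups are elementary abelian of order 8.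
  The group algebras agree because 2 or -2 is a square, which produces an element of order 8
  inside the group algebra of C_4 x C_4.

  For the negative part there are three cases.  In characteristic 2, the fourth power of every element
  of a commutative twisted group algebra of C_4 x C_4 is a scalar, so x^16 = 0 implies x^4 = 0, which
  fails for C_8 x C_2.  If -1 is a square i^2, the cocycle on C_4 x C_4 with commutator i has a
  non-symmetric square, whereas all squares on C_8 x C_2 are symmetric.  Otherwise take the cocycle
  on C_8 x C_2 with u_x^8 = u_y^2 = 1 and anticommuting u_x, u_y: its algebra has center
  F + F + F(i), which contains i on one component but not globally.  The noncommutative twisted group
  algebras of C_4 x C_4 have center F[z, w] / (z^2 - a, w^2 - b), whose components are all conjugate.
*)
theory Submission
  imports Defs "HOL-Number_Theory.Residues"
begin

section \<open>Twisted group algebras are rings\<close>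

text \<open>Equivalence supplies isomorphisms of rings, not of F-algebras, along an arbitrary group
  isomorphism \<psi> of the cohomology groups. So every obstruction has to be visible in the bare
  ring: commutativity, nilpotency, the center and square roots of -1 in it. If F contains i, squares
  make the comparison independent of \<psi>: squares go to squares, and the commutator c of the
  generators satisfies c^2 = 1 on C_8 x C_2 because u_y^2 is a scalar, while on C_4 x C_4 only c^4 =
  1 is forced. If F lacks i, the same relation c^4 = 1 leaves c = -1 as the only noncommutative
  case. The components of the center are never constructed: a central idempotent e with a central y
  such that e y = y and y^2 = -e records that i exists on part of the ring, and ring isomorphisms
  preserve such a pair. In the positive part d = (q - 1) / 2 is odd, so every u with u^d = 1 is an
  m-th power for each power m of 2; only signs survive in cohomology. The element of order 8 comes
  from (1 + i)^2 = 2 i, divided by a square root of 2 or -2.\<close>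

lemma (in abelian_monoid) finsum_swap:
  assumes "finite A" "finite B" "\<And>a b. a \<in> A \<Longrightarrow> b \<in> B \<Longrightarrow> f a b \<in> carrier G"
  shows "(\<Oplus>a\<in>A. \<Oplus>b\<in>B. f a b) = (\<Oplus>b\<in>B. \<Oplus>a\<in>A. f a b)"
  using assms(1,3)
proof (induction A rule: finite_induct)
  case empty
  then show ?case by simp
next
  case (insert x A)
  then have "(\<Oplus>a\<in>insert x A. \<Oplus>b\<in>B. f a b) = (\<Oplus>b\<in>B. f x b) \<oplus> (\<Oplus>b\<in>B. \<Oplus>a\<in>A. f a b)"
    by (subst finsum_insert) (auto intro!: finsum_closed)
  also have "\<dots> = (\<Oplus>b\<in>B. f x b \<oplus> (\<Oplus>a\<in>A. f a b))"
    using insert.prems by (subst finsum_addf) (auto intro!: finsum_closed)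
  also have "\<dots> = (\<Oplus>b\<in>B. \<Oplus>a\<in>insert x A. f a b)"
    using insert by (intro finsum_cong') (auto intro!: finsum_closed)
  finally show ?case .
qed

locale twisted_algebra = G: group G + F: cring F
  for G :: "('g, 'c) monoid_scheme" and F :: "('a, 'b) ring_scheme" +
  fixes \<alpha> :: "'g \<Rightarrow> 'g \<Rightarrow> 'a"
  assumes fin: "finite (carrier G)"
    and cocycle: "\<alpha> \<in> cocycles G F"
begin

abbreviation A where "A \<equiv> twisted_group_algebra F G \<alpha>"

lemma unit [simp]: "g \<in> carrier G \<Longrightarrow> h \<in> carrier G \<Longrightarrow> \<alpha> g h \<in> Units F"
  using cocycle by (simp add: cocycles_def)

lemma closed [simp]: "g \<in> carrier G \<Longrightarrow> h \<in> carrier G \<Longrightarrow> \<alpha> g h \<in> carrier F"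
  using unit by blast

lemma cocycle_eq:
  "g \<in> carrier G \<Longrightarrow> h \<in> carrier G \<Longrightarrow> k \<in> carrier G \<Longrightarrow>
    \<alpha> g h \<otimes>\<^bsub>F\<^esub> \<alpha> (g \<otimes>\<^bsub>G\<^esub> h) k = \<alpha> h k \<otimes>\<^bsub>F\<^esub> \<alpha> g (h \<otimes>\<^bsub>G\<^esub> k)"
  using cocycle by (simp add: cocycles_def)

text \<open>The cocycle identity at (1, 1, g) reads \<alpha>(1,1) \<alpha>(1,g) = \<alpha>(1,g)
  \<alpha>(1,g), and a unit cancels. Cocycles may have \<alpha>(1,1) different from 1, so this
  constant has to be carried along.\<close>

lemma one_left: "g \<in> carrier G \<Longrightarrow> \<alpha> \<one>\<^bsub>G\<^esub> g = \<alpha> \<one>\<^bsub>G\<^esub> \<one>\<^bsub>G\<^esub>"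
  using cocycle_eq[of "\<one>\<^bsub>G\<^esub>" "\<one>\<^bsub>G\<^esub>" g] unit[of "\<one>\<^bsub>G\<^esub>" g] unit[of "\<one>\<^bsub>G\<^esub>" "\<one>\<^bsub>G\<^esub>"]
  by (metis F.Units_closed F.Units_l_cancel F.m_comm G.l_one G.one_closed)

lemma one_right: "g \<in> carrier G \<Longrightarrow> \<alpha> g \<one>\<^bsub>G\<^esub> = \<alpha> \<one>\<^bsub>G\<^esub> \<one>\<^bsub>G\<^esub>"
  using cocycle_eq[of g "\<one>\<^bsub>G\<^esub>" "\<one>\<^bsub>G\<^esub>"] unit[of g "\<one>\<^bsub>G\<^esub>"] unit[of "\<one>\<^bsub>G\<^esub>" "\<one>\<^bsub>G\<^esub>"]
  by (metis F.Units_closed F.Units_l_cancel F.m_comm G.r_one G.one_closed)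

lemma carrierI: "(\<And>g. g \<in> carrier G \<Longrightarrow> x g \<in> carrier F) \<Longrightarrow> (\<And>g. g \<notin> carrier G \<Longrightarrow> x g = \<zero>\<^bsub>F\<^esub>) \<Longrightarrow> x \<in> carrier A"
  by (simp add: twisted_group_algebra_def)

lemma coeff_closed: "x \<in> carrier A \<Longrightarrow> x g \<in> carrier F"
  by (cases "g \<in> carrier G") (auto simp: twisted_group_algebra_def)

lemma coeff_outside: "x \<in> carrier A \<Longrightarrow> g \<notin> carrier G \<Longrightarrow> x g = \<zero>\<^bsub>F\<^esub>"
  by (auto simp: twisted_group_algebra_def)

lemma carrier_eqI:
  "x \<in> carrier A \<Longrightarrow> y \<in> carrier A \<Longrightarrow> (\<And>g. g \<in> carrier G \<Longrightarrow> x g = y g) \<Longrightarrow> x = y"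
  by (rule ext) (metis coeff_outside)

lemma add_coeff [simp]: "(x \<oplus>\<^bsub>A\<^esub> y) g = x g \<oplus>\<^bsub>F\<^esub> y g"
  by (simp add: twisted_group_algebra_def)

lemma zero_coeff [simp]: "\<zero>\<^bsub>A\<^esub> g = \<zero>\<^bsub>F\<^esub>"
  by (simp add: twisted_group_algebra_def)

lemma mult_coeff: "k \<in> carrier G \<Longrightarrow> (x \<otimes>\<^bsub>A\<^esub> y) k =
    (\<Oplus>\<^bsub>F\<^esub>g\<in>carrier G. x g \<otimes>\<^bsub>F\<^esub> y (inv\<^bsub>G\<^esub> g \<otimes>\<^bsub>G\<^esub> k) \<otimes>\<^bsub>F\<^esub> \<alpha> g (inv\<^bsub>G\<^esub> g \<otimes>\<^bsub>G\<^esub> k))"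
  by (simp add: twisted_group_algebra_def)

lemma one_coeff: "\<one>\<^bsub>A\<^esub> g = (if g = \<one>\<^bsub>G\<^esub> then inv\<^bsub>F\<^esub> (\<alpha> \<one>\<^bsub>G\<^esub> \<one>\<^bsub>G\<^esub>) else \<zero>\<^bsub>F\<^esub>)"
  by (simp add: twisted_group_algebra_def)

lemma mult_coeff_outside: "k \<notin> carrier G \<Longrightarrow> (x \<otimes>\<^bsub>A\<^esub> y) k = \<zero>\<^bsub>F\<^esub>"
  by (simp add: twisted_group_algebra_def)

declare coeff_closed [simp]

lemma mult_closed: "x \<in> carrier A \<Longrightarrow> y \<in> carrier A \<Longrightarrow> x \<otimes>\<^bsub>A\<^esub> y \<in> carrier A"
  by (rule carrierI) (auto intro!: F.finsum_closed simp: mult_coeff mult_coeff_outside)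

lemma one_closed: "\<one>\<^bsub>A\<^esub> \<in> carrier A"
  by (rule carrierI) (auto simp: one_coeff)

lemma finsum_single:
  assumes "g \<in> carrier G" "\<And>k. k \<in> carrier G \<Longrightarrow> f k \<in> carrier F"
    "\<And>k. k \<in> carrier G \<Longrightarrow> k \<noteq> g \<Longrightarrow> f k = \<zero>\<^bsub>F\<^esub>"
  shows "(\<Oplus>\<^bsub>F\<^esub>k\<in>carrier G. f k) = f g"
proof -
  have "(\<Oplus>\<^bsub>F\<^esub>k\<in>carrier G. f k) = (\<Oplus>\<^bsub>F\<^esub>k\<in>carrier G. if g = k then f k else \<zero>\<^bsub>F\<^esub>)"
    using assms by (intro F.finsum_cong') auto
  also have "\<dots> = f g"
    using assms fin by (intro F.finsum_singleton) auto
  finally show ?thesis .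
qed

lemma finsum_translate:
  assumes "a \<in> carrier G" "\<And>k. k \<in> carrier G \<Longrightarrow> f k \<in> carrier F"
  shows "(\<Oplus>\<^bsub>F\<^esub>k\<in>carrier G. f k) = (\<Oplus>\<^bsub>F\<^esub>k\<in>carrier G. f (a \<otimes>\<^bsub>G\<^esub> k))"
proof -
  have im: "(\<lambda>k. a \<otimes>\<^bsub>G\<^esub> k) ` carrier G = carrier G"
    using G.surj_const_mult[OF assms(1)] .
  have "inj_on (\<lambda>k. a \<otimes>\<^bsub>G\<^esub> k) (carrier G)"
    using G.inj_on_cmult[OF assms(1)] .
  then show ?thesis
    using F.add.finprod_reindex[of f "\<lambda>k. a \<otimes>\<^bsub>G\<^esub> k" "carrier G"] assms im by (auto simp: Pi_def)
qed

text \<open>Both coefficients at k are double sums. After exchanging the order of summation and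
  substituting g = a b, the terms are indexed by factorisations k = a b c, and each pair of terms
  agrees by the cocycle identity at (a, b, c).\<close>

lemma assoc:
  assumes x: "x \<in> carrier A" and y: "y \<in> carrier A" and z: "z \<in> carrier A"
  shows "(x \<otimes>\<^bsub>A\<^esub> y) \<otimes>\<^bsub>A\<^esub> z = x \<otimes>\<^bsub>A\<^esub> (y \<otimes>\<^bsub>A\<^esub> z)"
proof (rule carrier_eqI)
  fix k assume k: "k \<in> carrier G"
  note [simp] = x y z fin k
  have "((x \<otimes>\<^bsub>A\<^esub> y) \<otimes>\<^bsub>A\<^esub> z) k = (\<Oplus>\<^bsub>F\<^esub>g\<in>carrier G. \<Oplus>\<^bsub>F\<^esub>a\<in>carrier G.
     x a \<otimes>\<^bsub>F\<^esub> y (inv\<^bsub>G\<^esub> a \<otimes>\<^bsub>G\<^esub> g) \<otimes>\<^bsub>F\<^esub> \<alpha> a (inv\<^bsub>G\<^esub> a \<otimes>\<^bsub>G\<^esub> g) \<otimes>\<^bsub>F\<^esub> (z (inv\<^bsub>G\<^esub> g \<otimes>\<^bsub>G\<^esub> k) \<otimes>\<^bsub>F\<^esub> \<alpha> g (inv\<^bsub>G\<^esub> g \<otimes>\<^bsub>G\<^esub> k)))"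
    unfolding mult_coeff[OF k, of "x \<otimes>\<^bsub>A\<^esub> y"]
    by (intro F.finsum_cong' refl)
      (simp_all add: F.m_assoc mult_closed, simp_all add: mult_coeff F.finsum_ldistr Pi_def)
  also have "\<dots> = (\<Oplus>\<^bsub>F\<^esub>a\<in>carrier G. \<Oplus>\<^bsub>F\<^esub>g\<in>carrier G.
     x a \<otimes>\<^bsub>F\<^esub> y (inv\<^bsub>G\<^esub> a \<otimes>\<^bsub>G\<^esub> g) \<otimes>\<^bsub>F\<^esub> \<alpha> a (inv\<^bsub>G\<^esub> a \<otimes>\<^bsub>G\<^esub> g) \<otimes>\<^bsub>F\<^esub> (z (inv\<^bsub>G\<^esub> g \<otimes>\<^bsub>G\<^esub> k) \<otimes>\<^bsub>F\<^esub> \<alpha> g (inv\<^bsub>G\<^esub> g \<otimes>\<^bsub>G\<^esub> k)))"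
    by (rule F.finsum_swap) auto
  also have "\<dots> = (\<Oplus>\<^bsub>F\<^esub>a\<in>carrier G. x a \<otimes>\<^bsub>F\<^esub> (y \<otimes>\<^bsub>A\<^esub> z) (inv\<^bsub>G\<^esub> a \<otimes>\<^bsub>G\<^esub> k) \<otimes>\<^bsub>F\<^esub> \<alpha> a (inv\<^bsub>G\<^esub> a \<otimes>\<^bsub>G\<^esub> k))"
  proof (intro F.finsum_cong' refl)
    fix a assume a [simp]: "a \<in> carrier G"
    have "(\<Oplus>\<^bsub>F\<^esub>g\<in>carrier G.
       x a \<otimes>\<^bsub>F\<^esub> y (inv\<^bsub>G\<^esub> a \<otimes>\<^bsub>G\<^esub> g) \<otimes>\<^bsub>F\<^esub> \<alpha> a (inv\<^bsub>G\<^esub> a \<otimes>\<^bsub>G\<^esub> g) \<otimes>\<^bsub>F\<^esub> (z (inv\<^bsub>G\<^esub> g \<otimes>\<^bsub>G\<^esub> k) \<otimes>\<^bsub>F\<^esub> \<alpha> g (inv\<^bsub>G\<^esub> g \<otimes>\<^bsub>G\<^esub> k)))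
     = (\<Oplus>\<^bsub>F\<^esub>b\<in>carrier G.
       x a \<otimes>\<^bsub>F\<^esub> (y b \<otimes>\<^bsub>F\<^esub> z (inv\<^bsub>G\<^esub> b \<otimes>\<^bsub>G\<^esub> (inv\<^bsub>G\<^esub> a \<otimes>\<^bsub>G\<^esub> k)) \<otimes>\<^bsub>F\<^esub> \<alpha> b (inv\<^bsub>G\<^esub> b \<otimes>\<^bsub>G\<^esub> (inv\<^bsub>G\<^esub> a \<otimes>\<^bsub>G\<^esub> k))) \<otimes>\<^bsub>F\<^esub> \<alpha> a (inv\<^bsub>G\<^esub> a \<otimes>\<^bsub>G\<^esub> k))"
    proof (subst finsum_translate[of a], simp, simp, intro F.finsum_cong' refl)
      fix b assume b [simp]: "b \<in> carrier G"
      define c where "c = inv\<^bsub>G\<^esub> b \<otimes>\<^bsub>G\<^esub> (inv\<^bsub>G\<^esub> a \<otimes>\<^bsub>G\<^esub> k)"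
      have c [simp]: "c \<in> carrier G" by (simp add: c_def)
      have e1: "inv\<^bsub>G\<^esub> a \<otimes>\<^bsub>G\<^esub> (a \<otimes>\<^bsub>G\<^esub> b) = b"
        by (simp add: G.m_assoc[symmetric])
      have e2: "inv\<^bsub>G\<^esub> (a \<otimes>\<^bsub>G\<^esub> b) \<otimes>\<^bsub>G\<^esub> k = c"
        by (simp add: c_def G.inv_mult_group G.m_assoc)
      have e3: "inv\<^bsub>G\<^esub> a \<otimes>\<^bsub>G\<^esub> k = b \<otimes>\<^bsub>G\<^esub> c"
        by (simp add: c_def G.m_assoc[symmetric])
      show "x a \<otimes>\<^bsub>F\<^esub> y (inv\<^bsub>G\<^esub> a \<otimes>\<^bsub>G\<^esub> (a \<otimes>\<^bsub>G\<^esub> b)) \<otimes>\<^bsub>F\<^esub> \<alpha> a (inv\<^bsub>G\<^esub> a \<otimes>\<^bsub>G\<^esub> (a \<otimes>\<^bsub>G\<^esub> b)) \<otimes>\<^bsub>F\<^esub>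
          (z (inv\<^bsub>G\<^esub> (a \<otimes>\<^bsub>G\<^esub> b) \<otimes>\<^bsub>G\<^esub> k) \<otimes>\<^bsub>F\<^esub> \<alpha> (a \<otimes>\<^bsub>G\<^esub> b) (inv\<^bsub>G\<^esub> (a \<otimes>\<^bsub>G\<^esub> b) \<otimes>\<^bsub>G\<^esub> k)) =
        x a \<otimes>\<^bsub>F\<^esub> (y b \<otimes>\<^bsub>F\<^esub> z (inv\<^bsub>G\<^esub> b \<otimes>\<^bsub>G\<^esub> (inv\<^bsub>G\<^esub> a \<otimes>\<^bsub>G\<^esub> k)) \<otimes>\<^bsub>F\<^esub> \<alpha> b (inv\<^bsub>G\<^esub> b \<otimes>\<^bsub>G\<^esub> (inv\<^bsub>G\<^esub> a \<otimes>\<^bsub>G\<^esub> k))) \<otimes>\<^bsub>F\<^esub> \<alpha> a (inv\<^bsub>G\<^esub> a \<otimes>\<^bsub>G\<^esub> k)"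
        unfolding c_def[symmetric] e1 e2 unfolding e3
        using cocycle_eq[OF a b c] by (simp add: F.m_ac x y z)
    qed auto
    also have "\<dots> = x a \<otimes>\<^bsub>F\<^esub> (y \<otimes>\<^bsub>A\<^esub> z) (inv\<^bsub>G\<^esub> a \<otimes>\<^bsub>G\<^esub> k) \<otimes>\<^bsub>F\<^esub> \<alpha> a (inv\<^bsub>G\<^esub> a \<otimes>\<^bsub>G\<^esub> k)"
      by (simp add: mult_coeff F.finsum_ldistr F.finsum_rdistr Pi_def)
    finally show "(\<Oplus>\<^bsub>F\<^esub>g\<in>carrier G.
       x a \<otimes>\<^bsub>F\<^esub> y (inv\<^bsub>G\<^esub> a \<otimes>\<^bsub>G\<^esub> g) \<otimes>\<^bsub>F\<^esub> \<alpha> a (inv\<^bsub>G\<^esub> a \<otimes>\<^bsub>G\<^esub> g) \<otimes>\<^bsub>F\<^esub> (z (inv\<^bsub>G\<^esub> g \<otimes>\<^bsub>G\<^esub> k) \<otimes>\<^bsub>F\<^esub> \<alpha> g (inv\<^bsub>G\<^esub> g \<otimes>\<^bsub>G\<^esub> k)))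
      = x a \<otimes>\<^bsub>F\<^esub> (y \<otimes>\<^bsub>A\<^esub> z) (inv\<^bsub>G\<^esub> a \<otimes>\<^bsub>G\<^esub> k) \<otimes>\<^bsub>F\<^esub> \<alpha> a (inv\<^bsub>G\<^esub> a \<otimes>\<^bsub>G\<^esub> k)" .
  qed (auto simp: mult_closed)
  also have "\<dots> = (x \<otimes>\<^bsub>A\<^esub> (y \<otimes>\<^bsub>A\<^esub> z)) k"
    by (simp add: mult_coeff[OF k])
  finally show "((x \<otimes>\<^bsub>A\<^esub> y) \<otimes>\<^bsub>A\<^esub> z) k = (x \<otimes>\<^bsub>A\<^esub> (y \<otimes>\<^bsub>A\<^esub> z)) k" .
qed (auto intro!: mult_closed assms)

section \<open>Homogeneous elements c u_g and the ring axioms\<close>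

definition single :: "'g \<Rightarrow> 'a \<Rightarrow> 'g \<Rightarrow> 'a" where
  "single g c = (\<lambda>k. if k = g then c else \<zero>\<^bsub>F\<^esub>)"

lemma single_closed [simp]: "g \<in> carrier G \<Longrightarrow> c \<in> carrier F \<Longrightarrow> single g c \<in> carrier A"
  by (rule carrierI) (auto simp: single_def)

lemma single_mult_coeff:
  assumes "g \<in> carrier G" "c \<in> carrier F" "x \<in> carrier A" "k \<in> carrier G"
  shows "(single g c \<otimes>\<^bsub>A\<^esub> x) k = c \<otimes>\<^bsub>F\<^esub> x (inv\<^bsub>G\<^esub> g \<otimes>\<^bsub>G\<^esub> k) \<otimes>\<^bsub>F\<^esub> \<alpha> g (inv\<^bsub>G\<^esub> g \<otimes>\<^bsub>G\<^esub> k)"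
  unfolding mult_coeff[OF assms(4)]
  using assms by (subst finsum_single[of g]) (auto simp: single_def)

lemma mult_single_coeff:
  assumes "g \<in> carrier G" "c \<in> carrier F" "x \<in> carrier A" "k \<in> carrier G"
  shows "(x \<otimes>\<^bsub>A\<^esub> single g c) k = x (k \<otimes>\<^bsub>G\<^esub> inv\<^bsub>G\<^esub> g) \<otimes>\<^bsub>F\<^esub> c \<otimes>\<^bsub>F\<^esub> \<alpha> (k \<otimes>\<^bsub>G\<^esub> inv\<^bsub>G\<^esub> g) g"
proof -
  have e: "inv\<^bsub>G\<^esub> (k \<otimes>\<^bsub>G\<^esub> inv\<^bsub>G\<^esub> g) \<otimes>\<^bsub>G\<^esub> k = g"
    using assms by (simp add: G.inv_mult_group G.m_assoc)
  have "inv\<^bsub>G\<^esub> h \<otimes>\<^bsub>G\<^esub> k \<noteq> g" if "h \<in> carrier G" "h \<noteq> k \<otimes>\<^bsub>G\<^esub> inv\<^bsub>G\<^esub> g" for h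
    using that assms by (metis G.inv_closed G.inv_inv G.inv_mult_group G.inv_solve_left' G.m_closed)
  then show ?thesis
    unfolding mult_coeff[OF assms(4)]
    using assms by (subst finsum_single[of "k \<otimes>\<^bsub>G\<^esub> inv\<^bsub>G\<^esub> g"]) (auto simp: single_def e)
qed

lemma single_mult [simp]:
  assumes "g \<in> carrier G" "c \<in> carrier F" "h \<in> carrier G" "d \<in> carrier F"
  shows "single g c \<otimes>\<^bsub>A\<^esub> single h d = single (g \<otimes>\<^bsub>G\<^esub> h) (c \<otimes>\<^bsub>F\<^esub> d \<otimes>\<^bsub>F\<^esub> \<alpha> g h)"
proof (rule carrier_eqI)
  fix k assume k: "k \<in> carrier G"
  show "(single g c \<otimes>\<^bsub>A\<^esub> single h d) k = single (g \<otimes>\<^bsub>G\<^esub> h) (c \<otimes>\<^bsub>F\<^esub> d \<otimes>\<^bsub>F\<^esub> \<alpha> g h) k"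
    using assms k
    by (simp add: single_mult_coeff) (auto simp: single_def G.inv_solve_left' G.m_assoc[symmetric])
qed (use assms in \<open>auto intro!: mult_closed\<close>)

lemma one_eq: "\<one>\<^bsub>A\<^esub> = single \<one>\<^bsub>G\<^esub> (inv\<^bsub>F\<^esub> (\<alpha> \<one>\<^bsub>G\<^esub> \<one>\<^bsub>G\<^esub>))"
  by (rule ext) (simp add: one_coeff single_def)

lemma add_closed: "x \<in> carrier A \<Longrightarrow> y \<in> carrier A \<Longrightarrow> x \<oplus>\<^bsub>A\<^esub> y \<in> carrier A"
  by (rule carrierI) (simp_all add: coeff_outside[of x] coeff_outside[of y])

lemma zero_closed: "\<zero>\<^bsub>A\<^esub> \<in> carrier A"
  by (rule carrierI) simp_all

lemma is_ring: "ring A"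
proof (rule ringI)
  show "abelian_group A"
  proof (rule abelian_groupI)
    fix x assume x: "x \<in> carrier A"
    have "(\<lambda>g. \<ominus>\<^bsub>F\<^esub> x g) \<in> carrier A"
      by (rule carrierI) (use x in \<open>simp_all add: coeff_outside[OF x]\<close>)
    then show "\<exists>y\<in>carrier A. y \<oplus>\<^bsub>A\<^esub> x = \<zero>\<^bsub>A\<^esub>"
    proof (rule bexI[rotated])
      show "(\<lambda>g. \<ominus>\<^bsub>F\<^esub> x g) \<oplus>\<^bsub>A\<^esub> x = \<zero>\<^bsub>A\<^esub>"
        by (rule ext) (use x in \<open>simp add: F.l_neg\<close>)
    qed
    show "\<zero>\<^bsub>A\<^esub> \<oplus>\<^bsub>A\<^esub> x = x"
      by (rule carrier_eqI) (use x in \<open>simp_all add: add_closed zero_closed\<close>)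
    fix y assume y: "y \<in> carrier A"
    show "x \<oplus>\<^bsub>A\<^esub> y = y \<oplus>\<^bsub>A\<^esub> x"
      by (rule carrier_eqI) (use x y in \<open>simp_all add: add_closed F.a_ac\<close>)
    fix z assume z: "z \<in> carrier A"
    show "(x \<oplus>\<^bsub>A\<^esub> y) \<oplus>\<^bsub>A\<^esub> z = x \<oplus>\<^bsub>A\<^esub> (y \<oplus>\<^bsub>A\<^esub> z)"
      by (rule carrier_eqI) (use x y z in \<open>simp_all add: add_closed F.a_ac\<close>)
  qed (simp_all add: add_closed zero_closed)
  show "monoid A"
  proof (rule monoidI)
    fix x assume x: "x \<in> carrier A"
    have one: "single \<one>\<^bsub>G\<^esub> (inv\<^bsub>F\<^esub> (\<alpha> \<one>\<^bsub>G\<^esub> \<one>\<^bsub>G\<^esub>)) \<in> carrier A"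
      by simp
    show "\<one>\<^bsub>A\<^esub> \<otimes>\<^bsub>A\<^esub> x = x"
      unfolding one_eq
    proof (rule carrier_eqI)
      fix k assume k: "k \<in> carrier G"
      show "(single \<one>\<^bsub>G\<^esub> (inv\<^bsub>F\<^esub> (\<alpha> \<one>\<^bsub>G\<^esub> \<one>\<^bsub>G\<^esub>)) \<otimes>\<^bsub>A\<^esub> x) k = x k"
        using x k by (simp add: single_mult_coeff one_left[OF k] F.m_ac)
    qed (use x one in \<open>simp_all add: mult_closed\<close>)
    show "x \<otimes>\<^bsub>A\<^esub> \<one>\<^bsub>A\<^esub> = x"
      unfolding one_eq
    proof (rule carrier_eqI)
      fix k assume k: "k \<in> carrier G"
      show "(x \<otimes>\<^bsub>A\<^esub> single \<one>\<^bsub>G\<^esub> (inv\<^bsub>F\<^esub> (\<alpha> \<one>\<^bsub>G\<^esub> \<one>\<^bsub>G\<^esub>))) k = x k"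
        using x k by (simp add: mult_single_coeff one_right[OF k] F.m_ac)
    qed (use x one in \<open>simp_all add: mult_closed\<close>)
  qed (auto simp: mult_closed one_closed assoc)
  fix x y z assume x: "x \<in> carrier A" and y: "y \<in> carrier A" and z: "z \<in> carrier A"
  note [simp] = add_closed mult_closed x y z
  show "(x \<oplus>\<^bsub>A\<^esub> y) \<otimes>\<^bsub>A\<^esub> z = x \<otimes>\<^bsub>A\<^esub> z \<oplus>\<^bsub>A\<^esub> y \<otimes>\<^bsub>A\<^esub> z"
  proof (rule carrier_eqI)
    fix k assume k: "k \<in> carrier G"
    have "((x \<oplus>\<^bsub>A\<^esub> y) \<otimes>\<^bsub>A\<^esub> z) k = (\<Oplus>\<^bsub>F\<^esub>g\<in>carrier G.
        x g \<otimes>\<^bsub>F\<^esub> z (inv\<^bsub>G\<^esub> g \<otimes>\<^bsub>G\<^esub> k) \<otimes>\<^bsub>F\<^esub> \<alpha> g (inv\<^bsub>G\<^esub> g \<otimes>\<^bsub>G\<^esub> k) \<oplus>\<^bsub>F\<^esub>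
        y g \<otimes>\<^bsub>F\<^esub> z (inv\<^bsub>G\<^esub> g \<otimes>\<^bsub>G\<^esub> k) \<otimes>\<^bsub>F\<^esub> \<alpha> g (inv\<^bsub>G\<^esub> g \<otimes>\<^bsub>G\<^esub> k))"
      unfolding mult_coeff[OF k] by (intro F.finsum_cong') (use k in \<open>auto simp: F.l_distr\<close>)
    also have "\<dots> = (x \<otimes>\<^bsub>A\<^esub> z \<oplus>\<^bsub>A\<^esub> y \<otimes>\<^bsub>A\<^esub> z) k"
      using k by (subst F.finsum_addf) (auto simp: mult_coeff)
    finally show "((x \<oplus>\<^bsub>A\<^esub> y) \<otimes>\<^bsub>A\<^esub> z) k = (x \<otimes>\<^bsub>A\<^esub> z \<oplus>\<^bsub>A\<^esub> y \<otimes>\<^bsub>A\<^esub> z) k" .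
  qed simp_all
  show "z \<otimes>\<^bsub>A\<^esub> (x \<oplus>\<^bsub>A\<^esub> y) = z \<otimes>\<^bsub>A\<^esub> x \<oplus>\<^bsub>A\<^esub> z \<otimes>\<^bsub>A\<^esub> y"
  proof (rule carrier_eqI)
    fix k assume k: "k \<in> carrier G"
    have "(z \<otimes>\<^bsub>A\<^esub> (x \<oplus>\<^bsub>A\<^esub> y)) k = (\<Oplus>\<^bsub>F\<^esub>g\<in>carrier G.
        z g \<otimes>\<^bsub>F\<^esub> x (inv\<^bsub>G\<^esub> g \<otimes>\<^bsub>G\<^esub> k) \<otimes>\<^bsub>F\<^esub> \<alpha> g (inv\<^bsub>G\<^esub> g \<otimes>\<^bsub>G\<^esub> k) \<oplus>\<^bsub>F\<^esub>
        z g \<otimes>\<^bsub>F\<^esub> y (inv\<^bsub>G\<^esub> g \<otimes>\<^bsub>G\<^esub> k) \<otimes>\<^bsub>F\<^esub> \<alpha> g (inv\<^bsub>G\<^esub> g \<otimes>\<^bsub>G\<^esub> k))"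
      unfolding mult_coeff[OF k] by (intro F.finsum_cong') (use k in \<open>auto simp: F.l_distr F.r_distr\<close>)
    also have "\<dots> = (z \<otimes>\<^bsub>A\<^esub> x \<oplus>\<^bsub>A\<^esub> z \<otimes>\<^bsub>A\<^esub> y) k"
      using k by (subst F.finsum_addf) (auto simp: mult_coeff)
    finally show "(z \<otimes>\<^bsub>A\<^esub> (x \<oplus>\<^bsub>A\<^esub> y)) k = (z \<otimes>\<^bsub>A\<^esub> x \<oplus>\<^bsub>A\<^esub> z \<otimes>\<^bsub>A\<^esub> y) k" .
  qed simp_all
qed

sublocale A: ring A
  by (rule is_ring)

lemma finsum_coeff:
  assumes "finite B" "\<And>b. b \<in> B \<Longrightarrow> f b \<in> carrier A"
  shows "(\<Oplus>\<^bsub>A\<^esub>b\<in>B. f b) g = (\<Oplus>\<^bsub>F\<^esub>b\<in>B. f b g)"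
  using assms
proof (induction B rule: finite_induct)
  case (insert b B)
  then show ?case
    by (subst A.finsum_insert) (auto simp: F.finsum_insert)
qed auto

lemma single_expansion:
  assumes x: "x \<in> carrier A"
  shows "x = (\<Oplus>\<^bsub>A\<^esub>g\<in>carrier G. single g (x g))"
proof (rule carrier_eqI)
  fix k assume k: "k \<in> carrier G"
  show "x k = (\<Oplus>\<^bsub>A\<^esub>g\<in>carrier G. single g (x g)) k"
    by (subst finsum_coeff, simp add: fin, use x in simp, subst finsum_single[of k])
      (use x k in \<open>auto simp: single_def\<close>)
qed (use x in \<open>auto intro!: A.finsum_closed\<close>)

lemma single_add: "c \<in> carrier F \<Longrightarrow> d \<in> carrier F \<Longrightarrow> single g c \<oplus>\<^bsub>A\<^esub> single g d = single g (c \<oplus>\<^bsub>F\<^esub> d)"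
  by (rule ext) (auto simp: single_def)

text \<open>In an abelian group the involution g -> g^-1 k exchanges the two arguments of each term
  of the convolution at k. Symmetry is demanded only for g in the support of x, so the lemma also
  detects central elements of noncommutative algebras.\<close>

lemma symmetric_commutes:
  assumes sym: "\<And>g h. g \<in> carrier G \<Longrightarrow> h \<in> carrier G \<Longrightarrow> x g \<noteq> \<zero>\<^bsub>F\<^esub> \<Longrightarrow> \<alpha> g h = \<alpha> h g"
    and G: "comm_group G" and x: "x \<in> carrier A" and y: "y \<in> carrier A"
  shows "x \<otimes>\<^bsub>A\<^esub> y = y \<otimes>\<^bsub>A\<^esub> x"
proof (rule carrier_eqI)
  interpret comm_group G by fact
  fix k assume k: "k \<in> carrier G"
  define i where "i g = inv\<^bsub>G\<^esub> g \<otimes>\<^bsub>G\<^esub> k" for g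
  have i: "i g \<in> carrier G" "i (i g) = g" if "g \<in> carrier G" for g
    using that k by (auto simp: i_def G.inv_mult_group G.m_assoc) (metis G.inv_closed G.inv_solve_left G.m_closed m_comm)
  have im: "i ` carrier G = carrier G"
    using i by (metis image_subset_iff subsetI subset_antisym imageI)
  have inj: "inj_on i (carrier G)"
    using i(2) by (metis inj_onI)
  have "(x \<otimes>\<^bsub>A\<^esub> y) k = (\<Oplus>\<^bsub>F\<^esub>g\<in>i ` carrier G. x g \<otimes>\<^bsub>F\<^esub> y (i g) \<otimes>\<^bsub>F\<^esub> \<alpha> g (i g))"
    using k im by (simp add: mult_coeff i_def)
  also have "\<dots> = (\<Oplus>\<^bsub>F\<^esub>g\<in>carrier G. x (i g) \<otimes>\<^bsub>F\<^esub> y (i (i g)) \<otimes>\<^bsub>F\<^esub> \<alpha> (i g) (i (i g)))"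
    using x y i im inj by (intro F.finsum_reindex) auto
  also have "\<dots> = (\<Oplus>\<^bsub>F\<^esub>g\<in>carrier G. y g \<otimes>\<^bsub>F\<^esub> x (i g) \<otimes>\<^bsub>F\<^esub> \<alpha> g (i g))"
  proof (intro F.finsum_cong' refl)
    fix g assume g: "g \<in> carrier G"
    show "x (i g) \<otimes>\<^bsub>F\<^esub> y (i (i g)) \<otimes>\<^bsub>F\<^esub> \<alpha> (i g) (i (i g)) = y g \<otimes>\<^bsub>F\<^esub> x (i g) \<otimes>\<^bsub>F\<^esub> \<alpha> g (i g)"
      using x y i g sym[of "i g" g] by (cases "x (i g) = \<zero>\<^bsub>F\<^esub>") (auto simp: F.m_ac)
  qed (use x y i in auto)
  also have "\<dots> = (y \<otimes>\<^bsub>A\<^esub> x) k"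
    using k by (simp add: mult_coeff i_def)
  finally show "(x \<otimes>\<^bsub>A\<^esub> y) k = (y \<otimes>\<^bsub>A\<^esub> x) k" .
qed (use x y in \<open>auto simp: mult_closed\<close>)

end

section \<open>Cocycles and the second cohomology group\<close>

lemma (in comm_monoid) inv_mult_units:
  assumes "x \<in> Units G" "y \<in> Units G"
  shows "inv (x \<otimes> y) = inv x \<otimes> inv y"
proof -
  have "(x \<otimes> y) \<otimes> (inv x \<otimes> inv y) = (x \<otimes> inv x) \<otimes> (y \<otimes> inv y)"
    using assms by (simp only: m_ac Units_closed Units_inv_closed m_closed)
  then show ?thesis
    using assms by (intro comm_inv_char) auto
qed

lemma (in comm_monoid) divide_eq_iff_units:
  assumes "a \<in> Units G" "b \<in> Units G" "c \<in> Units G" "d \<in> Units G"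
  shows "a \<otimes> inv b = c \<otimes> inv d \<longleftrightarrow> a \<otimes> d = c \<otimes> b"
proof -
  have "a \<otimes> inv b = c \<otimes> inv d \<longleftrightarrow> (b \<otimes> d) \<otimes> (a \<otimes> inv b) = (b \<otimes> d) \<otimes> (c \<otimes> inv d)"
    using assms by (intro Units_l_cancel[symmetric]) auto
  also have "(b \<otimes> d) \<otimes> (a \<otimes> inv b) = (b \<otimes> inv b) \<otimes> (a \<otimes> d)"
    using assms by (simp only: m_ac Units_closed Units_inv_closed m_closed)
  also have "(b \<otimes> d) \<otimes> (c \<otimes> inv d) = (d \<otimes> inv d) \<otimes> (c \<otimes> b)"
    using assms by (simp only: m_ac Units_closed Units_inv_closed m_closed)
  finally show ?thesis
    using assms by (simp add: Units_closed)
qed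

lemma (in comm_monoid) mult_inv_eq_one_iff:
  assumes "a \<in> Units G" "b \<in> Units G"
  shows "a \<otimes> inv b = \<one> \<longleftrightarrow> a = b"
  using divide_eq_iff_units[of a b \<one> \<one>] assms by (simp add: Units_closed)

lemma (in monoid) Units_nat_pow: "x \<in> Units G \<Longrightarrow> x [^] (n::nat) \<in> Units G"
  by (induction n) auto

lemma (in comm_monoid) finprod_Units:
  assumes "finite B" "\<And>b. b \<in> B \<Longrightarrow> f b \<in> Units G"
  shows "finprod G f B \<in> Units G"
  using assms by (induction B rule: finite_induct) (auto simp: Pi_def Units_closed)

text \<open>For abelian G this is the commutator pairing: u_g u_h is this scalar times u_h
  u_g.\<close>

definition comm_form :: "('a, 'b) ring_scheme \<Rightarrow> ('g \<Rightarrow> 'g \<Rightarrow> 'a) \<Rightarrow> 'g \<Rightarrow> 'g \<Rightarrow> 'a" where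
  "comm_form F \<alpha> g h = \<alpha> g h \<otimes>\<^bsub>F\<^esub> inv\<^bsub>F\<^esub> (\<alpha> h g)"

text \<open>The scalar by which the power \<open>u_g ^ n\<close> differs from the basis element of \<open>g ^ n\<close>,
  when \<open>\<alpha>\<close> is normalised.\<close>
definition pow_const :: "('g, 'c) monoid_scheme \<Rightarrow> ('a, 'b) ring_scheme \<Rightarrow> ('g \<Rightarrow> 'g \<Rightarrow> 'a) \<Rightarrow> 'g \<Rightarrow> nat \<Rightarrow> 'a" where
  "pow_const G F \<alpha> g n = (\<Otimes>\<^bsub>F\<^esub>j\<in>{..<n}. \<alpha> (g [^]\<^bsub>G\<^esub> j) g)"

section \<open>The commutator pairing and powers of homogeneous elements\<close>

context twisted_algebra
begin

lemma comm_form_unit [simp]: "g \<in> carrier G \<Longrightarrow> h \<in> carrier G \<Longrightarrow> comm_form F \<alpha> g h \<in> Units F"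
  by (simp add: comm_form_def)

lemma comm_form_eq_one_iff:
  "g \<in> carrier G \<Longrightarrow> h \<in> carrier G \<Longrightarrow> comm_form F \<alpha> g h = \<one>\<^bsub>F\<^esub> \<longleftrightarrow> \<alpha> g h = \<alpha> h g"
  by (simp add: comm_form_def F.mult_inv_eq_one_iff)

lemma comm_form_mult: "g \<in> carrier G \<Longrightarrow> h \<in> carrier G \<Longrightarrow> comm_form F \<alpha> g h \<otimes>\<^bsub>F\<^esub> \<alpha> h g = \<alpha> g h"
  by (simp add: comm_form_def F.m_assoc)

lemma comm_form_self: "g \<in> carrier G \<Longrightarrow> comm_form F \<alpha> g g = \<one>\<^bsub>F\<^esub>"
  by (simp add: comm_form_eq_one_iff)

lemma comm_form_one: "g \<in> carrier G \<Longrightarrow> comm_form F \<alpha> \<one>\<^bsub>G\<^esub> g = \<one>\<^bsub>F\<^esub>"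
  using one_left[of g] one_right[of g] by (simp add: comm_form_eq_one_iff)

lemma comm_form_swap:
  "g \<in> carrier G \<Longrightarrow> h \<in> carrier G \<Longrightarrow> comm_form F \<alpha> h g = inv\<^bsub>F\<^esub> (comm_form F \<alpha> g h)"
  by (simp add: comm_form_def F.inv_mult_units F.m_comm F.Units_closed)

text \<open>Conjugation by u_h scales u_g by the pairing and is multiplicative in u_g. In terms of
  \<alpha>, the cocycle identities at (g, g', h), (h, g, g') and (g, h, g') combine so that the unit
  \<alpha>(g, g') cancels.\<close>

lemma comm_form_mult_left:
  assumes "comm_group G" and g: "g \<in> carrier G" and g': "g' \<in> carrier G" and h: "h \<in> carrier G"
  shows "comm_form F \<alpha> (g \<otimes>\<^bsub>G\<^esub> g') h = comm_form F \<alpha> g h \<otimes>\<^bsub>F\<^esub> comm_form F \<alpha> g' h"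
proof -
  interpret comm_group G by fact
  define p u v a b d e k l where defs: "p = \<alpha> g g'" "u = \<alpha> (g \<otimes>\<^bsub>G\<^esub> g') h" "v = \<alpha> h (g \<otimes>\<^bsub>G\<^esub> g')"
    "a = \<alpha> g' h" "b = \<alpha> g (g' \<otimes>\<^bsub>G\<^esub> h)" "d = \<alpha> h g" "e = \<alpha> (g \<otimes>\<^bsub>G\<^esub> h) g'" "k = \<alpha> g h" "l = \<alpha> h g'"
  have U [simp]: "p \<in> Units F" "u \<in> Units F" "v \<in> Units F" "a \<in> Units F" "b \<in> Units F"
    "d \<in> Units F" "e \<in> Units F" "k \<in> Units F" "l \<in> Units F"
    using g g' h by (simp_all add: defs)
  note C = U[THEN F.Units_closed]
  have 1: "p \<otimes>\<^bsub>F\<^esub> u = a \<otimes>\<^bsub>F\<^esub> b"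
    using cocycle_eq[OF g g' h] by (simp add: defs)
  have 2: "d \<otimes>\<^bsub>F\<^esub> e = p \<otimes>\<^bsub>F\<^esub> v"
    using cocycle_eq[OF h g g'] m_comm[OF g h] by (simp add: defs)
  have 3: "k \<otimes>\<^bsub>F\<^esub> e = l \<otimes>\<^bsub>F\<^esub> b"
    using cocycle_eq[OF g h g'] m_comm[OF g' h] by (simp add: defs)
  have "p \<otimes>\<^bsub>F\<^esub> (u \<otimes>\<^bsub>F\<^esub> (d \<otimes>\<^bsub>F\<^esub> l)) = (p \<otimes>\<^bsub>F\<^esub> u) \<otimes>\<^bsub>F\<^esub> (d \<otimes>\<^bsub>F\<^esub> l)"
    by (simp add: C F.m_assoc)
  also have "\<dots> = a \<otimes>\<^bsub>F\<^esub> d \<otimes>\<^bsub>F\<^esub> (l \<otimes>\<^bsub>F\<^esub> b)"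
    unfolding 1 by (simp add: C F.m_ac)
  also have "\<dots> = (d \<otimes>\<^bsub>F\<^esub> e) \<otimes>\<^bsub>F\<^esub> (k \<otimes>\<^bsub>F\<^esub> a)"
    unfolding 3[symmetric] by (simp add: C F.m_ac)
  also have "\<dots> = p \<otimes>\<^bsub>F\<^esub> (k \<otimes>\<^bsub>F\<^esub> a \<otimes>\<^bsub>F\<^esub> v)"
    unfolding 2 by (simp add: C F.m_ac)
  finally have "u \<otimes>\<^bsub>F\<^esub> (d \<otimes>\<^bsub>F\<^esub> l) = k \<otimes>\<^bsub>F\<^esub> a \<otimes>\<^bsub>F\<^esub> v"
    by (simp add: C)
  then have "u \<otimes>\<^bsub>F\<^esub> inv\<^bsub>F\<^esub> v = (k \<otimes>\<^bsub>F\<^esub> a) \<otimes>\<^bsub>F\<^esub> inv\<^bsub>F\<^esub> (d \<otimes>\<^bsub>F\<^esub> l)"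
    by (simp add: F.divide_eq_iff_units)
  also have "\<dots> = (k \<otimes>\<^bsub>F\<^esub> inv\<^bsub>F\<^esub> d) \<otimes>\<^bsub>F\<^esub> (a \<otimes>\<^bsub>F\<^esub> inv\<^bsub>F\<^esub> l)"
    by (simp add: F.inv_mult_units C F.m_ac)
  finally show ?thesis
    by (simp add: comm_form_def defs)
qed

lemma comm_form_pow_left:
  assumes "comm_group G" "g \<in> carrier G" "h \<in> carrier G"
  shows "comm_form F \<alpha> (g [^]\<^bsub>G\<^esub> (n::nat)) h = comm_form F \<alpha> g h [^]\<^bsub>F\<^esub> n"
  using assms by (induction n) (simp_all add: comm_form_one comm_form_mult_left)

lemma single_pow_unit:
  assumes "g \<in> carrier G" "c \<in> Units F"
  shows "\<exists>d\<in>Units F. single g c [^]\<^bsub>A\<^esub> (n::nat) = single (g [^]\<^bsub>G\<^esub> n) d"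
proof (induction n)
  case 0
  then show ?case by (auto simp: one_eq)
next
  case (Suc n)
  then obtain d where "d \<in> Units F" "single g c [^]\<^bsub>A\<^esub> n = single (g [^]\<^bsub>G\<^esub> n) d" by blast
  then show ?case
    using assms by (intro bexI[of _ "d \<otimes>\<^bsub>F\<^esub> c \<otimes>\<^bsub>F\<^esub> \<alpha> (g [^]\<^bsub>G\<^esub> n) g"]) (auto simp: F.Units_closed)
qed

lemma pow_const_unit: "g \<in> carrier G \<Longrightarrow> pow_const G F \<alpha> g n \<in> Units F"
  unfolding pow_const_def by (rule F.finprod_Units) auto

text \<open>The power starts at the identity \<alpha>(1,1)^-1 u_1, and every multiplication by u_g
  adds one factor of \<open>pow_const\<close>. If g^n = 1, then \<open>pow_const\<close> is
  therefore exactly the scalar u_g^n, even when \<alpha>(1,1) differs from 1.\<close>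

lemma single_pow:
  assumes "g \<in> carrier G" "c \<in> carrier F"
  shows "single g c [^]\<^bsub>A\<^esub> (n::nat) =
    single (g [^]\<^bsub>G\<^esub> n) (c [^]\<^bsub>F\<^esub> n \<otimes>\<^bsub>F\<^esub> pow_const G F \<alpha> g n \<otimes>\<^bsub>F\<^esub> inv\<^bsub>F\<^esub> (\<alpha> \<one>\<^bsub>G\<^esub> \<one>\<^bsub>G\<^esub>))"
proof (induction n)
  case 0
  then show ?case by (simp add: one_eq pow_const_def)
next
  case (Suc n)
  have "pow_const G F \<alpha> g (Suc n) = \<alpha> (g [^]\<^bsub>G\<^esub> n) g \<otimes>\<^bsub>F\<^esub> pow_const G F \<alpha> g n"
    using assms by (simp add: pow_const_def lessThan_Suc Pi_def)
  then show ?case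
    using Suc assms pow_const_unit[OF assms(1), of n] by (simp add: F.Units_closed F.m_ac)
qed

end

lemma coboundaries_eq:
  fixes F :: "('a, 'b) ring_scheme" and G :: "('g, 'c) monoid_scheme"
  shows "coboundaries G F = {\<alpha>. \<exists>f. (\<forall>g\<in>carrier G. f g \<in> Units F) \<and>
     \<alpha> = (\<lambda>g h. if g \<in> carrier G \<and> h \<in> carrier G
        then f g \<otimes>\<^bsub>F\<^esub> f h \<otimes>\<^bsub>F\<^esub> inv\<^bsub>F\<^esub> (f (g \<otimes>\<^bsub>G\<^esub> h)) else \<one>\<^bsub>F\<^esub>)}"
  unfolding coboundaries_def by (intro Collect_cong ex_cong1 conj_cong refl) (auto simp: fun_eq_iff)

section \<open>The second cohomology group as a quotient group\<close>

locale cohomology = G: group G + F: cring F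
  for G :: "('g, 'c) monoid_scheme" and F :: "('a, 'b) ring_scheme"
begin

text \<open>The default value 1 outside G makes this hold for all arguments, which spares membership
  conditions in pointwise calculations with cocycles.\<close>

lemma cocycles_unit: "\<alpha> \<in> cocycles G F \<Longrightarrow> \<alpha> g h \<in> Units F"
  by (cases "g \<in> carrier G \<and> h \<in> carrier G") (auto simp: cocycles_def)

lemma cocycles_mult:
  assumes a: "\<alpha> \<in> cocycles G F" and b: "\<beta> \<in> cocycles G F"
  shows "(\<lambda>g h. \<alpha> g h \<otimes>\<^bsub>F\<^esub> \<beta> g h) \<in> cocycles G F"
proof -
  note [simp] = cocycles_unit[OF a] cocycles_unit[OF b]
    cocycles_unit[OF a, THEN F.Units_closed] cocycles_unit[OF b, THEN F.Units_closed]
  have "\<alpha> g h \<otimes>\<^bsub>F\<^esub> \<beta> g h \<otimes>\<^bsub>F\<^esub> (\<alpha> (g \<otimes>\<^bsub>G\<^esub> h) k \<otimes>\<^bsub>F\<^esub> \<beta> (g \<otimes>\<^bsub>G\<^esub> h) k) =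
    \<alpha> h k \<otimes>\<^bsub>F\<^esub> \<beta> h k \<otimes>\<^bsub>F\<^esub> (\<alpha> g (h \<otimes>\<^bsub>G\<^esub> k) \<otimes>\<^bsub>F\<^esub> \<beta> g (h \<otimes>\<^bsub>G\<^esub> k))"
    if "g \<in> carrier G" "h \<in> carrier G" "k \<in> carrier G" for g h k
  proof -
    have "\<alpha> g h \<otimes>\<^bsub>F\<^esub> \<beta> g h \<otimes>\<^bsub>F\<^esub> (\<alpha> (g \<otimes>\<^bsub>G\<^esub> h) k \<otimes>\<^bsub>F\<^esub> \<beta> (g \<otimes>\<^bsub>G\<^esub> h) k) =
      \<alpha> g h \<otimes>\<^bsub>F\<^esub> \<alpha> (g \<otimes>\<^bsub>G\<^esub> h) k \<otimes>\<^bsub>F\<^esub> (\<beta> g h \<otimes>\<^bsub>F\<^esub> \<beta> (g \<otimes>\<^bsub>G\<^esub> h) k)"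
      by (simp add: F.m_ac)
    also have "\<dots> = \<alpha> h k \<otimes>\<^bsub>F\<^esub> \<alpha> g (h \<otimes>\<^bsub>G\<^esub> k) \<otimes>\<^bsub>F\<^esub> (\<beta> h k \<otimes>\<^bsub>F\<^esub> \<beta> g (h \<otimes>\<^bsub>G\<^esub> k))"
      using a b that by (simp add: cocycles_def)
    also have "\<dots> = \<alpha> h k \<otimes>\<^bsub>F\<^esub> \<beta> h k \<otimes>\<^bsub>F\<^esub> (\<alpha> g (h \<otimes>\<^bsub>G\<^esub> k) \<otimes>\<^bsub>F\<^esub> \<beta> g (h \<otimes>\<^bsub>G\<^esub> k))"
      by (simp add: F.m_ac)
    finally show ?thesis .
  qed
  moreover have "\<alpha> g h \<otimes>\<^bsub>F\<^esub> \<beta> g h = \<one>\<^bsub>F\<^esub>" if "\<not> (g \<in> carrier G \<and> h \<in> carrier G)" for g h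
    using a b that by (simp add: cocycles_def)
  ultimately show ?thesis
    unfolding cocycles_def by simp
qed

lemma cocycles_inv:
  assumes a: "\<alpha> \<in> cocycles G F"
  shows "(\<lambda>g h. inv\<^bsub>F\<^esub> (\<alpha> g h)) \<in> cocycles G F"
  using assms cocycles_unit[OF a]
  by (auto simp: cocycles_def F.inv_mult_units[symmetric])

lemma one_cocycle: "(\<lambda>g h. \<one>\<^bsub>F\<^esub>) \<in> cocycles G F"
  by (simp add: cocycles_def)

lemma Z2_group_carrier: "carrier (Z2_group G F) = cocycles G F"
  by (simp add: Z2_group_def)

lemma Z2_comm_group: "comm_group (Z2_group G F)"
proof (rule comm_groupI)
  fix \<alpha> assume "\<alpha> \<in> carrier (Z2_group G F)"
  then have a: "\<alpha> \<in> cocycles G F" by (simp add: Z2_group_def)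
  show "\<exists>\<beta>\<in>carrier (Z2_group G F). \<beta> \<otimes>\<^bsub>Z2_group G F\<^esub> \<alpha> = \<one>\<^bsub>Z2_group G F\<^esub>"
    by (rule bexI[OF _ cocycles_inv[OF a, folded Z2_group_carrier]])
      (simp add: Z2_group_def cocycles_unit[OF a])
qed (auto simp: Z2_group_def fun_eq_iff one_cocycle cocycles_mult cocycles_unit F.m_ac F.Units_closed)

text \<open>Both sides of the cocycle identity equal f g f h f k / f (g h k); the calculation
  inserts the factor f (g h) / f (g h) on one side and f (h k) / f (h k) on the other.\<close>

lemma coboundaries_subset: "coboundaries G F \<subseteq> cocycles G F"
proof
  fix \<alpha> assume "\<alpha> \<in> coboundaries G F"
  then obtain f where f: "\<And>g. g \<in> carrier G \<Longrightarrow> f g \<in> Units F" and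
    \<alpha>: "\<alpha> = (\<lambda>g h. if g \<in> carrier G \<and> h \<in> carrier G
        then f g \<otimes>\<^bsub>F\<^esub> f h \<otimes>\<^bsub>F\<^esub> inv\<^bsub>F\<^esub> (f (g \<otimes>\<^bsub>G\<^esub> h)) else \<one>\<^bsub>F\<^esub>)"
    unfolding coboundaries_eq by blast
  note fc = f[THEN F.Units_closed] f[THEN F.Units_inv_closed]
  have "\<alpha> g h \<otimes>\<^bsub>F\<^esub> \<alpha> (g \<otimes>\<^bsub>G\<^esub> h) k = \<alpha> h k \<otimes>\<^bsub>F\<^esub> \<alpha> g (h \<otimes>\<^bsub>G\<^esub> k)"
    if [simp]: "g \<in> carrier G" "h \<in> carrier G" "k \<in> carrier G" for g h k
  proof -
    have "\<alpha> g h \<otimes>\<^bsub>F\<^esub> \<alpha> (g \<otimes>\<^bsub>G\<^esub> h) k = (f (g \<otimes>\<^bsub>G\<^esub> h) \<otimes>\<^bsub>F\<^esub> inv\<^bsub>F\<^esub> f (g \<otimes>\<^bsub>G\<^esub> h)) \<otimes>\<^bsub>F\<^esub>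
       (f g \<otimes>\<^bsub>F\<^esub> f h \<otimes>\<^bsub>F\<^esub> f k \<otimes>\<^bsub>F\<^esub> inv\<^bsub>F\<^esub> f (g \<otimes>\<^bsub>G\<^esub> h \<otimes>\<^bsub>G\<^esub> k))"
      by (simp add: \<alpha> fc F.m_ac del: F.Units_r_inv)
    also have "\<dots> = (f (h \<otimes>\<^bsub>G\<^esub> k) \<otimes>\<^bsub>F\<^esub> inv\<^bsub>F\<^esub> f (h \<otimes>\<^bsub>G\<^esub> k)) \<otimes>\<^bsub>F\<^esub>
       (f g \<otimes>\<^bsub>F\<^esub> f h \<otimes>\<^bsub>F\<^esub> f k \<otimes>\<^bsub>F\<^esub> inv\<^bsub>F\<^esub> f (g \<otimes>\<^bsub>G\<^esub> (h \<otimes>\<^bsub>G\<^esub> k)))"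
      by (simp add: f G.m_assoc)
    also have "\<dots> = \<alpha> h k \<otimes>\<^bsub>F\<^esub> \<alpha> g (h \<otimes>\<^bsub>G\<^esub> k)"
      by (simp add: \<alpha> fc F.m_ac del: F.Units_r_inv)
    finally show ?thesis .
  qed
  then show "\<alpha> \<in> cocycles G F"
    by (auto simp: cocycles_def f \<alpha>)
qed

lemma one_coboundary: "(\<lambda>g h. \<one>\<^bsub>F\<^esub>) \<in> coboundaries G F"
  unfolding coboundaries_eq by (intro CollectI exI[of _ "\<lambda>_. \<one>\<^bsub>F\<^esub>"]) (simp add: fun_eq_iff)

lemma coboundaries_normal: "coboundaries G F \<lhd> Z2_group G F"
proof -
  interpret Z: comm_group "Z2_group G F" by (rule Z2_comm_group)
  have "subgroup (coboundaries G F) (Z2_group G F)"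
  proof (rule Z.subgroupI)
    show "coboundaries G F \<subseteq> carrier (Z2_group G F)"
      using coboundaries_subset by (simp add: Z2_group_def)
    show "coboundaries G F \<noteq> {}" using one_coboundary by blast
    fix \<alpha> assume "\<alpha> \<in> coboundaries G F"
    then obtain f where f: "\<And>g. g \<in> carrier G \<Longrightarrow> f g \<in> Units F" and
      \<alpha>: "\<alpha> = (\<lambda>g h. if g \<in> carrier G \<and> h \<in> carrier G
          then f g \<otimes>\<^bsub>F\<^esub> f h \<otimes>\<^bsub>F\<^esub> inv\<^bsub>F\<^esub> (f (g \<otimes>\<^bsub>G\<^esub> h)) else \<one>\<^bsub>F\<^esub>)"
      and a: "\<alpha> \<in> cocycles G F"
      using coboundaries_subset[THEN subsetD] unfolding coboundaries_eq by blast
    have "inv\<^bsub>Z2_group G F\<^esub> \<alpha> = (\<lambda>g h. inv\<^bsub>F\<^esub> (\<alpha> g h))"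
      using cocycles_inv[OF a] cocycles_unit[OF a] a
      by (intro Z.inv_equality) (auto simp: Z2_group_def)
    also have "\<dots> = (\<lambda>g h. if g \<in> carrier G \<and> h \<in> carrier G
        then inv\<^bsub>F\<^esub> f g \<otimes>\<^bsub>F\<^esub> inv\<^bsub>F\<^esub> f h \<otimes>\<^bsub>F\<^esub> inv\<^bsub>F\<^esub> (inv\<^bsub>F\<^esub> f (g \<otimes>\<^bsub>G\<^esub> h)) else \<one>\<^bsub>F\<^esub>)"
      by (auto simp: fun_eq_iff \<alpha> f F.inv_mult_units)
    also have "\<dots> \<in> coboundaries G F"
      unfolding coboundaries_eq using f by (intro CollectI exI[of _ "\<lambda>g. inv\<^bsub>F\<^esub> f g"]) auto
    finally show "inv\<^bsub>Z2_group G F\<^esub> \<alpha> \<in> coboundaries G F" .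
    fix \<beta> assume "\<beta> \<in> coboundaries G F"
    then obtain f' where f': "\<And>g. g \<in> carrier G \<Longrightarrow> f' g \<in> Units F" and
      \<beta>: "\<beta> = (\<lambda>g h. if g \<in> carrier G \<and> h \<in> carrier G
          then f' g \<otimes>\<^bsub>F\<^esub> f' h \<otimes>\<^bsub>F\<^esub> inv\<^bsub>F\<^esub> (f' (g \<otimes>\<^bsub>G\<^esub> h)) else \<one>\<^bsub>F\<^esub>)"
      unfolding coboundaries_eq by blast
    have "\<alpha> \<otimes>\<^bsub>Z2_group G F\<^esub> \<beta> = (\<lambda>g h. if g \<in> carrier G \<and> h \<in> carrier G
        then (f g \<otimes>\<^bsub>F\<^esub> f' g) \<otimes>\<^bsub>F\<^esub> (f h \<otimes>\<^bsub>F\<^esub> f' h) \<otimes>\<^bsub>F\<^esub> inv\<^bsub>F\<^esub> (f (g \<otimes>\<^bsub>G\<^esub> h) \<otimes>\<^bsub>F\<^esub> f' (g \<otimes>\<^bsub>G\<^esub> h)) else \<one>\<^bsub>F\<^esub>)"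
      by (auto simp: fun_eq_iff \<alpha> \<beta> f f' F.inv_mult_units Z2_group_def F.Units_closed F.m_ac)
    also have "\<dots> \<in> coboundaries G F"
      unfolding coboundaries_eq using f f'
      by (intro CollectI exI[of _ "\<lambda>g. f g \<otimes>\<^bsub>F\<^esub> f' g"]) auto
    finally show "\<alpha> \<otimes>\<^bsub>Z2_group G F\<^esub> \<beta> \<in> coboundaries G F" .
  qed
  then show ?thesis
    by (simp add: Z.normal_iff_subgroup)
qed

lemma H2_group: "group (H2 G F)"
  unfolding H2_def using coboundaries_normal by (rule normal.factorgroup_is_group)

lemma H2_class:
  assumes "\<alpha> \<in> cocycles G F"
  shows "coboundaries G F #>\<^bsub>Z2_group G F\<^esub> \<alpha> \<in> carrier (H2 G F)"
    and "\<alpha> \<in> coboundaries G F #>\<^bsub>Z2_group G F\<^esub> \<alpha>"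
proof -
  show "coboundaries G F #>\<^bsub>Z2_group G F\<^esub> \<alpha> \<in> carrier (H2 G F)"
    using assms by (auto simp: H2_def carrier_FactGroup Z2_group_def)
  show "\<alpha> \<in> coboundaries G F #>\<^bsub>Z2_group G F\<^esub> \<alpha>"
    unfolding r_coset_def using one_coboundary assms
    by (auto simp: Z2_group_def cocycles_unit F.Units_closed intro!: bexI[of _ "\<lambda>g h. \<one>\<^bsub>F\<^esub>"])
qed

lemma H2_representative:
  assumes "C \<in> carrier (H2 G F)"
  shows "\<exists>\<alpha>\<in>cocycles G F. \<alpha> \<in> C"
proof -
  obtain \<alpha> where "\<alpha> \<in> cocycles G F" "C = coboundaries G F #>\<^bsub>Z2_group G F\<^esub> \<alpha>"
    using assms by (auto simp: H2_def carrier_FactGroup Z2_group_def)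
  then show ?thesis
    using H2_class(2) by blast
qed

text \<open>Provides representatives for products of classes; applied to a class times itself, it
  makes the square of a cocycle a representative of the squared class.\<close>

lemma H2_mult_mem:
  assumes "\<alpha> \<in> C" "\<beta> \<in> D"
  shows "(\<lambda>g h. \<alpha> g h \<otimes>\<^bsub>F\<^esub> \<beta> g h) \<in> C \<otimes>\<^bsub>H2 G F\<^esub> D"
  using assms by (auto simp: H2_def set_mult_def Z2_group_def)

end

section \<open>Products of two cyclic groups\<close>

lemma cocycles_outside:
  "\<alpha> \<in> cocycles G F \<Longrightarrow> \<not> (g \<in> carrier G \<and> h \<in> carrier G) \<Longrightarrow> \<alpha> g h = \<one>\<^bsub>F\<^esub>"
  unfolding cocycles_def by blast

definition bicyclic :: "nat \<Rightarrow> nat \<Rightarrow> (int \<times> int) monoid" where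
  "bicyclic m n = integer_mod_group m \<times>\<times> integer_mod_group n"

lemma C8xC2_eq: "C8xC2 = bicyclic 8 2" and C4xC4_eq: "C4xC4 = bicyclic 4 4"
  by (simp_all add: C8xC2_def C4xC4_def bicyclic_def)

lemma comm_group_bicyclic: "comm_group (bicyclic m n)"
  unfolding bicyclic_def
  by (intro group.group_comm_groupI DirProd_group) (auto simp: add.commute)

text \<open>The lower bound 2 makes 1 a reduced residue in both coordinates and excludes the modulus
  0, for which \<open>integer_mod_group\<close> is the infinite group of integers.\<close>

locale bicyclic_group =
  fixes m n :: nat
  assumes m: "m \<ge> 2" and n: "n \<ge> 2"
begin

abbreviation "G \<equiv> bicyclic m n"

sublocale G: comm_group G by (rule comm_group_bicyclic)

lemma carrier_eq: "carrier G = {0..<int m} \<times> {0..<int n}"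
  using m n by (simp add: bicyclic_def DirProd_def carrier_integer_mod_group)

lemma mult_eq [simp]: "(i, j) \<otimes>\<^bsub>G\<^esub> (k, l) = ((i + k) mod int m, (j + l) mod int n)"
  by (simp add: bicyclic_def DirProd_def)

lemma one_eq [simp]: "\<one>\<^bsub>G\<^esub> = (0, 0)"
  by (simp add: bicyclic_def DirProd_def)

lemma gen_mem [simp]: "(1, 0) \<in> carrier G" "(0, 1) \<in> carrier G" "(0, 0) \<in> carrier G"
  using m n by (simp_all add: carrier_eq)

lemma finite_carrier: "finite (carrier G)"
  by (simp add: carrier_eq)

lemma pow_eq [simp]: "(i, j) [^]\<^bsub>G\<^esub> (k::nat) = (int k * i mod int m, int k * j mod int n)"
  by (induction k) (simp_all add: mod_simps algebra_simps)

lemma carrierE: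
  assumes "g \<in> carrier G"
  obtains i j :: nat where "i < m" "j < n" "g = (int i, int j)"
proof -
  obtain a b where "g = (a, b)" "0 \<le> a" "a < int m" "0 \<le> b" "b < int n"
    using assms by (auto simp: carrier_eq)
  then show ?thesis
    by (intro that[of "nat a" "nat b"]) auto
qed

lemma gens_generate:
  assumes "i < m" "j < n"
  shows "(int i, int j) = (1, 0) [^]\<^bsub>G\<^esub> i \<otimes>\<^bsub>G\<^esub> (0, 1) [^]\<^bsub>G\<^esub> j"
  using assms m n by simp

end

locale bicyclic_algebra = bicyclic_group m n + twisted_algebra "bicyclic m n" F \<alpha>
  for m n :: nat and F :: "('a, 'b) ring_scheme" and \<alpha>
begin

abbreviation "c \<equiv> comm_form F \<alpha> (1, 0) (0, 1)"

lemma comm_form_fst: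
  assumes "i < m" "j < n" "h \<in> carrier G"
  shows "comm_form F \<alpha> (int i, int j) h = comm_form F \<alpha> (1, 0) h [^]\<^bsub>F\<^esub> i \<otimes>\<^bsub>F\<^esub> comm_form F \<alpha> (0, 1) h [^]\<^bsub>F\<^esub> j"
  unfolding gens_generate[OF assms(1,2)]
  using assms(3) by (simp only: comm_form_mult_left comm_form_pow_left comm_group_bicyclic G.nat_pow_closed gen_mem)

lemma comm_form_gen1:
  "i < m \<Longrightarrow> j < n \<Longrightarrow> comm_form F \<alpha> (int i, int j) (1, 0) = inv\<^bsub>F\<^esub> c [^]\<^bsub>F\<^esub> j"
  by (simp add: comm_form_fst comm_form_self comm_form_swap[of "(1, 0)" "(0, 1)"] F.Units_nat_pow F.Units_closed)

lemma comm_form_gen2: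
  "i < m \<Longrightarrow> j < n \<Longrightarrow> comm_form F \<alpha> (int i, int j) (0, 1) = c [^]\<^bsub>F\<^esub> i"
  by (simp add: comm_form_fst comm_form_self F.Units_nat_pow F.Units_closed)

text \<open>The pairing is bimultiplicative and trivial on equal arguments, so its single value
  \<open>c\<close> on the two generators determines it; here \<open>c\<close> = 1.\<close>

lemma symmetric:
  assumes "\<alpha> (1, 0) (0, 1) = \<alpha> (0, 1) (1, 0)" "g \<in> carrier G" "h \<in> carrier G"
  shows "\<alpha> g h = \<alpha> h g"
proof -
  have c: "c = \<one>\<^bsub>F\<^esub>"
    using assms(1) by (simp add: comm_form_eq_one_iff)
  obtain i j where ij: "i < m" "j < n" "g = (int i, int j)"
    using carrierE[OF assms(2)] .
  obtain k l where kl: "k < m" "l < n" "h = (int k, int l)"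
    using carrierE[OF assms(3)] .
  have "comm_form F \<alpha> (1, 0) h = \<one>\<^bsub>F\<^esub>" "comm_form F \<alpha> (0, 1) h = \<one>\<^bsub>F\<^esub>"
    using assms(3) kl(1,2) c unfolding kl(3)
    by (simp_all add: comm_form_swap[of "(int k, int l)"] comm_form_gen1 comm_form_gen2)
  then have "comm_form F \<alpha> g h = \<one>\<^bsub>F\<^esub>"
    using ij assms(3) by (simp add: comm_form_fst)
  then show ?thesis
    using assms by (simp add: comm_form_eq_one_iff)
qed

text \<open>The n-th power of u_y is a scalar and commutes with u_x. The orders 2 and 4 of the
  second factors of the two groups enter the negative part through this relation.\<close>

lemma c_pow_snd: "c [^]\<^bsub>F\<^esub> n = \<one>\<^bsub>F\<^esub>"
proof -
  have "inv\<^bsub>F\<^esub> c [^]\<^bsub>F\<^esub> n = \<one>\<^bsub>F\<^esub>"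
    using comm_form_pow_left[OF comm_group_bicyclic, of "(0, 1)" "(1, 0)" n] n
      comm_form_one[of "(1, 0)"] comm_form_swap[of "(1, 0)" "(0, 1)"] by simp
  moreover have "c [^]\<^bsub>F\<^esub> n \<otimes>\<^bsub>F\<^esub> inv\<^bsub>F\<^esub> c [^]\<^bsub>F\<^esub> n = \<one>\<^bsub>F\<^esub>"
    by (simp add: F.nat_pow_distrib[symmetric] F.Units_closed)
  ultimately show ?thesis
    by (simp add: F.Units_closed)
qed

lemma A_pow_mod:
  assumes "u \<in> carrier A" "u [^]\<^bsub>A\<^esub> (k::nat) = \<one>\<^bsub>A\<^esub>"
  shows "u [^]\<^bsub>A\<^esub> (i mod k) = u [^]\<^bsub>A\<^esub> (i::nat)"
proof -
  have "u [^]\<^bsub>A\<^esub> i = u [^]\<^bsub>A\<^esub> (k * (i div k) + i mod k)"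
    by simp
  also have "\<dots> = u [^]\<^bsub>A\<^esub> (i mod k)"
    using assms by (simp only: A.nat_pow_mult[symmetric] A.nat_pow_pow[symmetric] A.nat_pow_one)
      (simp add: A.nat_pow_closed)
  finally show ?thesis ..
qed

lemma A_pow_commute:
  assumes "u \<in> carrier A" "v \<in> carrier A" "u \<otimes>\<^bsub>A\<^esub> v = v \<otimes>\<^bsub>A\<^esub> u"
  shows "u [^]\<^bsub>A\<^esub> (i::nat) \<otimes>\<^bsub>A\<^esub> v = v \<otimes>\<^bsub>A\<^esub> u [^]\<^bsub>A\<^esub> i"
proof (induction i)
  case (Suc i)
  have "u [^]\<^bsub>A\<^esub> Suc i \<otimes>\<^bsub>A\<^esub> v = u [^]\<^bsub>A\<^esub> i \<otimes>\<^bsub>A\<^esub> v \<otimes>\<^bsub>A\<^esub> u"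
    using assms by (simp add: A.m_assoc)
  then show ?case
    using assms Suc by (simp add: A.m_assoc)
qed (use assms in simp)

text \<open>If the two basis elements can be rescaled to commuting elements \<open>U\<close>, \<open>V\<close> with
  \<open>U ^ m = V ^ n = 1\<close>, then the monomials \<open>U ^ i V ^ j\<close> form a rescaled basis that multiplies
  without any cocycle.\<close>
lemma coboundaryI:
  assumes a: "a \<in> Units F" "a [^]\<^bsub>F\<^esub> m \<otimes>\<^bsub>F\<^esub> pow_const G F \<alpha> (1, 0) m = \<one>\<^bsub>F\<^esub>"
    and b: "b \<in> Units F" "b [^]\<^bsub>F\<^esub> n \<otimes>\<^bsub>F\<^esub> pow_const G F \<alpha> (0, 1) n = \<one>\<^bsub>F\<^esub>"
    and sym: "\<alpha> (1, 0) (0, 1) = \<alpha> (0, 1) (1, 0)"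
  shows "\<alpha> \<in> coboundaries G F"
proof -
  define U where "U = single (1, 0) a"
  define V where "V = single (0, 1) b"
  have [simp]: "U \<in> carrier A" "V \<in> carrier A"
    using a b by (auto simp: U_def V_def)
  have UV: "U \<otimes>\<^bsub>A\<^esub> V = V \<otimes>\<^bsub>A\<^esub> U"
    using a(1) b(1) sym m n by (simp add: U_def V_def F.Units_closed F.m_comm)
  have Um: "U [^]\<^bsub>A\<^esub> m = \<one>\<^bsub>A\<^esub>"
    unfolding U_def using a m by (subst single_pow) (auto simp: twisted_algebra.one_eq[OF twisted_algebra_axioms])
  have Vn: "V [^]\<^bsub>A\<^esub> n = \<one>\<^bsub>A\<^esub>"
    unfolding V_def using b n by (subst single_pow) (auto simp: twisted_algebra.one_eq[OF twisted_algebra_axioms])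
  define W where "W g = U [^]\<^bsub>A\<^esub> nat (fst g) \<otimes>\<^bsub>A\<^esub> V [^]\<^bsub>A\<^esub> nat (snd g)" for g
  have "\<exists>d\<in>Units F. W g = single g d" if g: "g \<in> carrier G" for g
  proof -
    obtain i j where ij: "i < m" "j < n" "g = (int i, int j)"
      using carrierE[OF g] .
    obtain d where d: "d \<in> Units F" "U [^]\<^bsub>A\<^esub> i = single ((1, 0) [^]\<^bsub>G\<^esub> i) d"
      unfolding U_def using single_pow_unit[of "(1, 0)" a i] a by auto
    obtain e where e: "e \<in> Units F" "V [^]\<^bsub>A\<^esub> j = single ((0, 1) [^]\<^bsub>G\<^esub> j) e"
      unfolding V_def using single_pow_unit[of "(0, 1)" b j] b by auto
    have "(1, 0) [^]\<^bsub>G\<^esub> i \<in> carrier G" "(0, 1) [^]\<^bsub>G\<^esub> j \<in> carrier G"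
      by (simp_all only: G.nat_pow_closed gen_mem)
    note mem = this
    have "W g = U [^]\<^bsub>A\<^esub> i \<otimes>\<^bsub>A\<^esub> V [^]\<^bsub>A\<^esub> j"
      by (simp add: W_def ij)
    also have "\<dots> = single g (d \<otimes>\<^bsub>F\<^esub> e \<otimes>\<^bsub>F\<^esub> \<alpha> ((1, 0) [^]\<^bsub>G\<^esub> i) ((0, 1) [^]\<^bsub>G\<^esub> j))"
      unfolding d(2) e(2) ij(3) gens_generate[OF ij(1,2)] using d(1) e(1) mem by (intro single_mult) auto
    finally show ?thesis
      using d(1) e(1) unit[OF mem] by blast
  qed
  then obtain f where f: "\<And>g. g \<in> carrier G \<Longrightarrow> f g \<in> Units F" "\<And>g. g \<in> carrier G \<Longrightarrow> W g = single g (f g)"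
    by metis
  have W_mult: "W g \<otimes>\<^bsub>A\<^esub> W h = W (g \<otimes>\<^bsub>G\<^esub> h)" if g: "g \<in> carrier G" and h: "h \<in> carrier G" for g h
  proof -
    obtain i j where ij: "i < m" "j < n" "g = (int i, int j)"
      using carrierE[OF g] .
    obtain k l where kl: "k < m" "l < n" "h = (int k, int l)"
      using carrierE[OF h] .
    have comm: "V [^]\<^bsub>A\<^esub> j \<otimes>\<^bsub>A\<^esub> U [^]\<^bsub>A\<^esub> k = U [^]\<^bsub>A\<^esub> k \<otimes>\<^bsub>A\<^esub> V [^]\<^bsub>A\<^esub> j"
      by (rule A_pow_commute) (simp_all add: A_pow_commute UV)
    have "W g \<otimes>\<^bsub>A\<^esub> W h = U [^]\<^bsub>A\<^esub> i \<otimes>\<^bsub>A\<^esub> (V [^]\<^bsub>A\<^esub> j \<otimes>\<^bsub>A\<^esub> U [^]\<^bsub>A\<^esub> k) \<otimes>\<^bsub>A\<^esub> V [^]\<^bsub>A\<^esub> l"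
      by (simp add: W_def ij kl A.m_assoc)
    also have "\<dots> = (U [^]\<^bsub>A\<^esub> i \<otimes>\<^bsub>A\<^esub> U [^]\<^bsub>A\<^esub> k) \<otimes>\<^bsub>A\<^esub> (V [^]\<^bsub>A\<^esub> j \<otimes>\<^bsub>A\<^esub> V [^]\<^bsub>A\<^esub> l)"
      unfolding comm by (simp add: A.m_assoc)
    also have "\<dots> = U [^]\<^bsub>A\<^esub> ((i + k) mod m) \<otimes>\<^bsub>A\<^esub> V [^]\<^bsub>A\<^esub> ((j + l) mod n)"
      by (simp add: A.nat_pow_mult A_pow_mod Um Vn)
    also have "\<dots> = W (g \<otimes>\<^bsub>G\<^esub> h)"
    proof -
      have "g \<otimes>\<^bsub>G\<^esub> h = (int ((i + k) mod m), int ((j + l) mod n))"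
        by (simp add: ij kl zmod_int)
      then show ?thesis by (simp only: W_def fst_conv snd_conv nat_int)
    qed
    finally show ?thesis .
  qed
  \<comment> \<open>With W g = f(g) u_g, comparing coefficients in W g W h = W (g h) gives f(g) f(h)
    \<alpha>(g, h) = f(g h). So \<alpha> is the coboundary of the inverse of f, not of f
    itself.\<close>
  have main: "\<alpha> g h = inv\<^bsub>F\<^esub> f g \<otimes>\<^bsub>F\<^esub> inv\<^bsub>F\<^esub> f h \<otimes>\<^bsub>F\<^esub> inv\<^bsub>F\<^esub> (inv\<^bsub>F\<^esub> f (g \<otimes>\<^bsub>G\<^esub> h))"
    if g: "g \<in> carrier G" and h: "h \<in> carrier G" for g h
  proof -
    have gh: "g \<otimes>\<^bsub>G\<^esub> h \<in> carrier G" using g h by (rule G.m_closed)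
    note fu = f(1)[OF g] f(1)[OF h] f(1)[OF gh]
    have "single (g \<otimes>\<^bsub>G\<^esub> h) (f g \<otimes>\<^bsub>F\<^esub> f h \<otimes>\<^bsub>F\<^esub> \<alpha> g h) (g \<otimes>\<^bsub>G\<^esub> h) = single (g \<otimes>\<^bsub>G\<^esub> h) (f (g \<otimes>\<^bsub>G\<^esub> h)) (g \<otimes>\<^bsub>G\<^esub> h)"
      using W_mult[OF g h] g h gh fu by (simp add: f(2) F.Units_closed)
    then have e: "f g \<otimes>\<^bsub>F\<^esub> f h \<otimes>\<^bsub>F\<^esub> \<alpha> g h = f (g \<otimes>\<^bsub>G\<^esub> h)"
      by (simp add: single_def)
    have "inv\<^bsub>F\<^esub> (f g \<otimes>\<^bsub>F\<^esub> f h) \<otimes>\<^bsub>F\<^esub> (f g \<otimes>\<^bsub>F\<^esub> f h \<otimes>\<^bsub>F\<^esub> \<alpha> g h) = \<alpha> g h"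
      using fu g h by (subst F.m_assoc[symmetric]) (simp_all add: F.Units_closed)
    then show ?thesis
      unfolding e using fu by (simp add: F.inv_mult_units)
  qed
  have "\<alpha> g h = \<one>\<^bsub>F\<^esub>" if "\<not> (g \<in> carrier G \<and> h \<in> carrier G)" for g h
    using cocycle that by (rule cocycles_outside)
  then have eq: "\<alpha> g h = (if g \<in> carrier G \<and> h \<in> carrier G
      then inv\<^bsub>F\<^esub> f g \<otimes>\<^bsub>F\<^esub> inv\<^bsub>F\<^esub> f h \<otimes>\<^bsub>F\<^esub> inv\<^bsub>F\<^esub> (inv\<^bsub>F\<^esub> f (g \<otimes>\<^bsub>G\<^esub> h)) else \<one>\<^bsub>F\<^esub>)" for g h
  proof (cases "g \<in> carrier G \<and> h \<in> carrier G")
    case True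
    then show ?thesis unfolding if_P[OF True] by (intro main) blast+
  next
    case False
    then show ?thesis unfolding if_not_P[OF False] by fact
  qed
  show ?thesis
    unfolding coboundaries_def
    by (intro CollectI exI[of _ "\<lambda>g. inv\<^bsub>F\<^esub> f g"] conjI ballI allI F.Units_inv_Units f(1) eq)
qed

end

section \<open>Cohomology over fields with unit group of exponent twice an odd number\<close>

definition sign_group :: "('a, 'b) ring_scheme \<Rightarrow> 'a monoid" where
  "sign_group F = \<lparr>carrier = {\<one>\<^bsub>F\<^esub>, \<ominus>\<^bsub>F\<^esub> \<one>\<^bsub>F\<^esub>}, monoid.mult = monoid.mult F, one = \<one>\<^bsub>F\<^esub>\<rparr>"

lemma (in ring) sign_group_group: "group (sign_group R)"
  by (rule groupI) (auto simp: sign_group_def l_minus r_minus)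

lemma (in domain) pow_two_eq_one:
  "x \<in> carrier R \<Longrightarrow> x [^] (2::nat) = \<one> \<Longrightarrow> x = \<one> \<or> x = \<ominus> \<one>"
  using square_eq_one[of x] by (simp add: numeral_2_eq_2)

lemma (in ring) minus_one_pow:
  "(\<ominus> \<one>) [^] (k::nat) = (if even k then \<one> else \<ominus> \<one>)"
  by (induction k) (auto simp: l_minus r_minus)

context twisted_algebra
begin

text \<open>The product over j of f(g^j) f(g) / f(g^(j+1)) telescopes, leaving the end terms f(1)
  and f(g^n).\<close>

lemma pow_const_coboundary:
  assumes "\<And>g. g \<in> carrier G \<Longrightarrow> f g \<in> Units F" "g \<in> carrier G"
    and "\<And>g h. g \<in> carrier G \<Longrightarrow> h \<in> carrier G \<Longrightarrow>
      \<alpha> g h = f g \<otimes>\<^bsub>F\<^esub> f h \<otimes>\<^bsub>F\<^esub> inv\<^bsub>F\<^esub> (f (g \<otimes>\<^bsub>G\<^esub> h))"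
  shows "pow_const G F \<alpha> g n = f \<one>\<^bsub>G\<^esub> \<otimes>\<^bsub>F\<^esub> f g [^]\<^bsub>F\<^esub> n \<otimes>\<^bsub>F\<^esub> inv\<^bsub>F\<^esub> (f (g [^]\<^bsub>G\<^esub> n))"
proof (induction n)
  case 0
  then show ?case using assms(1)[of "\<one>\<^bsub>G\<^esub>"] by (simp add: pow_const_def F.Units_closed)
next
  case (Suc n)
  define p where "p = g [^]\<^bsub>G\<^esub> n"
  have p: "p \<in> carrier G" using assms(2) by (simp add: p_def)
  have pg: "p \<otimes>\<^bsub>G\<^esub> g \<in> carrier G" using p assms(2) by simp
  note u = assms(1)[OF p] assms(1)[OF assms(2)] assms(1)[OF pg] assms(1)[OF G.one_closed]
  note [simp] = u u[THEN F.Units_closed]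
  have "pow_const G F \<alpha> g (Suc n) = \<alpha> p g \<otimes>\<^bsub>F\<^esub> pow_const G F \<alpha> g n"
    using assms(2) by (simp add: pow_const_def lessThan_Suc Pi_def p_def F.Units_closed)
  also have "\<dots> = (f p \<otimes>\<^bsub>F\<^esub> inv\<^bsub>F\<^esub> f p) \<otimes>\<^bsub>F\<^esub> (f \<one>\<^bsub>G\<^esub> \<otimes>\<^bsub>F\<^esub> f g [^]\<^bsub>F\<^esub> Suc n \<otimes>\<^bsub>F\<^esub> inv\<^bsub>F\<^esub> (f (p \<otimes>\<^bsub>G\<^esub> g)))"
    unfolding Suc assms(3)[OF p assms(2)] p_def[symmetric] by (simp add: F.m_ac del: F.Units_r_inv)
  also have "\<dots> = f \<one>\<^bsub>G\<^esub> \<otimes>\<^bsub>F\<^esub> f g [^]\<^bsub>F\<^esub> Suc n \<otimes>\<^bsub>F\<^esub> inv\<^bsub>F\<^esub> (f (g [^]\<^bsub>G\<^esub> Suc n))"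
    using p assms(2) by (simp add: p_def[symmetric])
  finally show ?case .
qed

end

text \<open>A field whose unit group has exponent twice an odd number, as is the case for the
  finite fields of order \<open>q \<equiv> 3\<close> modulo \<open>4\<close> (with \<open>d = (q - 1) / 2\<close>).\<close>
locale odd_exponent_field = field F for F :: "('a, 'b) ring_scheme" (structure) +
  fixes d :: nat
  assumes odd_d: "odd d" and unit_pow: "u \<in> Units F \<Longrightarrow> u [^] (2 * d) = \<one>"
    and minus_one: "\<ominus> \<one> \<noteq> \<one>"
begin

lemma unit_pow_d: "u \<in> Units F \<Longrightarrow> u [^] d = \<one> \<or> u [^] d = \<ominus> \<one>"
  using unit_pow[of u] by (intro pow_two_eq_one) (auto simp: nat_pow_pow mult.commute Units_closed)

lemma unit_pow_even: "u \<in> Units F \<Longrightarrow> even k \<Longrightarrow> u [^] (d * k) = \<one>"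
proof -
  assume u: "u \<in> Units F" and "even k"
  then obtain l where "d * k = (2 * d) * l" by (auto elim: evenE)
  then show ?thesis
    using u unit_pow[OF u] by (simp only: nat_pow_pow[symmetric] Units_closed) simp
qed

lemma minus_one_pow_d: "(\<ominus> \<one>) [^] d = \<ominus> \<one>"
  using odd_d by (simp add: minus_one_pow)

text \<open>By Bezout k x = d y + 1, so the k-th power of u^-x is u^-(d y) u^-1 = u^-1. The result
  is phrased as a k = u^-1 root because \<open>coboundaryI\<close> asks for a rescaling factor that
  cancels the scalar u_x^m; the case k = 2 later yields a square root of 1/2 or -1/2.\<close>

lemma inverse_is_power:
  assumes u: "u \<in> Units F" and ud: "u [^] d = \<one>" and "coprime k d" and "k \<noteq> 0"
  shows "\<exists>a\<in>Units F. a [^] (k::nat) \<otimes> u = \<one>"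
proof -
  obtain x y where xy: "k * x = d * y + 1"
    using bezout_nat[of k d] assms(3,4) by auto
  have inv_d: "inv u [^] d = \<one>"
  proof -
    have "(inv u \<otimes> u) [^] d = inv u [^] d \<otimes> u [^] d"
      using u by (intro nat_pow_distrib) auto
    then show ?thesis using u ud by simp
  qed
  have "(inv u [^] x) [^] k = (inv u [^] d) [^] y \<otimes> inv u"
    using u by (simp add: nat_pow_pow mult.commute[of x k] xy)
  then have "(inv u [^] x) [^] k \<otimes> u = \<one>"
    using u by (simp add: inv_d)
  then show ?thesis
    using u by (intro bexI[of _ "inv u [^] x"]) (auto intro: Units_nat_pow)
qed

text \<open>There is no primitive fourth root of unity: c^2 = -1 would give c^(2d) = (-1)^d = -1
  because d is odd.\<close>

lemma pow_four_eq_one: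
  assumes "c \<in> Units F" "c [^] (4::nat) = \<one>"
  shows "c = \<one> \<or> c = \<ominus> \<one>"
proof -
  have "(c [^] (2::nat)) [^] (2::nat) = \<one>"
    using assms by (simp add: nat_pow_pow Units_closed)
  then have "c [^] (2::nat) = \<one> \<or> c [^] (2::nat) = \<ominus> \<one>"
    using assms by (intro pow_two_eq_one) auto
  moreover have "c [^] (2::nat) \<noteq> \<ominus> \<one>"
  proof
    assume "c [^] (2::nat) = \<ominus> \<one>"
    then have "c [^] (2 * d) = \<ominus> \<one>"
      using assms(1) minus_one_pow_d by (simp only: nat_pow_pow[symmetric] Units_closed)
    then show False using unit_pow[OF assms(1)] minus_one by simp
  qed
  ultimately show ?thesis
    using assms by (intro pow_two_eq_one) auto
qed

end

text \<open>Its exponent is the first coordinate of g times the second of h. Hence the commutator of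
  u_x and u_y is z, while products among powers of a single generator pick up no factor, so the
  commutator is adjusted independently of u_x^m and u_y^n.\<close>

definition bichar :: "('a, 'b) ring_scheme \<Rightarrow> (int \<times> int) monoid \<Rightarrow> 'a \<Rightarrow> int \<times> int \<Rightarrow> int \<times> int \<Rightarrow> 'a" where
  "bichar F G z g h = (if g \<in> carrier G \<and> h \<in> carrier G then z [^]\<^bsub>F\<^esub> (nat (fst g) * nat (snd h)) else \<one>\<^bsub>F\<^esub>)"

text \<open>The cocycles of the extensions with \<open>u_x ^ m = s\<close> and \<open>u_y ^ n = s\<close>, respectively.\<close>
definition carry1 :: "('a, 'b) ring_scheme \<Rightarrow> nat \<Rightarrow> nat \<Rightarrow> 'a \<Rightarrow> int \<times> int \<Rightarrow> int \<times> int \<Rightarrow> 'a" where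
  "carry1 F m n s g h = (if g \<in> carrier (bicyclic m n) \<and> h \<in> carrier (bicyclic m n) \<and> fst g + fst h \<ge> int m
     then s else \<one>\<^bsub>F\<^esub>)"

definition carry2 :: "('a, 'b) ring_scheme \<Rightarrow> nat \<Rightarrow> nat \<Rightarrow> 'a \<Rightarrow> int \<times> int \<Rightarrow> int \<times> int \<Rightarrow> 'a" where
  "carry2 F m n s g h = (if g \<in> carrier (bicyclic m n) \<and> h \<in> carrier (bicyclic m n) \<and> snd g + snd h \<ge> int n
     then s else \<one>\<^bsub>F\<^esub>)"

lemma mod_double: "0 \<le> a \<Longrightarrow> a < 2 * b \<Longrightarrow> a mod b = (if a < b then a else a - b)" for a b :: int
  using minus_mod_self2[of a b] mod_pos_pos_trivial[of "a - b" b] by (auto simp: mod_pos_pos_trivial)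

section \<open>Explicit cocycles on products of two cyclic groups\<close>

context bicyclic_group
begin

text \<open>Each side is s raised to the number of carries modulo m when three residues are added,
  and that number does not depend on the bracketing.\<close>

lemma carry1_cocycle:
  assumes "cring F" "s \<in> Units F"
  shows "carry1 F m n s \<in> cocycles G F"
proof -
  interpret F: cring F by fact
  have "carry1 F m n s g h \<otimes>\<^bsub>F\<^esub> carry1 F m n s (g \<otimes>\<^bsub>G\<^esub> h) k = carry1 F m n s h k \<otimes>\<^bsub>F\<^esub> carry1 F m n s g (h \<otimes>\<^bsub>G\<^esub> k)"
    if "g \<in> carrier G" "h \<in> carrier G" "k \<in> carrier G" for g h k
  proof -
    have "g \<otimes>\<^bsub>G\<^esub> h \<in> carrier G" "h \<otimes>\<^bsub>G\<^esub> k \<in> carrier G" using that by simp_all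
    then show ?thesis
      using that assms(2) by (cases g; cases h; cases k) (auto simp: carry1_def carrier_eq mod_double F.Units_closed)
  qed
  then show ?thesis
    using assms(2) unfolding cocycles_def by (auto simp: carry1_def)
qed

lemma carry2_cocycle:
  assumes "cring F" "s \<in> Units F"
  shows "carry2 F m n s \<in> cocycles G F"
proof -
  interpret F: cring F by fact
  have "carry2 F m n s g h \<otimes>\<^bsub>F\<^esub> carry2 F m n s (g \<otimes>\<^bsub>G\<^esub> h) k = carry2 F m n s h k \<otimes>\<^bsub>F\<^esub> carry2 F m n s g (h \<otimes>\<^bsub>G\<^esub> k)"
    if "g \<in> carrier G" "h \<in> carrier G" "k \<in> carrier G" for g h k
  proof -
    have "g \<otimes>\<^bsub>G\<^esub> h \<in> carrier G" "h \<otimes>\<^bsub>G\<^esub> k \<in> carrier G" using that by simp_all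
    then show ?thesis
      using that assms(2) by (cases g; cases h; cases k) (auto simp: carry2_def carrier_eq mod_double F.Units_closed)
  qed
  then show ?thesis
    using assms(2) unfolding cocycles_def by (auto simp: carry2_def)
qed

text \<open>Any bimultiplicative map is a cocycle. The conditions z^m = z^n = 1 allow reducing the
  first coordinates modulo m and the second modulo n inside the exponent, which is what
  bimultiplicativity amounts to here.\<close>

lemma bichar_cocycle:
  assumes "cring F" "z \<in> Units F" "z [^]\<^bsub>F\<^esub> m = \<one>\<^bsub>F\<^esub>" "z [^]\<^bsub>F\<^esub> n = \<one>\<^bsub>F\<^esub>"
  shows "bichar F G z \<in> cocycles G F"
proof -
  interpret F: cring F by fact
  have z: "z \<in> carrier F" using assms by auto
  have pow_mod: "z [^]\<^bsub>F\<^esub> (i mod k * p) = z [^]\<^bsub>F\<^esub> (i * p)" if "z [^]\<^bsub>F\<^esub> k = \<one>\<^bsub>F\<^esub>" for i k p :: nat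
  proof -
    have "z [^]\<^bsub>F\<^esub> i = z [^]\<^bsub>F\<^esub> (k * (i div k) + i mod k)"
      by simp
    also have "\<dots> = z [^]\<^bsub>F\<^esub> (i mod k)"
      using z that by (simp only: F.nat_pow_mult[symmetric] F.nat_pow_pow[symmetric] F.nat_pow_one) simp
    finally show ?thesis
      using z by (simp only: F.nat_pow_pow[symmetric])
  qed
  have "bichar F G z g h \<otimes>\<^bsub>F\<^esub> bichar F G z (g \<otimes>\<^bsub>G\<^esub> h) k = bichar F G z h k \<otimes>\<^bsub>F\<^esub> bichar F G z g (h \<otimes>\<^bsub>G\<^esub> k)"
    if g: "g \<in> carrier G" and h: "h \<in> carrier G" and k: "k \<in> carrier G" for g h k
  proof -
    have c: "g \<otimes>\<^bsub>G\<^esub> h \<in> carrier G" "h \<otimes>\<^bsub>G\<^esub> k \<in> carrier G" using that by simp_all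
    obtain g1 g2 where G: "g = (int g1, int g2)" using carrierE[OF g] by blast
    obtain h1 h2 where H: "h = (int h1, int h2)" using carrierE[OF h] by blast
    obtain k1 k2 where K: "k = (int k1, int k2)" using carrierE[OF k] by blast
    have e: "g \<otimes>\<^bsub>G\<^esub> h = (int ((g1 + h1) mod m), int ((g2 + h2) mod n))"
      "h \<otimes>\<^bsub>G\<^esub> k = (int ((h1 + k1) mod m), int ((h2 + k2) mod n))"
      by (simp_all add: G H K zmod_int)
    have "bichar F G z (g \<otimes>\<^bsub>G\<^esub> h) k = z [^]\<^bsub>F\<^esub> ((g1 + h1) * k2)"
      using c k unfolding bichar_def e K by (simp only: if_True simp_thms fst_conv snd_conv nat_int pow_mod[OF assms(3)])
    moreover have "bichar F G z g (h \<otimes>\<^bsub>G\<^esub> k) = z [^]\<^bsub>F\<^esub> ((h2 + k2) * g1)"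
      using c g unfolding bichar_def e G
      by (simp only: if_True simp_thms fst_conv snd_conv nat_int mult.commute[of g1] pow_mod[OF assms(4)])
    moreover have "bichar F G z g h = z [^]\<^bsub>F\<^esub> (g1 * h2)" "bichar F G z h k = z [^]\<^bsub>F\<^esub> (h1 * k2)"
      using g h k by (simp_all add: bichar_def G H K)
    ultimately show ?thesis
      using z by (simp add: F.nat_pow_mult algebra_simps)
  qed
  then show ?thesis
    using assms(2) unfolding cocycles_def by (auto simp: bichar_def F.Units_nat_pow)
qed

lemma bichar_gens:
  assumes "cring F" "z \<in> carrier F"
  shows "bichar F G z (1, 0) (0, 1) = z" "bichar F G z (0, 1) (1, 0) = \<one>\<^bsub>F\<^esub>"
proof -
  interpret F: cring F by fact
  show "bichar F G z (1, 0) (0, 1) = z" "bichar F G z (0, 1) (1, 0) = \<one>\<^bsub>F\<^esub>"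
    using assms(2) by (simp_all add: bichar_def)
qed

end

text \<open>Coprimality to d provides m-th and n-th roots of units with trivial sign; evenness of m
  and n makes m-th and n-th powers have trivial sign and makes \<open>bichar\<close> with z = -1 a
  cocycle; n dividing 4 turns c^n = 1 into c^4 = 1, so that c is a sign.\<close>

locale bicyclic_odd = bicyclic_group m n + odd_exponent_field F d
  for m n :: nat and F :: "('a, 'b) ring_scheme" and d +
  assumes even_mn: "even m" "even n" and coprime_mn: "coprime m d" "coprime n d"
    and n_dvd: "n dvd 4"
begin

sublocale cohomology G F ..

lemma algebra: "\<alpha> \<in> cocycles G F \<Longrightarrow> bicyclic_algebra m n F \<alpha>"
  by unfold_locales (auto simp: finite_carrier)

definition sign_map where
  "sign_map \<alpha> = (pow_const G F \<alpha> (1, 0) m [^]\<^bsub>F\<^esub> d, pow_const G F \<alpha> (0, 1) n [^]\<^bsub>F\<^esub> d,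
     comm_form F \<alpha> (1, 0) (0, 1))"

abbreviation "S \<equiv> sign_group F"

lemma sign_map_closed:
  assumes "\<alpha> \<in> cocycles G F"
  shows "sign_map \<alpha> \<in> carrier (S \<times>\<times> S \<times>\<times> S)"
proof -
  interpret bicyclic_algebra m n F \<alpha> using assms by (rule algebra)
  obtain k where "4 = n * k" using n_dvd by blast
  then have "c [^]\<^bsub>F\<^esub> (4::nat) = \<one>\<^bsub>F\<^esub>"
    using c_pow_snd by (simp only: nat_pow_pow[symmetric] comm_form_unit Units_closed gen_mem) simp
  then show ?thesis
    using pow_four_eq_one[of c] unit_pow_d[OF pow_const_unit[of "(1, 0)" m]]
      unit_pow_d[OF pow_const_unit[of "(0, 1)" n]]
    by (auto simp: sign_map_def sign_group_def)
qed

lemma sign_map_hom: "sign_map \<in> hom (Z2_group G F) (S \<times>\<times> S \<times>\<times> S)"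
proof (rule homI)
  fix \<alpha> \<beta> assume "\<alpha> \<in> carrier (Z2_group G F)" "\<beta> \<in> carrier (Z2_group G F)"
  then have ab: "\<alpha> \<in> cocycles G F" "\<beta> \<in> cocycles G F" by (simp_all add: Z2_group_def)
  note [simp] = ab[THEN cocycles_unit] ab[THEN cocycles_unit, THEN Units_closed]
  show "sign_map (\<alpha> \<otimes>\<^bsub>Z2_group G F\<^esub> \<beta>) = sign_map \<alpha> \<otimes>\<^bsub>S \<times>\<times> S \<times>\<times> S\<^esub> sign_map \<beta>"
    by (simp add: sign_map_def sign_group_def Z2_group_def pow_const_def comm_form_def
        finprod_multf Pi_def nat_pow_distrib inv_mult_units m_ac)
qed (unfold Z2_group_carrier, rule sign_map_closed)

text \<open>If both signs are 1, then u_x and u_y can be rescaled so that u_x^m = u_y^n = 1, and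
  \<open>coboundaryI\<close> applies. Conversely, a coboundary has u_x^m = f(x)^m, whose d-th power
  is 1 since m is even, and likewise for y.\<close>

lemma kernel_sign_map: "kernel (Z2_group G F) (S \<times>\<times> S \<times>\<times> S) sign_map = coboundaries G F"
proof (intro equalityI subsetI)
  fix \<alpha> assume "\<alpha> \<in> kernel (Z2_group G F) (S \<times>\<times> S \<times>\<times> S) sign_map"
  then have \<alpha>: "\<alpha> \<in> cocycles G F" and eqs: "pow_const G F \<alpha> (1, 0) m [^]\<^bsub>F\<^esub> d = \<one>\<^bsub>F\<^esub>"
    "pow_const G F \<alpha> (0, 1) n [^]\<^bsub>F\<^esub> d = \<one>\<^bsub>F\<^esub>" "comm_form F \<alpha> (1, 0) (0, 1) = \<one>\<^bsub>F\<^esub>"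
    by (auto simp: kernel_def Z2_group_def sign_map_def sign_group_def)
  interpret bicyclic_algebra m n F \<alpha> using \<alpha> by (rule algebra)
  obtain a where a: "a \<in> Units F" "a [^]\<^bsub>F\<^esub> m \<otimes>\<^bsub>F\<^esub> pow_const G F \<alpha> (1, 0) m = \<one>\<^bsub>F\<^esub>"
    using inverse_is_power[OF pow_const_unit eqs(1) coprime_mn(1)] m by auto
  obtain b where b: "b \<in> Units F" "b [^]\<^bsub>F\<^esub> n \<otimes>\<^bsub>F\<^esub> pow_const G F \<alpha> (0, 1) n = \<one>\<^bsub>F\<^esub>"
    using inverse_is_power[OF pow_const_unit eqs(2) coprime_mn(2)] n by auto
  show "\<alpha> \<in> coboundaries G F"
    using coboundaryI[OF a b] eqs(3) by (simp add: comm_form_eq_one_iff)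
next
  fix \<alpha> assume cob: "\<alpha> \<in> coboundaries G F"
  then have \<alpha>: "\<alpha> \<in> cocycles G F" using coboundaries_subset by blast
  interpret bicyclic_algebra m n F \<alpha> using \<alpha> by (rule algebra)
  obtain f where f: "\<And>g. g \<in> carrier G \<Longrightarrow> f g \<in> Units F" and
    \<alpha>_eq: "\<And>g h. g \<in> carrier G \<Longrightarrow> h \<in> carrier G \<Longrightarrow>
      \<alpha> g h = f g \<otimes>\<^bsub>F\<^esub> f h \<otimes>\<^bsub>F\<^esub> inv\<^bsub>F\<^esub> (f (g \<otimes>\<^bsub>G\<^esub> h))"
    using cob unfolding coboundaries_eq by fastforce
  have f0: "f (0, 0) \<in> Units F" by (simp add: f)
  have f10: "f (1, 0) \<in> Units F" and f01: "f (0, 1) \<in> Units F" by (simp_all add: f)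
  have "pow_const G F \<alpha> (1, 0) m = f (0, 0) \<otimes>\<^bsub>F\<^esub> f (1, 0) [^]\<^bsub>F\<^esub> m \<otimes>\<^bsub>F\<^esub> inv\<^bsub>F\<^esub> f (0, 0)"
    "pow_const G F \<alpha> (0, 1) n = f (0, 0) \<otimes>\<^bsub>F\<^esub> f (0, 1) [^]\<^bsub>F\<^esub> n \<otimes>\<^bsub>F\<^esub> inv\<^bsub>F\<^esub> f (0, 0)"
    using pow_const_coboundary[OF f _ \<alpha>_eq, of "(1, 0)" m] pow_const_coboundary[OF f _ \<alpha>_eq, of "(0, 1)" n]
    by simp_all
  then have "pow_const G F \<alpha> (1, 0) m = f (1, 0) [^]\<^bsub>F\<^esub> m" "pow_const G F \<alpha> (0, 1) n = f (0, 1) [^]\<^bsub>F\<^esub> n"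
    using f0 f10 f01 by (simp_all add: m_comm[of "f (0, 0)"] m_assoc Units_closed)
  then have "pow_const G F \<alpha> (1, 0) m [^]\<^bsub>F\<^esub> d = \<one>\<^bsub>F\<^esub>" "pow_const G F \<alpha> (0, 1) n [^]\<^bsub>F\<^esub> d = \<one>\<^bsub>F\<^esub>"
    using f10 f01 even_mn by (simp_all add: nat_pow_pow Units_closed unit_pow_even mult.commute[of _ d])
  moreover have "comm_form F \<alpha> (1, 0) (0, 1) = \<one>\<^bsub>F\<^esub>"
    using f10 f01 m n by (simp add: comm_form_eq_one_iff \<alpha>_eq m_comm Units_closed)
  ultimately show "\<alpha> \<in> kernel (Z2_group G F) (S \<times>\<times> S \<times>\<times> S) sign_map"
    using \<alpha> by (simp add: kernel_def Z2_group_def sign_map_def sign_group_def)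
qed

lemma sign_map_surj: "sign_map ` carrier (Z2_group G F) = carrier (S \<times>\<times> S \<times>\<times> S)"
proof
  show "sign_map ` carrier (Z2_group G F) \<subseteq> carrier (S \<times>\<times> S \<times>\<times> S)"
    using sign_map_closed unfolding Z2_group_carrier by blast
  show "carrier (S \<times>\<times> S \<times>\<times> S) \<subseteq> sign_map ` carrier (Z2_group G F)"
  proof
    fix x assume "x \<in> carrier (S \<times>\<times> S \<times>\<times> S)"
    then obtain s t r where x: "x = (s, t, r)" and
      str: "s \<in> carrier S" "t \<in> carrier S" "r \<in> carrier S"
      by (auto simp: DirProd_def)
    have sign: "a \<in> Units F" "a [^]\<^bsub>F\<^esub> d = a" "even k \<Longrightarrow> a [^]\<^bsub>F\<^esub> k = \<one>\<^bsub>F\<^esub>"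
      if "a \<in> carrier S" for a and k :: nat
      using that minus_one_pow_d by (auto simp: sign_group_def minus_one_pow)
    note [simp] = str[THEN sign(1)] str[THEN sign(1), THEN Units_closed]
    \<comment> \<open>The three factors prescribe the three signs separately. No correction of s and
      t is necessary, because a sign is its own d-th power for odd d.\<close>
    define \<alpha> where "\<alpha> = (\<lambda>g h. carry1 F m n s g h \<otimes>\<^bsub>F\<^esub> (carry2 F m n t g h \<otimes>\<^bsub>F\<^esub> bichar F G r g h))"
    have "\<alpha> \<in> cocycles G F"
      unfolding \<alpha>_def using str even_mn
      by (intro cocycles_mult carry1_cocycle carry2_cocycle bichar_cocycle) (auto simp: sign is_cring)
    moreover have "sign_map \<alpha> = x"
    proof -
      \<comment> \<open>Among the products u_x^j u_x with j < m a carry occurs only at j = m -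
        1.\<close>
      have "pow_const G F \<alpha> (1, 0) m = (\<Otimes>\<^bsub>F\<^esub>j\<in>{..<m}. if m - 1 = j then s else \<one>\<^bsub>F\<^esub>)"
        unfolding pow_const_def using m n
        by (intro finprod_cong') (auto simp: \<alpha>_def carry1_def carry2_def bichar_def carrier_eq)
      also have "\<dots> = s"
        using m by (intro finprod_singleton) auto
      finally have 1: "pow_const G F \<alpha> (1, 0) m = s" .
      have "pow_const G F \<alpha> (0, 1) n = (\<Otimes>\<^bsub>F\<^esub>j\<in>{..<n}. if n - 1 = j then t else \<one>\<^bsub>F\<^esub>)"
        unfolding pow_const_def using m n
        by (intro finprod_cong') (auto simp: \<alpha>_def carry1_def carry2_def bichar_def carrier_eq)
      also have "\<dots> = t"
        using n by (intro finprod_singleton) auto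
      finally have 2: "pow_const G F \<alpha> (0, 1) n = t" .
      have "comm_form F \<alpha> (1, 0) (0, 1) = r"
        using m n by (simp add: comm_form_def \<alpha>_def carry1_def carry2_def bichar_def)
      then show ?thesis
        using str by (simp add: x sign_map_def 1 2 sign(2))
    qed
    ultimately show "x \<in> sign_map ` carrier (Z2_group G F)"
      by (force simp: Z2_group_def)
  qed
qed

theorem H2_iso: "H2 G F \<cong> S \<times>\<times> S \<times>\<times> S"
proof -
  have "group_hom (Z2_group G F) (S \<times>\<times> S \<times>\<times> S) sign_map"
    unfolding group_hom_def group_hom_axioms_def
    using Z2_comm_group sign_map_hom sign_group_group by (auto intro: comm_group.axioms DirProd_group)
  from group_hom.FactGroup_iso[OF this sign_map_surj] show ?thesis
    by (simp add: H2_def kernel_sign_map)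
qed

end

lemma H2_iso_odd_exponent_field:
  assumes "odd_exponent_field F d"
  shows "H2 C8xC2 F \<cong> H2 C4xC4 F"
proof -
  interpret odd_exponent_field F d by fact
  have [simp]: "coprime 2 d" using odd_d by simp
  have cop: "coprime 8 d" "coprime 4 d"
    using odd_d coprime_power_left_iff[of 2 3 d] coprime_power_left_iff[of 2 2 d] by simp_all
  interpret G: bicyclic_odd 8 2 F d
    using cop by unfold_locales auto
  interpret H: bicyclic_odd 4 4 F d
    using cop by unfold_locales auto
  show ?thesis
    unfolding C8xC2_eq C4xC4_eq
    using G.H2_iso H.H2_iso iso_trans group.iso_sym[OF H.H2_group] by blast
qed

section \<open>Ring homomorphisms out of a twisted group algebra\<close>

context cring
begin

text \<open>Here k is 1/2 and x^2 is an involution, so y = (1 + x^2) / 2 projects to the part where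
  x^2 = 1 and 1 - y to the part where x^2 = -1.\<close>

lemma half_idempotent:
  assumes [simp]: "k \<in> carrier R" "x \<in> carrier R" and kk: "k \<oplus> k = \<one>" and x4: "(x \<otimes> x) \<otimes> (x \<otimes> x) = \<one>"
  defines "y \<equiv> k \<otimes> (\<one> \<oplus> x \<otimes> x)"
  shows "y \<otimes> y = y" "y \<otimes> (x \<otimes> x) = y" "(\<one> \<ominus> y) \<otimes> (x \<otimes> x) = \<ominus> (\<one> \<ominus> y)"
proof -
  have [simp]: "y \<in> carrier R" by (simp add: y_def)
  have yx: "y \<otimes> (x \<otimes> x) = k \<otimes> (x \<otimes> x \<oplus> (x \<otimes> x) \<otimes> (x \<otimes> x))"
    unfolding y_def by (simp add: l_distr r_distr m_assoc)
  then show yx: "y \<otimes> (x \<otimes> x) = y"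
    unfolding x4 by (simp add: y_def a_comm)
  have double: "y \<oplus> y = \<one> \<oplus> x \<otimes> x"
    unfolding y_def by (simp add: kk flip: l_distr)
  have "y \<otimes> y = k \<otimes> (y \<oplus> y \<otimes> (x \<otimes> x))"
    by (subst (2) y_def) (simp add: r_distr m_ac)
  also have "\<dots> = (k \<oplus> k) \<otimes> y"
    unfolding yx by (simp add: l_distr r_distr)
  finally show "y \<otimes> y = y" by (simp add: kk)
  have "(\<one> \<ominus> y) \<otimes> (x \<otimes> x) \<oplus> (\<one> \<ominus> y) = (\<one> \<oplus> x \<otimes> x) \<oplus> \<ominus> (y \<oplus> y)"
    by (simp add: minus_eq l_distr l_minus yx minus_add) (simp add: a_ac)
  also have "\<dots> = \<zero>"
    unfolding double by (simp add: r_neg del: minus_add)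
  finally show "(\<one> \<ominus> y) \<otimes> (x \<otimes> x) = \<ominus> (\<one> \<ominus> y)"
    by (intro minus_equality[symmetric]) simp_all
qed

lemma complement_idempotent:
  assumes [simp]: "e \<in> carrier R" and ee: "e \<otimes> e = e"
  shows "e \<otimes> (\<one> \<ominus> e) = \<zero>" "(\<one> \<ominus> e) \<otimes> (\<one> \<ominus> e) = \<one> \<ominus> e" "e \<oplus> (\<one> \<ominus> e) = \<one>"
proof -
  show 0: "e \<otimes> (\<one> \<ominus> e) = \<zero>" by (simp add: minus_eq r_distr r_minus ee r_neg)
  have "(\<one> \<ominus> e) \<otimes> (\<one> \<ominus> e) = (\<one> \<ominus> e) \<oplus> \<ominus> (e \<otimes> (\<one> \<ominus> e))"
    by (simp add: minus_eq[of \<one> "e"] l_distr l_minus)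
  then show "(\<one> \<ominus> e) \<otimes> (\<one> \<ominus> e) = \<one> \<ominus> e" by (simp add: 0)
  show "e \<oplus> (\<one> \<ominus> e) = \<one>" by (simp add: minus_eq a_lcomm[of e \<one>] r_neg)
qed

text \<open>For an idempotent c this is equality in the factor c R of the ring. Including membership
  in the carrier lets the congruence rules be chained without side conditions on the elements
  compared.\<close>

definition eq_on :: "'a \<Rightarrow> 'a \<Rightarrow> 'a \<Rightarrow> bool" where
  "eq_on c x y \<longleftrightarrow> x \<in> carrier R \<and> y \<in> carrier R \<and> c \<otimes> x = c \<otimes> y"

lemma eq_on_refl: "x \<in> carrier R \<Longrightarrow> eq_on c x x"
  by (simp add: eq_on_def)

lemma eq_on_trans [trans]: "eq_on c x y \<Longrightarrow> eq_on c y z \<Longrightarrow> eq_on c x z"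
  by (simp add: eq_on_def)

lemma eq_on_sym: "eq_on c x y \<Longrightarrow> eq_on c y x"
  by (simp add: eq_on_def)

lemma eq_on_mult:
  assumes "c \<in> carrier R" "eq_on c x x'" "eq_on c y y'"
  shows "eq_on c (x \<otimes> y) (x' \<otimes> y')"
proof -
  have [simp]: "x \<in> carrier R" "x' \<in> carrier R" "y \<in> carrier R" "y' \<in> carrier R"
    using assms by (auto simp: eq_on_def)
  have "c \<otimes> (x \<otimes> y) = (c \<otimes> x) \<otimes> y" using assms(1) by (simp add: m_assoc)
  also have "c \<otimes> x = c \<otimes> x'" using assms(2) by (simp add: eq_on_def)
  also have "(c \<otimes> x') \<otimes> y = x' \<otimes> (c \<otimes> y)" using assms(1) by (simp add: m_ac)
  also have "c \<otimes> y = c \<otimes> y'" using assms(3) by (simp add: eq_on_def)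
  also have "x' \<otimes> (c \<otimes> y') = c \<otimes> (x' \<otimes> y')" using assms(1) by (simp add: m_lcomm)
  finally show ?thesis by (simp add: eq_on_def)
qed

lemma eq_on_add:
  "c \<in> carrier R \<Longrightarrow> eq_on c x x' \<Longrightarrow> eq_on c y y' \<Longrightarrow> eq_on c (x \<oplus> y) (x' \<oplus> y')"
  by (simp add: eq_on_def r_distr)

lemma eq_on_minus: "c \<in> carrier R \<Longrightarrow> eq_on c x x' \<Longrightarrow> eq_on c (\<ominus> x) (\<ominus> x')"
  by (simp add: eq_on_def r_minus)

lemma eq_on_square:
  "c \<in> carrier R \<Longrightarrow> eq_on c x y \<Longrightarrow> eq_on c (x \<otimes> x) (y \<otimes> y)"
  by (rule eq_on_mult)

lemma eq_on_component: "c \<in> carrier R \<Longrightarrow> d \<in> carrier R \<Longrightarrow> eq_on c x y \<Longrightarrow> eq_on (c \<otimes> d) x y"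
  unfolding eq_on_def by (metis m_assoc m_comm)

end

text \<open>Multiplicative generators of order 8 and 2 inside the group algebra of \<open>C4 \<times> C4\<close> with
  generators \<open>s\<close>, \<open>t\<close>.  On the component \<open>p\<close>, where \<open>s^2 = 1\<close>, they are \<open>t\<close> and \<open>s\<close>;
  elsewhere \<open>s\<close> is a square root of \<open>-1\<close>, so the primitive eighth root of unity
  \<open>z = (1 + s) v\<close> is available, and \<open>h = t^2\<close> separates the components \<open>c\<close> and \<open>d\<close>.\<close>
lemma (in cring) eighth_root_generators:
  assumes carr [simp]: "s \<in> carrier R" "t \<in> carrier R" "k \<in> carrier R" "v \<in> carrier R" "\<epsilon> \<in> carrier R"
    and kk: "k \<oplus> k = \<one>" and vv: "v \<otimes> v = \<epsilon> \<otimes> k" and ee: "\<epsilon> \<otimes> \<epsilon> = \<one>"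
    and s4: "(s \<otimes> s) \<otimes> (s \<otimes> s) = \<one>" and t4: "(t \<otimes> t) \<otimes> (t \<otimes> t) = \<one>"
  obtains g h where "g \<in> carrier R" "h \<in> carrier R" "g [^] (8::nat) = \<one>" "h [^] (2::nat) = \<one>"
    "\<And>I. \<lbrakk>subring I R; k \<in> I; v \<in> I; \<epsilon> \<in> I; g \<in> I; h \<in> I\<rbrakk> \<Longrightarrow> s \<in> I \<and> t \<in> I"
proof -
  define p q where "p = k \<otimes> (\<one> \<oplus> s \<otimes> s)" and "q = k \<otimes> (\<one> \<oplus> t \<otimes> t)"
  define e f where "e = \<one> \<ominus> p" and "f = \<one> \<ominus> q"
  define c d where "c = e \<otimes> q" and "d = e \<otimes> f"
  have [simp]: "p \<in> carrier R" "q \<in> carrier R" by (simp_all add: p_def q_def)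
  then have [simp]: "e \<in> carrier R" "f \<in> carrier R" by (simp_all add: e_def f_def)
  then have [simp]: "c \<in> carrier R" "d \<in> carrier R" by (simp_all add: c_def d_def)
  note P = half_idempotent[of k s, OF _ _ kk s4, folded p_def, folded e_def, simplified]
  note Q = half_idempotent[of k t, OF _ _ kk t4, folded q_def, folded f_def, simplified]
  note PE = complement_idempotent[OF _ P(1), folded e_def, simplified]
  note QF = complement_idempotent[OF _ Q(1), folded f_def, simplified]
  have sum: "p \<oplus> (c \<oplus> d) = \<one>"
    by (simp add: c_def d_def QF PE flip: r_distr)
  have mul: "p \<otimes> c = \<zero>" "p \<otimes> d = \<zero>" "c \<otimes> p = \<zero>" "d \<otimes> p = \<zero>" "c \<otimes> d = \<zero>" "d \<otimes> c = \<zero>" "c \<otimes> c = c" "d \<otimes> d = d"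
  proof -
    show pc: "p \<otimes> c = \<zero>" and pd: "p \<otimes> d = \<zero>"
      by (simp_all add: c_def d_def PE flip: m_assoc)
    show "c \<otimes> p = \<zero>" "d \<otimes> p = \<zero>"
      using pc pd by (simp_all add: m_comm)
    have "c \<otimes> d = (e \<otimes> e) \<otimes> (q \<otimes> f)" by (simp add: c_def d_def m_ac)
    then show cd: "c \<otimes> d = \<zero>" by (simp add: QF)
    then show "d \<otimes> c = \<zero>" by (simp add: m_comm)
    have "c \<otimes> c = (e \<otimes> e) \<otimes> (q \<otimes> q)" by (simp add: c_def m_ac)
    then show "c \<otimes> c = c" by (simp add: PE Q c_def)
    have "d \<otimes> d = (e \<otimes> e) \<otimes> (f \<otimes> f)" by (simp add: d_def m_ac)
    then show "d \<otimes> d = d" by (simp add: PE QF d_def)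
  qed
  have eqI: "x = y" if "eq_on p x y" "eq_on c x y" "eq_on d x y" for x y
  proof -
    have [simp]: "x \<in> carrier R" "y \<in> carrier R" using that by (auto simp: eq_on_def)
    have "(p \<oplus> (c \<oplus> d)) \<otimes> x = (p \<oplus> (c \<oplus> d)) \<otimes> y"
      using that by (simp add: l_distr eq_on_def)
    then show ?thesis by (simp add: sum)
  qed
  define glue where "glue x y w = p \<otimes> x \<oplus> (c \<otimes> y \<oplus> d \<otimes> w)" for x y w
  have glue: "eq_on p (glue x y w) x" "eq_on c (glue x y w) y" "eq_on d (glue x y w) w"
    if "x \<in> carrier R" "y \<in> carrier R" "w \<in> carrier R" for x y w
    using that by (simp_all add: eq_on_def glue_def r_distr mul P flip: m_assoc)
  have dbl: "(x \<oplus> x) \<otimes> k = x" if "x \<in> carrier R" for x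
  proof -
    have "(x \<oplus> x) \<otimes> k = x \<otimes> (k \<oplus> k)" using that by (simp add: l_distr r_distr)
    then show ?thesis using that by (simp add: kk)
  qed
  have ss: "eq_on p (s \<otimes> s) \<one>" "eq_on e (s \<otimes> s) (\<ominus> \<one>)"
    using P by (simp_all add: eq_on_def r_minus)
  have tt: "eq_on q (t \<otimes> t) \<one>" "eq_on f (t \<otimes> t) (\<ominus> \<one>)"
    using Q by (simp_all add: eq_on_def r_minus)
  \<comment> \<open>With v^2 = \<epsilon>/2 and s^2 = -1 on e, z^2 = (1 + 2 s + s^2) \<epsilon>/2 =
    \<epsilon> s, and z' is the inverse of z there because (1 - s)(1 + s) = 2.\<close>
  define z where "z = (\<one> \<oplus> s) \<otimes> v"
  define z' where "z' = (\<one> \<ominus> s) \<otimes> (\<epsilon> \<otimes> v)"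
  have [simp]: "z \<in> carrier R" "z' \<in> carrier R" by (simp_all add: z_def z'_def)
  have zz: "eq_on e (z \<otimes> z) (\<epsilon> \<otimes> s)"
  proof -
    have "z \<otimes> z = ((\<one> \<oplus> s \<otimes> s) \<oplus> (s \<oplus> s)) \<otimes> (\<epsilon> \<otimes> k)"
      by (simp add: z_def m_ac flip: vv) (simp add: l_distr r_distr a_ac m_ac)
    moreover have "eq_on e (((\<one> \<oplus> s \<otimes> s) \<oplus> (s \<oplus> s)) \<otimes> (\<epsilon> \<otimes> k)) (((\<one> \<oplus> \<ominus> \<one>) \<oplus> (s \<oplus> s)) \<otimes> (\<epsilon> \<otimes> k))"
      by (intro eq_on_mult eq_on_add ss eq_on_refl) simp_all
    moreover have "((\<one> \<oplus> \<ominus> \<one>) \<oplus> (s \<oplus> s)) \<otimes> (\<epsilon> \<otimes> k) = \<epsilon> \<otimes> ((s \<oplus> s) \<otimes> k)"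
      by (simp add: r_neg m_lcomm)
    ultimately show ?thesis by (simp add: dbl)
  qed
  have zz': "eq_on e (z' \<otimes> z) \<one>"
  proof -
    have "(\<one> \<ominus> s) \<otimes> (\<one> \<oplus> s) = \<one> \<oplus> \<ominus> (s \<otimes> s)"
      by (simp add: minus_eq l_distr r_distr l_minus minus_add a_assoc r_neg1 r_neg2)
    moreover have "z' \<otimes> z = ((\<one> \<ominus> s) \<otimes> (\<one> \<oplus> s)) \<otimes> (\<epsilon> \<otimes> (v \<otimes> v))"
      by (simp add: z_def z'_def m_ac)
    moreover have "\<epsilon> \<otimes> (v \<otimes> v) = k" by (simp add: vv ee flip: m_assoc)
    ultimately have "z' \<otimes> z = (\<one> \<oplus> \<ominus> (s \<otimes> s)) \<otimes> k" by simp
    moreover have "eq_on e ((\<one> \<oplus> \<ominus> (s \<otimes> s)) \<otimes> k) ((\<one> \<oplus> \<ominus> (\<ominus> \<one>)) \<otimes> k)"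
      by (intro eq_on_mult eq_on_add eq_on_minus ss eq_on_refl) simp_all
    ultimately show ?thesis by (simp add: dbl)
  qed
  have on_c: "eq_on e x y \<Longrightarrow> eq_on c x y" "eq_on q x y \<Longrightarrow> eq_on c x y" for x y
    using eq_on_component[of e q x y] eq_on_component[of q e x y] by (simp_all add: c_def m_comm)
  have on_d: "eq_on e x y \<Longrightarrow> eq_on d x y" "eq_on f x y \<Longrightarrow> eq_on d x y" for x y
    using eq_on_component[of e f x y] eq_on_component[of f e x y] by (simp_all add: d_def m_comm)
  \<comment> \<open>On d, where t^2 = -1, the additional factor s compensates that sign, so g^2 =
    \<epsilon> s on all of e and g^4 = -1 there, against g^4 = t^4 = 1 on p. The minus sign is
    chosen so that s z' g gives back t on d.\<close>
  define g h where "g = glue t (z \<otimes> t) (\<ominus> (z \<otimes> (s \<otimes> t)))" and "h = glue s \<one> (\<ominus> \<one>)"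
  have g: "eq_on p g t" "eq_on c g (z \<otimes> t)" "eq_on d g (\<ominus> (z \<otimes> (s \<otimes> t)))"
    unfolding g_def by (intro glue; simp)+
  have h: "eq_on p h s" "eq_on c h \<one>" "eq_on d h (\<ominus> \<one>)"
    unfolding h_def by (intro glue; simp)+
  have [simp]: "g \<in> carrier R" "h \<in> carrier R" by (simp_all add: g_def h_def glue_def)
  have g2: "eq_on p (g \<otimes> g) (t \<otimes> t)" "eq_on c (g \<otimes> g) (\<epsilon> \<otimes> s)" "eq_on d (g \<otimes> g) (\<epsilon> \<otimes> s)"
  proof -
    show "eq_on p (g \<otimes> g) (t \<otimes> t)" by (intro eq_on_square g) simp
    have "eq_on c (g \<otimes> g) ((z \<otimes> t) \<otimes> (z \<otimes> t))" by (intro eq_on_square g) simp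
    also have "(z \<otimes> t) \<otimes> (z \<otimes> t) = (z \<otimes> z) \<otimes> (t \<otimes> t)" by (simp add: m_ac)
    also have "eq_on c \<dots> ((\<epsilon> \<otimes> s) \<otimes> \<one>)" by (intro eq_on_mult on_c(1)[OF zz] on_c(2)[OF tt(1)]) simp
    finally show "eq_on c (g \<otimes> g) (\<epsilon> \<otimes> s)" by simp
    have "eq_on d (g \<otimes> g) (\<ominus> (z \<otimes> (s \<otimes> t)) \<otimes> \<ominus> (z \<otimes> (s \<otimes> t)))" by (intro eq_on_square g) simp
    also have "\<ominus> (z \<otimes> (s \<otimes> t)) \<otimes> \<ominus> (z \<otimes> (s \<otimes> t)) = (z \<otimes> z) \<otimes> ((s \<otimes> s) \<otimes> (t \<otimes> t))"
      by (simp add: l_minus r_minus m_ac)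
    also have "eq_on d \<dots> ((\<epsilon> \<otimes> s) \<otimes> (\<ominus> \<one> \<otimes> \<ominus> \<one>))"
      by (intro eq_on_mult on_d(1)[OF zz] on_d(2)[OF tt(2)] on_d(1)[OF ss(2)]) simp_all
    finally show "eq_on d (g \<otimes> g) (\<epsilon> \<otimes> s)" by (simp add: l_minus)
  qed
  define g4 where "g4 = (g \<otimes> g) \<otimes> (g \<otimes> g)"
  have [simp]: "g4 \<in> carrier R" by (simp add: g4_def)
  have es: "eq_on e ((\<epsilon> \<otimes> s) \<otimes> (\<epsilon> \<otimes> s)) (\<ominus> \<one>)"
  proof -
    have "(\<epsilon> \<otimes> s) \<otimes> (\<epsilon> \<otimes> s) = (\<epsilon> \<otimes> \<epsilon>) \<otimes> (s \<otimes> s)" by (simp add: m_ac del: ee)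
    then show ?thesis using ss(2) by (simp add: ee)
  qed
  have g4: "eq_on p g4 \<one>" "eq_on c g4 (\<ominus> \<one>)" "eq_on d g4 (\<ominus> \<one>)"
  proof -
    show "eq_on p g4 \<one>"
      using eq_on_square[OF _ g2(1)] by (simp add: g4_def t4)
    show "eq_on c g4 (\<ominus> \<one>)" unfolding g4_def
      by (rule eq_on_trans[OF eq_on_square[OF _ g2(2)] on_c(1)[OF es]]) simp
    show "eq_on d g4 (\<ominus> \<one>)" unfolding g4_def
      by (rule eq_on_trans[OF eq_on_square[OF _ g2(3)] on_d(1)[OF es]]) simp
  qed
  have "g4 \<otimes> g4 = \<one>"
    using eq_on_square[OF _ g4(1)] eq_on_square[OF _ g4(2)] eq_on_square[OF _ g4(3)]
    by (intro eqI) (simp_all add: l_minus)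
  moreover have "g [^] (8::nat) = g4 \<otimes> g4"
    by (simp add: g4_def numeral_eq_Suc m_assoc)
  ultimately have g8: "g [^] (8::nat) = \<one>" by simp
  have "h \<otimes> h = \<one>"
    using eq_on_trans[OF eq_on_square[OF _ h(1)] ss(1)] eq_on_square[OF _ h(2)] eq_on_square[OF _ h(3)]
    by (intro eqI) (simp_all add: l_minus)
  then have h2: "h [^] (2::nat) = \<one>" by (simp add: numeral_2_eq_2)
  have on_self: "eq_on a a \<one>" if "a \<otimes> a = a" "a \<in> carrier R" for a
    using that by (simp add: eq_on_def)
  have on_zero: "eq_on a b \<zero>" if "a \<otimes> b = \<zero>" "a \<in> carrier R" "b \<in> carrier R" for a b
    using that by (simp add: eq_on_def)
  \<comment> \<open>The gluing must be undone inside a subring that contains only k, v, \<epsilon>,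
    g and h. So first the idempotents are recovered: p from g^4 = 1, then c from h = 1 within e, and
    d as the remainder of e; afterwards s and t are glued from expressions in g and h.\<close>
  have p_eq: "k \<otimes> (\<one> \<oplus> g4) = p"
  proof (rule eqI)
    have "eq_on p (k \<otimes> (\<one> \<oplus> g4)) (k \<otimes> (\<one> \<oplus> \<one>))"
      by (intro eq_on_mult eq_on_add eq_on_refl g4) simp_all
    then show "eq_on p (k \<otimes> (\<one> \<oplus> g4)) p"
      using eq_on_sym[OF on_self[OF P(1)]] eq_on_trans by (simp add: kk r_distr)
    have "eq_on c (k \<otimes> (\<one> \<oplus> g4)) (k \<otimes> (\<one> \<oplus> \<ominus> \<one>))" "eq_on d (k \<otimes> (\<one> \<oplus> g4)) (k \<otimes> (\<one> \<oplus> \<ominus> \<one>))"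
      by (intro eq_on_mult eq_on_add eq_on_refl g4; simp)+
    then show "eq_on c (k \<otimes> (\<one> \<oplus> g4)) p" "eq_on d (k \<otimes> (\<one> \<oplus> g4)) p"
      using eq_on_sym[OF on_zero[OF mul(3)]] eq_on_sym[OF on_zero[OF mul(4)]] eq_on_trans
      by (simp_all add: r_neg)
  qed
  have c_eq: "e \<otimes> (k \<otimes> (\<one> \<oplus> h)) = c"
  proof (rule eqI)
    have ch: "eq_on c (k \<otimes> (\<one> \<oplus> h)) (k \<otimes> (\<one> \<oplus> \<one>))"
      by (intro eq_on_mult eq_on_add eq_on_refl h) simp_all
    have dh: "eq_on d (k \<otimes> (\<one> \<oplus> h)) (k \<otimes> (\<one> \<oplus> \<ominus> \<one>))"
      by (intro eq_on_mult eq_on_add eq_on_refl h) simp_all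
    have pe: "p \<otimes> (e \<otimes> w) = \<zero>" "c \<otimes> (e \<otimes> w) = c \<otimes> w" "d \<otimes> (e \<otimes> w) = d \<otimes> w" if "w \<in> carrier R" for w
    proof -
      show "p \<otimes> (e \<otimes> w) = \<zero>" using that by (simp add: PE flip: m_assoc)
      have "c \<otimes> (e \<otimes> w) = (e \<otimes> e) \<otimes> (q \<otimes> w)" using that by (simp add: c_def m_ac)
      then show "c \<otimes> (e \<otimes> w) = c \<otimes> w" using that by (simp add: PE c_def m_assoc)
      have "d \<otimes> (e \<otimes> w) = (e \<otimes> e) \<otimes> (f \<otimes> w)" using that by (simp add: d_def m_ac)
      then show "d \<otimes> (e \<otimes> w) = d \<otimes> w" using that by (simp add: PE d_def m_assoc)
    qed
    show "eq_on p (e \<otimes> (k \<otimes> (\<one> \<oplus> h))) c"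
      by (simp add: eq_on_def pe mul)
    show "eq_on c (e \<otimes> (k \<otimes> (\<one> \<oplus> h))) c"
      using ch by (simp add: eq_on_def pe mul r_distr kk)
    show "eq_on d (e \<otimes> (k \<otimes> (\<one> \<oplus> h))) c"
      using dh by (simp add: eq_on_def pe mul r_neg)
  qed
  have d_eq: "e \<ominus> c = d"
  proof -
    have "c \<oplus> d = e" by (simp add: c_def d_def QF flip: r_distr)
    then have "e = d \<oplus> c" by (simp add: a_comm)
    then show ?thesis by (simp add: minus_eq a_assoc r_neg)
  qed
  have s_eq: "glue h (\<epsilon> \<otimes> (g \<otimes> g)) (\<epsilon> \<otimes> (g \<otimes> g)) = s"
  proof (rule eqI)
    have "eq_on c (\<epsilon> \<otimes> (g \<otimes> g)) (\<epsilon> \<otimes> (\<epsilon> \<otimes> s))" "eq_on d (\<epsilon> \<otimes> (g \<otimes> g)) (\<epsilon> \<otimes> (\<epsilon> \<otimes> s))"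
      by (intro eq_on_mult eq_on_refl g2; simp)+
    moreover have "\<epsilon> \<otimes> (\<epsilon> \<otimes> s) = s" by (simp add: ee flip: m_assoc)
    ultimately have cs: "eq_on c (\<epsilon> \<otimes> (g \<otimes> g)) s" "eq_on d (\<epsilon> \<otimes> (g \<otimes> g)) s" by simp_all
    show "eq_on p (glue h (\<epsilon> \<otimes> (g \<otimes> g)) (\<epsilon> \<otimes> (g \<otimes> g))) s"
      by (rule eq_on_trans[OF glue(1) h(1)]) simp_all
    show "eq_on c (glue h (\<epsilon> \<otimes> (g \<otimes> g)) (\<epsilon> \<otimes> (g \<otimes> g))) s"
      by (rule eq_on_trans[OF glue(2) cs(1)]) simp_all
    show "eq_on d (glue h (\<epsilon> \<otimes> (g \<otimes> g)) (\<epsilon> \<otimes> (g \<otimes> g))) s"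
      by (rule eq_on_trans[OF glue(3) cs(2)]) simp_all
  qed
  have t_eq: "glue g (z' \<otimes> g) (s \<otimes> (z' \<otimes> g)) = t"
  proof (rule eqI)
    show "eq_on p (glue g (z' \<otimes> g) (s \<otimes> (z' \<otimes> g))) t"
      by (rule eq_on_trans[OF glue(1) g(1)]) simp_all
    have "eq_on c (z' \<otimes> g) (z' \<otimes> (z \<otimes> t))" by (intro eq_on_mult eq_on_refl g) simp_all
    also have "z' \<otimes> (z \<otimes> t) = (z' \<otimes> z) \<otimes> t" by (simp add: m_assoc)
    also have "eq_on c \<dots> (\<one> \<otimes> t)" by (intro eq_on_mult eq_on_refl on_c(1)[OF zz']) simp_all
    finally have 1: "eq_on c (z' \<otimes> g) t" by simp
    show "eq_on c (glue g (z' \<otimes> g) (s \<otimes> (z' \<otimes> g))) t"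
      by (rule eq_on_trans[OF glue(2) 1]) simp_all
    have "eq_on d (s \<otimes> (z' \<otimes> g)) (s \<otimes> (z' \<otimes> \<ominus> (z \<otimes> (s \<otimes> t))))" by (intro eq_on_mult eq_on_refl g) simp_all
    also have "s \<otimes> (z' \<otimes> \<ominus> (z \<otimes> (s \<otimes> t))) = (z' \<otimes> z) \<otimes> (\<ominus> (s \<otimes> s) \<otimes> t)"
      by (simp add: l_minus r_minus m_ac)
    also have "eq_on d \<dots> (\<one> \<otimes> (\<ominus> (\<ominus> \<one>) \<otimes> t))"
      by (intro eq_on_mult eq_on_minus eq_on_refl on_d(1)[OF zz'] on_d(1)[OF ss(2)]) simp_all
    finally have 2: "eq_on d (s \<otimes> (z' \<otimes> g)) t" by simp
    show "eq_on d (glue g (z' \<otimes> g) (s \<otimes> (z' \<otimes> g))) t"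
      by (rule eq_on_trans[OF glue(3) 2]) simp_all
  qed
  have "s \<in> I \<and> t \<in> I" if I: "subring I R" and mem: "k \<in> I" "v \<in> I" "\<epsilon> \<in> I" "g \<in> I" "h \<in> I" for I
  proof -
    have minus: "x \<ominus> y \<in> I" if "x \<in> I" "y \<in> I" for x y
      using that I by (simp add: minus_eq subringE)
    note closed = subringE(6,7)[OF I] mem minus subringE(3)[OF I]
    have p: "p \<in> I" unfolding p_eq[symmetric] g4_def by (intro closed)
    have c: "c \<in> I" unfolding c_eq[symmetric] e_def by (intro closed p)
    have d: "d \<in> I" unfolding d_eq[symmetric] e_def by (intro closed p c)
    have s: "s \<in> I" by (subst s_eq[symmetric], unfold glue_def) (intro closed p c d)
    have "t \<in> I" by (subst t_eq[symmetric], unfold glue_def z'_def) (intro closed p c d s)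
    with s show ?thesis ..
  qed
  then show ?thesis
    using g8 h2 by (intro that[of g h]) simp_all
qed

text \<open>Since x and y lie in e R, both cross terms contain the factor e (1 - e) = 0 and the
  product is formed componentwise.\<close>

lemma (in cring) orthogonal_mult:
  assumes [simp]: "e \<in> carrier R" "x \<in> carrier R" "y \<in> carrier R" "a \<in> carrier R" "b \<in> carrier R"
    and ee: "e \<otimes> e = e" and ex: "e \<otimes> x = x" and ey: "e \<otimes> y = y"
  shows "(x \<oplus> (\<one> \<ominus> e) \<otimes> a) \<otimes> (y \<oplus> (\<one> \<ominus> e) \<otimes> b) = x \<otimes> y \<oplus> (\<one> \<ominus> e) \<otimes> (a \<otimes> b)"
proof -
  define n where "n = \<one> \<ominus> e"
  have n [simp]: "n \<in> carrier R" by (simp add: n_def)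
  note ne = complement_idempotent[OF assms(1) ee, folded n_def]
  have "x \<otimes> n = x \<otimes> (e \<otimes> n)" "n \<otimes> y = (e \<otimes> n) \<otimes> y"
    by (subst (1) ex[symmetric], simp add: m_ac) (subst (1) ey[symmetric], simp add: m_ac)
  then have xn: "x \<otimes> n = \<zero>" and ny: "n \<otimes> y = \<zero>" by (simp_all add: ne)
  have "(x \<oplus> n \<otimes> a) \<otimes> (y \<oplus> n \<otimes> b) = x \<otimes> y \<oplus> (x \<otimes> n) \<otimes> b \<oplus> ((n \<otimes> y) \<otimes> a \<oplus> (n \<otimes> n) \<otimes> (a \<otimes> b))"
    by (simp add: l_distr r_distr) (simp add: m_ac a_ac)
  then show ?thesis unfolding n_def[symmetric] by (simp add: xn ny ne)
qed

section \<open>The universal property of a twisted group algebra\<close>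

context twisted_algebra
begin

text \<open>A homomorphism to a commutative ring B is prescribed by scalars \<iota> and images W g
  of the basis that obey the same multiplication rule. Commutativity of B lets the scalars move past
  W.\<close>

lemma lift_ring_hom:
  fixes B :: "('e, 'f) ring_scheme"
  assumes "cring B" and \<iota>: "\<iota> \<in> ring_hom F B"
    and W: "\<And>g. g \<in> carrier G \<Longrightarrow> W g \<in> carrier B"
    and W_mult: "\<And>g h. g \<in> carrier G \<Longrightarrow> h \<in> carrier G \<Longrightarrow>
      W g \<otimes>\<^bsub>B\<^esub> W h = \<iota> (\<alpha> g h) \<otimes>\<^bsub>B\<^esub> W (g \<otimes>\<^bsub>G\<^esub> h)"
    and W_one: "W \<one>\<^bsub>G\<^esub> = \<iota> (\<alpha> \<one>\<^bsub>G\<^esub> \<one>\<^bsub>G\<^esub>)"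
  shows "(\<lambda>x. \<Oplus>\<^bsub>B\<^esub>g\<in>carrier G. \<iota> (x g) \<otimes>\<^bsub>B\<^esub> W g) \<in> ring_hom A B" (is "?\<Phi> \<in> _")
proof (rule ring_hom_memI)
  interpret B: cring B by fact
  interpret \<iota>: ring_hom_cring F B \<iota>
    using \<iota> by unfold_locales
  note [simp] = W fin
  show "?\<Phi> x \<in> carrier B" if "x \<in> carrier A" for x
    using that by (auto intro!: B.finsum_closed)
  show "?\<Phi> (x \<oplus>\<^bsub>A\<^esub> y) = ?\<Phi> x \<oplus>\<^bsub>B\<^esub> ?\<Phi> y" if x: "x \<in> carrier A" and y: "y \<in> carrier A" for x y
  proof -
    have "?\<Phi> (x \<oplus>\<^bsub>A\<^esub> y) = (\<Oplus>\<^bsub>B\<^esub>g\<in>carrier G. \<iota> (x g) \<otimes>\<^bsub>B\<^esub> W g \<oplus>\<^bsub>B\<^esub> \<iota> (y g) \<otimes>\<^bsub>B\<^esub> W g)"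
      using x y by (intro B.finsum_cong') (auto simp: B.l_distr)
    also have "\<dots> = ?\<Phi> x \<oplus>\<^bsub>B\<^esub> ?\<Phi> y"
      using x y by (intro B.finsum_addf) auto
    finally show ?thesis .
  qed
  show "?\<Phi> (x \<otimes>\<^bsub>A\<^esub> y) = ?\<Phi> x \<otimes>\<^bsub>B\<^esub> ?\<Phi> y" if x: "x \<in> carrier A" and y: "y \<in> carrier A" for x y
  proof -
    note [simp] = x y
    let ?f = "\<lambda>g h. \<iota> (x g) \<otimes>\<^bsub>B\<^esub> \<iota> (y h) \<otimes>\<^bsub>B\<^esub> \<iota> (\<alpha> g h) \<otimes>\<^bsub>B\<^esub> W (g \<otimes>\<^bsub>G\<^esub> h)"
    have "?\<Phi> (x \<otimes>\<^bsub>A\<^esub> y) = (\<Oplus>\<^bsub>B\<^esub>k\<in>carrier G. \<Oplus>\<^bsub>B\<^esub>g\<in>carrier G. ?f g (inv\<^bsub>G\<^esub> g \<otimes>\<^bsub>G\<^esub> k))"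
    proof (intro B.finsum_cong' refl)
      fix k assume k [simp]: "k \<in> carrier G"
      have "\<iota> ((x \<otimes>\<^bsub>A\<^esub> y) k) \<otimes>\<^bsub>B\<^esub> W k = (\<Oplus>\<^bsub>B\<^esub>g\<in>carrier G.
         \<iota> (x g \<otimes>\<^bsub>F\<^esub> y (inv\<^bsub>G\<^esub> g \<otimes>\<^bsub>G\<^esub> k) \<otimes>\<^bsub>F\<^esub> \<alpha> g (inv\<^bsub>G\<^esub> g \<otimes>\<^bsub>G\<^esub> k))) \<otimes>\<^bsub>B\<^esub> W k"
        by (simp add: mult_coeff \<iota>.hom_finsum Pi_def o_def)
      also have "\<dots> = (\<Oplus>\<^bsub>B\<^esub>g\<in>carrier G.
         \<iota> (x g \<otimes>\<^bsub>F\<^esub> y (inv\<^bsub>G\<^esub> g \<otimes>\<^bsub>G\<^esub> k) \<otimes>\<^bsub>F\<^esub> \<alpha> g (inv\<^bsub>G\<^esub> g \<otimes>\<^bsub>G\<^esub> k)) \<otimes>\<^bsub>B\<^esub> W k)"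
        by (intro B.finsum_ldistr) auto
      also have "\<dots> = (\<Oplus>\<^bsub>B\<^esub>g\<in>carrier G. ?f g (inv\<^bsub>G\<^esub> g \<otimes>\<^bsub>G\<^esub> k))"
        by (intro B.finsum_cong') (auto simp: G.m_assoc[symmetric])
      finally show "\<iota> ((x \<otimes>\<^bsub>A\<^esub> y) k) \<otimes>\<^bsub>B\<^esub> W k = (\<Oplus>\<^bsub>B\<^esub>g\<in>carrier G. ?f g (inv\<^bsub>G\<^esub> g \<otimes>\<^bsub>G\<^esub> k))" .
    qed (auto intro!: B.finsum_closed)
    also have "\<dots> = (\<Oplus>\<^bsub>B\<^esub>g\<in>carrier G. \<Oplus>\<^bsub>B\<^esub>k\<in>carrier G. ?f g (inv\<^bsub>G\<^esub> g \<otimes>\<^bsub>G\<^esub> k))"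
      by (intro B.finsum_swap) auto
    also have "\<dots> = (\<Oplus>\<^bsub>B\<^esub>g\<in>carrier G. \<Oplus>\<^bsub>B\<^esub>h\<in>carrier G. ?f g h)"
    proof (rule B.finsum_cong'[OF refl])
      fix g assume g [simp]: "g \<in> carrier G"
      have "inj_on ((\<otimes>\<^bsub>G\<^esub>) g) (carrier G)" "(\<otimes>\<^bsub>G\<^esub>) g ` carrier G = carrier G"
        using G.inj_on_cmult[OF g] G.surj_const_mult[OF g] by auto
      then have "(\<Oplus>\<^bsub>B\<^esub>k\<in>carrier G. ?f g (inv\<^bsub>G\<^esub> g \<otimes>\<^bsub>G\<^esub> k)) =
          (\<Oplus>\<^bsub>B\<^esub>h\<in>carrier G. ?f g (inv\<^bsub>G\<^esub> g \<otimes>\<^bsub>G\<^esub> (g \<otimes>\<^bsub>G\<^esub> h)))"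
        using B.add.finprod_reindex[of "\<lambda>k. ?f g (inv\<^bsub>G\<^esub> g \<otimes>\<^bsub>G\<^esub> k)" "(\<otimes>\<^bsub>G\<^esub>) g" "carrier G"] by (auto simp: Pi_def)
      also have "\<dots> = (\<Oplus>\<^bsub>B\<^esub>h\<in>carrier G. ?f g h)"
        by (intro B.finsum_cong') (auto simp: G.m_assoc[symmetric])
      finally show "(\<Oplus>\<^bsub>B\<^esub>k\<in>carrier G. ?f g (inv\<^bsub>G\<^esub> g \<otimes>\<^bsub>G\<^esub> k)) = (\<Oplus>\<^bsub>B\<^esub>h\<in>carrier G. ?f g h)" .
    qed (auto intro!: B.finsum_closed)
    also have "\<dots> = (\<Oplus>\<^bsub>B\<^esub>g\<in>carrier G. \<iota> (x g) \<otimes>\<^bsub>B\<^esub> W g \<otimes>\<^bsub>B\<^esub> ?\<Phi> y)"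
    proof (intro B.finsum_cong' refl)
      fix g assume g [simp]: "g \<in> carrier G"
      have "?f g h = \<iota> (x g) \<otimes>\<^bsub>B\<^esub> W g \<otimes>\<^bsub>B\<^esub> (\<iota> (y h) \<otimes>\<^bsub>B\<^esub> W h)" if h [simp]: "h \<in> carrier G" for h
      proof -
        have "?f g h = \<iota> (x g) \<otimes>\<^bsub>B\<^esub> \<iota> (y h) \<otimes>\<^bsub>B\<^esub> (W g \<otimes>\<^bsub>B\<^esub> W h)"
          unfolding W_mult[OF g h] by (simp add: B.m_assoc)
        then show ?thesis by (simp add: B.m_ac)
      qed
      then have "(\<Oplus>\<^bsub>B\<^esub>h\<in>carrier G. ?f g h) = (\<Oplus>\<^bsub>B\<^esub>h\<in>carrier G. \<iota> (x g) \<otimes>\<^bsub>B\<^esub> W g \<otimes>\<^bsub>B\<^esub> (\<iota> (y h) \<otimes>\<^bsub>B\<^esub> W h))"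
        by (intro B.finsum_cong') auto
      also have "\<dots> = \<iota> (x g) \<otimes>\<^bsub>B\<^esub> W g \<otimes>\<^bsub>B\<^esub> ?\<Phi> y"
        by (subst B.finsum_rdistr) auto
      finally show "(\<Oplus>\<^bsub>B\<^esub>h\<in>carrier G. ?f g h) = \<iota> (x g) \<otimes>\<^bsub>B\<^esub> W g \<otimes>\<^bsub>B\<^esub> ?\<Phi> y" .
    qed (auto intro!: B.finsum_closed)
    also have "\<dots> = ?\<Phi> x \<otimes>\<^bsub>B\<^esub> ?\<Phi> y"
      by (subst B.finsum_ldistr) (auto intro!: B.finsum_closed)
    finally show ?thesis .
  qed
  have "?\<Phi> \<one>\<^bsub>A\<^esub> = (\<Oplus>\<^bsub>B\<^esub>g\<in>carrier G. if \<one>\<^bsub>G\<^esub> = g then \<iota> (\<one>\<^bsub>A\<^esub> g) \<otimes>\<^bsub>B\<^esub> W g else \<zero>\<^bsub>B\<^esub>)"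
    by (intro B.finsum_cong') (auto simp: one_coeff)
  also have "\<dots> = \<iota> (\<one>\<^bsub>A\<^esub> \<one>\<^bsub>G\<^esub>) \<otimes>\<^bsub>B\<^esub> W \<one>\<^bsub>G\<^esub>"
    by (rule B.finsum_singleton) auto
  also have "\<dots> = \<iota> (inv\<^bsub>F\<^esub> (\<alpha> \<one>\<^bsub>G\<^esub> \<one>\<^bsub>G\<^esub>) \<otimes>\<^bsub>F\<^esub> \<alpha> \<one>\<^bsub>G\<^esub> \<one>\<^bsub>G\<^esub>)"
    by (subst \<iota>.hom_mult) (auto simp: W_one one_coeff)
  also have "\<dots> = \<one>\<^bsub>B\<^esub>"
    by simp
  finally show "?\<Phi> \<one>\<^bsub>A\<^esub> = \<one>\<^bsub>B\<^esub>" .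
qed

lemma lift_single:
  fixes B :: "('e, 'f) ring_scheme"
  assumes "cring B" and \<iota>: "\<iota> \<in> ring_hom F B" and W: "\<And>g. g \<in> carrier G \<Longrightarrow> W g \<in> carrier B"
    and g: "g \<in> carrier G" and c: "c \<in> carrier F"
  shows "(\<Oplus>\<^bsub>B\<^esub>h\<in>carrier G. \<iota> (single g c h) \<otimes>\<^bsub>B\<^esub> W h) = \<iota> c \<otimes>\<^bsub>B\<^esub> W g"
proof -
  interpret B: cring B by fact
  interpret \<iota>: ring_hom_cring F B \<iota>
    using \<iota> by unfold_locales
  have "(\<Oplus>\<^bsub>B\<^esub>h\<in>carrier G. \<iota> (single g c h) \<otimes>\<^bsub>B\<^esub> W h) =
      (\<Oplus>\<^bsub>B\<^esub>h\<in>carrier G. if g = h then \<iota> c \<otimes>\<^bsub>B\<^esub> W h else \<zero>\<^bsub>B\<^esub>)"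
    using W c by (intro B.finsum_cong') (auto simp: single_def)
  also have "\<dots> = \<iota> c \<otimes>\<^bsub>B\<^esub> W g"
    using g W c fin by (intro B.finsum_singleton) auto
  finally show ?thesis .
qed

end

section \<open>Isomorphism of the untwisted group algebras\<close>

context twisted_algebra
begin

lemma finite_carrier_card:
  assumes "finite (carrier F)"
  shows "finite (carrier A)" "card (carrier A) = card (carrier F) ^ card (carrier G)"
proof -
  have bij: "bij_betw (\<lambda>x. restrict x (carrier G)) (carrier A) (carrier G \<rightarrow>\<^sub>E carrier F)"
  proof (rule bij_betw_byWitness[where f' = "\<lambda>x g. if g \<in> carrier G then x g else \<zero>\<^bsub>F\<^esub>"])
    show "\<forall>x\<in>carrier A. (\<lambda>g. if g \<in> carrier G then restrict x (carrier G) g else \<zero>\<^bsub>F\<^esub>) = x"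
      by (auto simp: fun_eq_iff coeff_outside)
    show "\<forall>x\<in>carrier G \<rightarrow>\<^sub>E carrier F. restrict (\<lambda>g. if g \<in> carrier G then x g else \<zero>\<^bsub>F\<^esub>) (carrier G) = x"
      by (auto simp: fun_eq_iff PiE_def extensional_def)
    show "(\<lambda>x. restrict x (carrier G)) ` carrier A \<subseteq> carrier G \<rightarrow>\<^sub>E carrier F"
      by (auto simp: PiE_iff)
    show "(\<lambda>x g. if g \<in> carrier G then x g else \<zero>\<^bsub>F\<^esub>) ` (carrier G \<rightarrow>\<^sub>E carrier F) \<subseteq> carrier A"
      by (auto intro!: carrierI)
  qed
  show "card (carrier A) = card (carrier F) ^ card (carrier G)"
    using bij_betw_same_card[OF bij] fin by (simp add: card_PiE)
  show "finite (carrier A)"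
    using bij_betw_finite[OF bij] fin assms by (simp add: finite_PiE)
qed

end

text \<open>For q = 4 j + 3 the number d = 2 j + 1 is odd, and the unit group has order 2 d. If -1 =
  1, odd multiples of 1 would all be 1, against q times 1 being 0.\<close>

lemma (in field) odd_exponent_if_card_mod_4:
  assumes fin: "finite (carrier R)" and card: "card (carrier R) mod 4 = 3"
  shows "odd_exponent_field R ((card (carrier R) - 1) div 2)"
proof
  define q where "q = card (carrier R)"
  have q: "q = 4 * (q div 4) + 3" using card by (metis q_def mult_div_mod_eq)
  show "odd ((card (carrier R) - 1) div 2)"
  proof -
    have "(q - 1) div 2 = 2 * (q div 4) + 1" using q by linarith
    then show ?thesis by (simp add: q_def)
  qed
  show "u [^] (2 * ((card (carrier R) - 1) div 2)) = \<one>" if "u \<in> Units R" for u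
  proof -
    have "card (Units R) = q - 1"
      using fin by (simp add: field_Units q_def card_Diff_singleton)
    moreover have "2 * ((q - 1) div 2) = q - 1"
      by (subst q, subst (2) q) simp
    moreover have "u [^] card (Units R) = \<one>"
      using fin that by (intro units_power_order_eq_one) auto
    ultimately show ?thesis by (simp add: q_def)
  qed
  show "\<ominus> \<one> \<noteq> \<one>"
  proof
    assume "\<ominus> \<one> = \<one>"
    then have 2: "\<one> \<oplus> \<one> = \<zero>" by (metis l_neg one_closed)
    have "add_pow R (4 * (q div 4) + 3) \<one> = \<zero>"
      using add.pow_order_eq_1[of \<one>] fin by (simp add: order_def q_def[symmetric] flip: q)
    moreover have "add_pow R (2 * j + 1) \<one> = \<one>" for j :: nat
      by (induction j) (simp_all add: 2 a_assoc)
    from this[of "2 * (q div 4) + 1"] have "add_pow R (4 * (q div 4) + 3) \<one> = \<one>"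
      by (simp add: numeral_3_eq_3)
    ultimately show False by simp
  qed
qed

text \<open>The d-th power of 2 is a sign and that of -1 is -1, so for one sign e the element 2 e
  has trivial d-th power and is the inverse of a square v^2. With k = 1/2 this is v^2 = e k.\<close>

lemma (in odd_exponent_field) sqrt_two_or_minus_two:
  obtains k v e where "k \<in> carrier F" "v \<in> carrier F" "e \<in> carrier F"
    "k \<oplus> k = \<one>" "v [^] (2::nat) = e \<otimes> k" "e [^] (2::nat) = \<one>"
proof -
  define w where "w = \<one> \<oplus> \<one>"
  have "w \<noteq> \<zero>" using minus_one by (metis minus_equality one_closed w_def)
  then have w [simp]: "w \<in> Units F" by (simp add: field_Units w_def)
  obtain e where e: "e = \<one> \<or> e = \<ominus> \<one>" "(e \<otimes> w) [^] d = \<one>"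
  proof (cases "w [^] d = \<one>")
    case True
    then show ?thesis by (intro that[of \<one>]) (auto simp: w Units_closed)
  next
    case False
    then have "w [^] d = \<ominus> \<one>" using unit_pow_d[OF w] by blast
    moreover have "(\<ominus> \<one> \<otimes> w) [^] d = (\<ominus> \<one>) [^] d \<otimes> w [^] d"
      by (intro nat_pow_distrib) (auto simp: Units_closed)
    ultimately have "(\<ominus> \<one> \<otimes> w) [^] d = \<one>"
      by (simp add: minus_one_pow_d l_minus)
    then show ?thesis
      by (intro that[of "\<ominus> \<one>"]) simp_all
  qed
  have eu: "e \<in> Units F" "e [^] (2::nat) = \<one>"
    using e(1) by (auto simp: minus_one_pow)
  obtain v where v: "v \<in> Units F" "v [^] (2::nat) \<otimes> (e \<otimes> w) = \<one>"
    using inverse_is_power[OF _ e(2), of 2] odd_d eu by auto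
  have "v [^] (2::nat) = inv (e \<otimes> w)"
    using v eu by (intro inv_char[symmetric]) (auto simp: m_comm Units_closed)
  also have "\<dots> = e \<otimes> inv w"
  proof -
    have "inv e = e"
      using eu by (intro inv_char) (auto simp: numeral_2_eq_2 Units_closed)
    then show ?thesis using eu by (simp add: inv_mult_units)
  qed
  finally have "v [^] (2::nat) = e \<otimes> inv w" .
  moreover have "inv w \<oplus> inv w = \<one>"
  proof -
    have "inv w \<oplus> inv w = w \<otimes> inv w"
      unfolding w_def[symmetric] using w by (simp add: w_def[of] l_distr Units_closed del: Units_r_inv)
    then show ?thesis using w by simp
  qed
  ultimately show ?thesis
    using that[of "inv w" v e] v eu by (simp add: Units_closed)
qed

text \<open>The two generators extend to a homomorphism from the algebra of C_8 x C_2. Its image is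
  a subring containing the scalars and the generators, hence s and t, hence everything. Both
  algebras have |F|^16 elements, so surjectivity already gives bijectivity.\<close>

lemma group_algebra_iso_odd_exponent_field:
  fixes F :: "('a, 'b) ring_scheme"
  assumes "odd_exponent_field F d" and finF: "finite (carrier F)"
  shows "group_algebra F C8xC2 \<simeq> group_algebra F C4xC4"
proof -
  interpret odd_exponent_field F d by fact
  let ?one = "\<lambda>(g :: int \<times> int) (h :: int \<times> int). \<one>\<^bsub>F\<^esub>"
  interpret G: bicyclic_group 8 2 by unfold_locales auto
  interpret H: bicyclic_group 4 4 by unfold_locales auto
  interpret G: bicyclic_algebra 8 2 F ?one
    by unfold_locales (auto simp: G.finite_carrier cocycles_def)
  interpret H: bicyclic_algebra 4 4 F ?one
    by unfold_locales (auto simp: H.finite_carrier cocycles_def)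
  interpret HA: cring H.A
    by (intro cring.intro H.is_ring comm_monoid.intro comm_monoid_axioms.intro ring.is_monoid
        H.symmetric_commutes comm_group_bicyclic refl)
  define \<iota> where "\<iota> c = H.single (0, 0) c" for c
  have one_H: "\<one>\<^bsub>H.A\<^esub> = \<iota> \<one>\<^bsub>F\<^esub>"
    unfolding \<iota>_def using twisted_algebra.one_eq[OF H.twisted_algebra_axioms] by simp
  have \<iota>: "\<iota> \<in> ring_hom F H.A"
    by (rule ring_hom_memI) (simp_all add: \<iota>_def H.single_add one_H)
  interpret \<iota>: ring_hom_cring F H.A \<iota>
    using \<iota> by unfold_locales
  have pow: "H.single g \<one>\<^bsub>F\<^esub> [^]\<^bsub>H.A\<^esub> n = H.single (g [^]\<^bsub>H.G\<^esub> n) \<one>\<^bsub>F\<^esub>"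
    if "g \<in> carrier H.G" for g and n :: nat
    using that by (simp add: H.single_pow pow_const_def)
  define s t where "s = H.single (1, 0) \<one>\<^bsub>F\<^esub>" and "t = H.single (0, 1) \<one>\<^bsub>F\<^esub>"
  have st [simp]: "s \<in> carrier H.A" "t \<in> carrier H.A"
    by (simp_all add: s_def t_def)
  have s4: "(s \<otimes>\<^bsub>H.A\<^esub> s) \<otimes>\<^bsub>H.A\<^esub> (s \<otimes>\<^bsub>H.A\<^esub> s) = \<one>\<^bsub>H.A\<^esub>"
    and t4: "(t \<otimes>\<^bsub>H.A\<^esub> t) \<otimes>\<^bsub>H.A\<^esub> (t \<otimes>\<^bsub>H.A\<^esub> t) = \<one>\<^bsub>H.A\<^esub>"
    by (simp_all add: s_def t_def one_H \<iota>_def H.carrier_eq)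
  obtain k v e where kve: "k \<in> carrier F" "v \<in> carrier F" "e \<in> carrier F"
    "k \<oplus>\<^bsub>F\<^esub> k = \<one>\<^bsub>F\<^esub>" "v [^]\<^bsub>F\<^esub> (2::nat) = e \<otimes>\<^bsub>F\<^esub> k" "e [^]\<^bsub>F\<^esub> (2::nat) = \<one>\<^bsub>F\<^esub>"
    by (rule sqrt_two_or_minus_two)
  obtain g h where gh [simp]: "g \<in> carrier H.A" "h \<in> carrier H.A"
    and g8: "g [^]\<^bsub>H.A\<^esub> (8::nat) = \<one>\<^bsub>H.A\<^esub>" and h2: "h [^]\<^bsub>H.A\<^esub> (2::nat) = \<one>\<^bsub>H.A\<^esub>"
    and gen: "\<And>I. \<lbrakk>subring I H.A; \<iota> k \<in> I; \<iota> v \<in> I; \<iota> e \<in> I; g \<in> I; h \<in> I\<rbrakk> \<Longrightarrow> s \<in> I \<and> t \<in> I"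
  proof (rule HA.eighth_root_generators[of s t "\<iota> k" "\<iota> v" "\<iota> e"])
    show "\<iota> k \<oplus>\<^bsub>H.A\<^esub> \<iota> k = \<one>\<^bsub>H.A\<^esub>"
      using kve by (simp flip: \<iota>.hom_add)
    show "\<iota> v \<otimes>\<^bsub>H.A\<^esub> \<iota> v = \<iota> e \<otimes>\<^bsub>H.A\<^esub> \<iota> k" "\<iota> e \<otimes>\<^bsub>H.A\<^esub> \<iota> e = \<one>\<^bsub>H.A\<^esub>"
      using kve by (simp_all add: numeral_2_eq_2 flip: \<iota>.hom_mult)
  qed (use kve s4 t4 that in auto)
  define W where "W x = g [^]\<^bsub>H.A\<^esub> nat (fst x) \<otimes>\<^bsub>H.A\<^esub> h [^]\<^bsub>H.A\<^esub> nat (snd x)" for x :: "int \<times> int"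
  have W [simp]: "W x \<in> carrier H.A" for x by (simp add: W_def)
  have W_mult: "W x \<otimes>\<^bsub>H.A\<^esub> W y = \<iota> \<one>\<^bsub>F\<^esub> \<otimes>\<^bsub>H.A\<^esub> W (x \<otimes>\<^bsub>G.G\<^esub> y)"
    if x: "x \<in> carrier G.G" and y: "y \<in> carrier G.G" for x y
  proof -
    obtain i j where x: "x = (int i, int j)" using G.carrierE[OF x] by blast
    obtain k l where y: "y = (int k, int l)" using G.carrierE[OF y] by blast
    have xy: "x \<otimes>\<^bsub>G.G\<^esub> y = (int ((i + k) mod 8), int ((j + l) mod 2))"
      by (simp add: x y zmod_int)
    have "W x \<otimes>\<^bsub>H.A\<^esub> W y = g [^]\<^bsub>H.A\<^esub> (i + k) \<otimes>\<^bsub>H.A\<^esub> h [^]\<^bsub>H.A\<^esub> (j + l)"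
      by (simp add: W_def x y H.A.nat_pow_mult[symmetric] HA.m_ac)
    also have "\<dots> = W (x \<otimes>\<^bsub>G.G\<^esub> y)"
      unfolding xy W_def fst_conv snd_conv nat_int using g8 h2 by (simp add: H.A_pow_mod)
    finally show ?thesis by (simp add: one_H[symmetric])
  qed
  have W_one: "W \<one>\<^bsub>G.G\<^esub> = \<iota> \<one>\<^bsub>F\<^esub>"
    unfolding W_def one_H[symmetric] G.one_eq fst_conv snd_conv nat_0 H.A.nat_pow_0 by simp
  define \<Phi> where "\<Phi> x = (\<Oplus>\<^bsub>H.A\<^esub>g\<in>carrier G.G. \<iota> (x g) \<otimes>\<^bsub>H.A\<^esub> W g)" for x
  have \<Phi>: "\<Phi> \<in> ring_hom G.A H.A"
    unfolding \<Phi>_def by (rule G.lift_ring_hom[OF HA.is_cring \<iota> W W_mult W_one])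
  have \<Phi>_single: "\<Phi> (G.single x c) = \<iota> c \<otimes>\<^bsub>H.A\<^esub> W x" if "x \<in> carrier G.G" "c \<in> carrier F" for x c
    unfolding \<Phi>_def using that by (intro G.lift_single[OF HA.is_cring \<iota>]) auto
  interpret \<Phi>: ring_hom_ring G.A H.A \<Phi>
    using \<Phi> G.is_ring H.is_ring by (intro ring_hom_ringI2)
  define I where "I = \<Phi> ` carrier G.A"
  have I: "subring I H.A"
    unfolding I_def using \<Phi>.img_is_subring[OF ring.carrier_is_subring[OF G.is_ring]] .
  have mem: "\<iota> c \<otimes>\<^bsub>H.A\<^esub> W x \<in> I" if "x \<in> carrier G.G" "c \<in> carrier F" for x c
    unfolding I_def using that \<Phi>_single[OF that] by (auto intro!: image_eqI[of _ _ "G.single x c"])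
  have \<iota>I: "\<iota> c \<in> I" if "c \<in> carrier F" for c
    using mem[of "(0, 0)" c] that W_one by (simp add: one_H[symmetric])
  have "g \<in> I" "h \<in> I"
    using mem[of "(1, 0)" "\<one>\<^bsub>F\<^esub>"] mem[of "(0, 1)" "\<one>\<^bsub>F\<^esub>"] by (simp_all add: W_def one_H[symmetric])
  then have sI: "s \<in> I" and tI: "t \<in> I"
    using gen[OF I] \<iota>I kve by auto
  have "carrier H.A \<subseteq> I"
  proof
    fix x assume x: "x \<in> carrier H.A"
    have "H.single y (x y) \<in> I" if y: "y \<in> carrier H.G" for y
    proof -
      obtain i j where ij: "i < 4" "j < 4" "y = (int i, int j)" using H.carrierE[OF y] by blast
      have pI: "a [^]\<^bsub>H.A\<^esub> (n::nat) \<in> I" if "a \<in> I" for a n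
        using that I by (induction n) (auto simp: subringE)
      have c: "x y \<in> carrier F" using x by simp
      have "H.single y (x y) = \<iota> (x y) \<otimes>\<^bsub>H.A\<^esub> (s [^]\<^bsub>H.A\<^esub> i \<otimes>\<^bsub>H.A\<^esub> t [^]\<^bsub>H.A\<^esub> j)"
        using ij c by (simp add: s_def t_def pow \<iota>_def H.carrier_eq)
      also have "\<dots> \<in> I"
        using \<iota>I[OF c] pI[OF sI] pI[OF tI] by (intro subringE(6)[OF I])
      finally show ?thesis .
    qed
    note single_mem = this
    have "(\<Oplus>\<^bsub>H.A\<^esub>y\<in>B. H.single y (x y)) \<in> I" if "finite B" "B \<subseteq> carrier H.G" for B
      using that
    proof (induction B rule: finite_induct)
      case empty
      show ?case using subringE(2)[OF I] by (simp only: H.A.finsum_empty)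
    next
      case (insert y B)
      then show ?case
        using x by (subst H.A.finsum_insert) (auto intro!: subringE(7)[OF I] single_mem)
    qed
    then show "x \<in> I"
      by (subst H.single_expansion[OF x]) (use H.finite_carrier in blast)
  qed
  then have img: "\<Phi> ` carrier G.A = carrier H.A"
    using subringE(1)[OF I] by (auto simp: I_def)
  have "card (carrier G.A) = card (carrier H.A)"
    using finF by (simp add: G.finite_carrier_card H.finite_carrier_card G.carrier_eq H.carrier_eq)
  then have "inj_on \<Phi> (carrier G.A)"
    using img finF by (intro eq_card_imp_inj_on) (auto simp: G.finite_carrier_card)
  then have "\<Phi> \<in> ring_iso G.A H.A"
    using \<Phi> img by (simp add: ring_iso_def bij_betw_def)
  then show ?thesis
    unfolding group_algebra_def C8xC2_eq C4xC4_eq is_ring_iso_def by blast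
qed

section \<open>Centers and Galois descent\<close>

definition center :: "('a, 'b) ring_scheme \<Rightarrow> 'a set" where
  "center R = {x \<in> carrier R. \<forall>z\<in>carrier R. x \<otimes>\<^bsub>R\<^esub> z = z \<otimes>\<^bsub>R\<^esub> x}"

lemma (in ring) center_cring: "cring (R\<lparr>carrier := center R\<rparr>)"
proof -
  have "subring (center R) R"
  proof (rule subringI)
    fix x y assume x: "x \<in> center R" and y: "y \<in> center R"
    then have [simp]: "x \<in> carrier R" "y \<in> carrier R" by (auto simp: center_def)
    have c: "x \<otimes> z = z \<otimes> x" "y \<otimes> z = z \<otimes> y" if "z \<in> carrier R" for z
      using x y that unfolding center_def by blast+
    show "x \<oplus> y \<in> center R"
      by (simp add: center_def l_distr r_distr c)
    have "x \<otimes> y \<otimes> z = z \<otimes> (x \<otimes> y)" if [simp]: "z \<in> carrier R" for z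
      by (simp add: m_assoc c(2)[of z]) (simp add: m_assoc[symmetric] c(1)[of z])
    then show "x \<otimes> y \<in> center R"
      by (simp add: center_def)
  next
    fix x assume "x \<in> center R"
    then show "\<ominus> x \<in> center R" by (auto simp: center_def l_minus r_minus)
  qed (auto simp: center_def)
  moreover have "x \<otimes> y = y \<otimes> x" if "x \<in> center R" "y \<in> center R" for x y
    using that unfolding center_def by blast
  ultimately have "subcring (center R) R"
    by (rule subcringI)
  moreover have "center R \<subseteq> carrier R"
    unfolding center_def by blast
  ultimately show ?thesis
    using subcring_iff by blast
qed

text \<open>Galois descent: the join of the idempotents conjugate to \<open>e\<close> is invariant, hence \<open>1\<close>,
  and the square roots of \<open>-1\<close> on the components can be glued along it.\<close>
lemma (in cring) sqrt_minus_one_descent: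
  assumes f: "f \<in> ring_hom R R" and h: "h \<in> ring_hom R R"
    and ff: "\<And>x. x \<in> carrier R \<Longrightarrow> f (f x) = x" and hh: "\<And>x. x \<in> carrier R \<Longrightarrow> h (h x) = x"
    and fh: "\<And>x. x \<in> carrier R \<Longrightarrow> f (h x) = h (f x)"
    and conn: "\<And>x. \<lbrakk>x \<in> carrier R; x \<otimes> x = x; f x = x; h x = x\<rbrakk> \<Longrightarrow> x = \<zero> \<or> x = \<one>"
    and e: "e \<in> carrier R" and y: "y \<in> carrier R"
    and ee: "e \<otimes> e = e" and ey: "e \<otimes> y = y" and yy: "y \<otimes> y \<oplus> e = \<zero>" and e0: "e \<noteq> \<zero>"
  shows "\<exists>u\<in>carrier R. u \<otimes> u \<oplus> \<one> = \<zero>"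
proof -
  have join: "\<exists>e'\<in>carrier R. \<exists>y'\<in>carrier R. e' \<otimes> e' = e' \<and> e' \<otimes> y' = y' \<and> y' \<otimes> y' \<oplus> e' = \<zero> \<and> e' \<noteq> \<zero> \<and>
      e' = e \<oplus> k e \<ominus> e \<otimes> k e"
    if k: "k \<in> ring_hom R R"
      and [simp]: "e \<in> carrier R" "y \<in> carrier R"
      and ee: "e \<otimes> e = e" and ey: "e \<otimes> y = y" and yy: "y \<otimes> y \<oplus> e = \<zero>" and e0: "e \<noteq> \<zero>" for k e y
  proof -
    interpret k: ring_hom_cring R R k
      using k by unfold_locales
    define a b where "a = k e" and "b = k y"
    have [simp]: "a \<in> carrier R" "b \<in> carrier R" by (simp_all add: a_def b_def)
    have aa: "a \<otimes> a = a" and ab: "a \<otimes> b = b" and bb: "b \<otimes> b \<oplus> a = \<zero>"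
      using ee ey yy by (simp_all add: a_def b_def flip: k.hom_mult k.hom_add)
    \<comment> \<open>The conjugates e and k e may overlap, so only the part of k e outside e is
      added, and y is extended by the conjugate root on that part alone.\<close>
    define e' y' where "e' = e \<oplus> (\<one> \<ominus> e) \<otimes> a" and "y' = y \<oplus> (\<one> \<ominus> e) \<otimes> b"
    have e'_eq: "e' = e \<oplus> a \<ominus> e \<otimes> a"
      by (simp add: e'_def minus_eq l_distr l_minus a_assoc)
    have [simp]: "e' \<in> carrier R" "y' \<in> carrier R" by (simp_all add: e'_def y'_def)
    have "e' \<otimes> e' = e'"
      unfolding e'_def by (simp add: orthogonal_mult ee aa)
    moreover have "e' \<otimes> y' = y'"
      unfolding e'_def y'_def by (simp add: orthogonal_mult ee ey ab)
    moreover have "y' \<otimes> y' \<oplus> e' = \<zero>"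
    proof -
      have "y' \<otimes> y' = y \<otimes> y \<oplus> (\<one> \<ominus> e) \<otimes> (b \<otimes> b)"
        unfolding y'_def by (simp add: orthogonal_mult ee ey)
      then have "y' \<otimes> y' \<oplus> e' = (y \<otimes> y \<oplus> e) \<oplus> (\<one> \<ominus> e) \<otimes> (b \<otimes> b \<oplus> a)"
        by (simp add: e'_def r_distr a_ac)
      then show ?thesis by (simp add: yy bb)
    qed
    moreover have "e' \<noteq> \<zero>"
    proof
      assume "e' = \<zero>"
      moreover have "e \<otimes> e' = e"
        using orthogonal_mult[of e e e \<zero> a] by (simp add: e'_def ee)
      ultimately show False using e0 by simp
    qed
    ultimately show ?thesis
      by (intro bexI[of _ e'] bexI[of _ y']) (simp_all add: e'_eq a_def)
  qed
  interpret f: ring_hom_cring R R f using f by unfold_locales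
  interpret h: ring_hom_cring R R h using h by unfold_locales
  obtain e1 y1 where 1: "e1 \<in> carrier R" "y1 \<in> carrier R" "e1 \<otimes> e1 = e1" "e1 \<otimes> y1 = y1" "y1 \<otimes> y1 \<oplus> e1 = \<zero>" "e1 \<noteq> \<zero>"
    and e1: "e1 = e \<oplus> f e \<ominus> e \<otimes> f e"
    using join[OF f e y ee ey yy e0] by blast
  \<comment> \<open>The expression e + f e - e f e is symmetric in e and f e, which the involution f
    exchanges.\<close>
  have fe1: "f e1 = e1"
    using e by (simp add: e1 ff minus_eq a_comm m_comm f.hom_a_inv)
  obtain e2 y2 where 2: "e2 \<in> carrier R" "y2 \<in> carrier R" "e2 \<otimes> e2 = e2" "e2 \<otimes> y2 = y2" "y2 \<otimes> y2 \<oplus> e2 = \<zero>" "e2 \<noteq> \<zero>"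
    and e2: "e2 = e1 \<oplus> h e1 \<ominus> e1 \<otimes> h e1"
    using join[OF h 1] by blast
  \<comment> \<open>Joining with the h-conjugate keeps invariance under f because f and h
    commute.\<close>
  have "h e2 = e2" "f e2 = e2"
    using 1(1) fe1 by (simp_all add: e2 hh fh minus_eq a_comm m_comm f.hom_a_inv h.hom_a_inv)
  then have "e2 = \<one>"
    using conn[OF 2(1,3)] 2(6) by blast
  then show ?thesis
    using 2 by blast
qed

lemma ring_iso_nat_pow:
  assumes "\<phi> \<in> ring_iso R S" "ring R" "x \<in> carrier R"
  shows "\<phi> (x [^]\<^bsub>R\<^esub> (n::nat)) = \<phi> x [^]\<^bsub>S\<^esub> n"
proof (induction n)
  case 0
  then show ?case using assms(1) by (simp add: ring_iso_memE)
next
  case (Suc n)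
  then show ?case
    using assms(1,3) monoid.nat_pow_closed[OF ring.is_monoid[OF assms(2)]] by (simp add: ring_iso_memE(2))
qed

lemma ring_iso_zero:
  assumes "\<phi> \<in> ring_iso R S" "ring R" "ring S"
  shows "\<phi> \<zero>\<^bsub>R\<^esub> = \<zero>\<^bsub>S\<^esub>"
proof -
  interpret ring_hom_ring R S \<phi>
    using assms by (intro ring_hom_ringI2) (auto simp: ring_iso_def)
  show ?thesis by simp
qed

lemma ring_iso_center:
  assumes "\<phi> \<in> ring_iso R S" "x \<in> center R"
  shows "\<phi> x \<in> center S"
  unfolding center_def
proof (intro CollectI conjI ballI)
  show "\<phi> x \<in> carrier S"
    using assms by (simp add: center_def ring_iso_memE(1))
  fix z assume "z \<in> carrier S"
  then obtain w where w: "w \<in> carrier R" "z = \<phi> w"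
    using ring_iso_memE(5)[OF assms(1)] by (auto simp: bij_betw_def)
  then show "\<phi> x \<otimes>\<^bsub>S\<^esub> z = z \<otimes>\<^bsub>S\<^esub> \<phi> x"
    using assms by (simp add: center_def flip: ring_iso_memE(2)[OF assms(1)])
qed

section \<open>Central elements and sign changes on their support\<close>

context twisted_algebra
begin

lemma mem_centerI:
  assumes "comm_group G" "x \<in> carrier A"
    and "\<And>g h. g \<in> carrier G \<Longrightarrow> h \<in> carrier G \<Longrightarrow> x g \<noteq> \<zero>\<^bsub>F\<^esub> \<Longrightarrow> \<alpha> g h = \<alpha> h g"
  shows "x \<in> center A"
  using assms symmetric_commutes unfolding center_def by blast

text \<open>Comparing the coefficients of x u_h and u_h x at g h gives x(g) \<alpha>(g,h) = x(g)
  \<alpha>(h,g), and in a field the nonzero x(g) cancels. So the center is spanned by the central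
  basis elements.\<close>

lemma center_support:
  assumes "field F" "comm_group G" "x \<in> center A" "g \<in> carrier G" "h \<in> carrier G" "x g \<noteq> \<zero>\<^bsub>F\<^esub>"
  shows "\<alpha> g h = \<alpha> h g"
proof -
  interpret field F by fact
  interpret G: comm_group G by fact
  have x: "x \<in> carrier A" using assms by (simp add: center_def)
  have "(x \<otimes>\<^bsub>A\<^esub> single h \<one>\<^bsub>F\<^esub>) (g \<otimes>\<^bsub>G\<^esub> h) = (single h \<one>\<^bsub>F\<^esub> \<otimes>\<^bsub>A\<^esub> x) (g \<otimes>\<^bsub>G\<^esub> h)"
    using assms by (simp add: center_def)
  moreover have "inv\<^bsub>G\<^esub> h \<otimes>\<^bsub>G\<^esub> (g \<otimes>\<^bsub>G\<^esub> h) = g" "g \<otimes>\<^bsub>G\<^esub> h \<otimes>\<^bsub>G\<^esub> inv\<^bsub>G\<^esub> h = g"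
    using assms by (simp_all add: G.m_comm[of g h] G.m_assoc[symmetric]) (simp add: G.m_comm[of h g] G.m_assoc)
  ultimately have "x g \<otimes>\<^bsub>F\<^esub> \<alpha> g h = x g \<otimes>\<^bsub>F\<^esub> \<alpha> h g"
    using assms x by (simp add: mult_single_coeff single_mult_coeff)
  then show ?thesis
    using assms x by (subst (asm) m_lcancel) auto
qed

text \<open>A convolution term with a vanishing factor needs no relation for \<chi>, so
  multiplicativity on a set D containing both supports suffices. This matters because a sign on the
  squares in C_4 need not extend to a character of C_4 with values in F.\<close>

lemma character_twist_mult:
  assumes \<chi>: "\<And>g. \<chi> g \<in> carrier F"
    and \<chi>_mult: "\<And>g h. g \<in> D \<Longrightarrow> h \<in> D \<Longrightarrow> \<chi> (g \<otimes>\<^bsub>G\<^esub> h) = \<chi> g \<otimes>\<^bsub>F\<^esub> \<chi> h"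
    and x: "x \<in> carrier A" "\<And>g. g \<in> carrier G \<Longrightarrow> x g \<noteq> \<zero>\<^bsub>F\<^esub> \<Longrightarrow> g \<in> D"
    and y: "y \<in> carrier A" "\<And>g. g \<in> carrier G \<Longrightarrow> y g \<noteq> \<zero>\<^bsub>F\<^esub> \<Longrightarrow> g \<in> D"
  shows "(\<lambda>g. \<chi> g \<otimes>\<^bsub>F\<^esub> (x \<otimes>\<^bsub>A\<^esub> y) g) = (\<lambda>g. \<chi> g \<otimes>\<^bsub>F\<^esub> x g) \<otimes>\<^bsub>A\<^esub> (\<lambda>g. \<chi> g \<otimes>\<^bsub>F\<^esub> y g)"
proof (rule carrier_eqI)
  have tw: "(\<lambda>g. \<chi> g \<otimes>\<^bsub>F\<^esub> z g) \<in> carrier A" if "z \<in> carrier A" for z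
    by (rule carrierI) (use that \<chi> in \<open>simp_all add: coeff_outside[OF that]\<close>)
  show "(\<lambda>g. \<chi> g \<otimes>\<^bsub>F\<^esub> (x \<otimes>\<^bsub>A\<^esub> y) g) \<in> carrier A"
    "(\<lambda>g. \<chi> g \<otimes>\<^bsub>F\<^esub> x g) \<otimes>\<^bsub>A\<^esub> (\<lambda>g. \<chi> g \<otimes>\<^bsub>F\<^esub> y g) \<in> carrier A"
    using x y by (auto intro!: tw mult_closed)
  fix k assume k [simp]: "k \<in> carrier G"
  note [simp] = x(1) y(1) \<chi> fin
  have "\<chi> k \<otimes>\<^bsub>F\<^esub> (x \<otimes>\<^bsub>A\<^esub> y) k = (\<Oplus>\<^bsub>F\<^esub>g\<in>carrier G.
      \<chi> k \<otimes>\<^bsub>F\<^esub> (x g \<otimes>\<^bsub>F\<^esub> y (inv\<^bsub>G\<^esub> g \<otimes>\<^bsub>G\<^esub> k) \<otimes>\<^bsub>F\<^esub> \<alpha> g (inv\<^bsub>G\<^esub> g \<otimes>\<^bsub>G\<^esub> k)))"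
    by (simp add: mult_coeff F.finsum_rdistr Pi_def)
  also have "\<dots> = ((\<lambda>g. \<chi> g \<otimes>\<^bsub>F\<^esub> x g) \<otimes>\<^bsub>A\<^esub> (\<lambda>g. \<chi> g \<otimes>\<^bsub>F\<^esub> y g)) k"
    unfolding mult_coeff[OF k]
  proof (intro F.finsum_cong' refl)
    fix g assume g [simp]: "g \<in> carrier G"
    let ?h = "inv\<^bsub>G\<^esub> g \<otimes>\<^bsub>G\<^esub> k"
    show "\<chi> k \<otimes>\<^bsub>F\<^esub> (x g \<otimes>\<^bsub>F\<^esub> y ?h \<otimes>\<^bsub>F\<^esub> \<alpha> g ?h) = \<chi> g \<otimes>\<^bsub>F\<^esub> x g \<otimes>\<^bsub>F\<^esub> (\<chi> ?h \<otimes>\<^bsub>F\<^esub> y ?h) \<otimes>\<^bsub>F\<^esub> \<alpha> g ?h"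
    proof (cases "x g = \<zero>\<^bsub>F\<^esub> \<or> y ?h = \<zero>\<^bsub>F\<^esub>")
      case False
      then have "\<chi> (g \<otimes>\<^bsub>G\<^esub> ?h) = \<chi> g \<otimes>\<^bsub>F\<^esub> \<chi> ?h"
        by (intro \<chi>_mult x(2) y(2)) auto
      moreover have "g \<otimes>\<^bsub>G\<^esub> ?h = k"
        by (simp add: G.m_assoc[symmetric])
      ultimately have "\<chi> k = \<chi> g \<otimes>\<^bsub>F\<^esub> \<chi> ?h" by simp
      then show ?thesis by (simp add: F.m_ac)
    qed auto
  qed auto
  finally show "\<chi> k \<otimes>\<^bsub>F\<^esub> (x \<otimes>\<^bsub>A\<^esub> y) k = ((\<lambda>g. \<chi> g \<otimes>\<^bsub>F\<^esub> x g) \<otimes>\<^bsub>A\<^esub> (\<lambda>g. \<chi> g \<otimes>\<^bsub>F\<^esub> y g)) k" .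
qed

end

lemma (in ring) inv_minus_one: "inv (\<ominus> \<one>) = \<ominus> \<one>"
  by (intro inv_char) (auto simp: l_minus)

lemma (in field) half_exists:
  assumes "\<ominus> \<one> \<noteq> \<one>"
  obtains k where "k \<in> carrier R" "k \<oplus> k = \<one>"
proof -
  have "\<one> \<oplus> \<one> \<noteq> \<zero>"
    using assms by (metis minus_equality one_closed)
  then have u: "\<one> \<oplus> \<one> \<in> Units R"
    by (simp add: field_Units)
  have "inv (\<one> \<oplus> \<one>) \<oplus> inv (\<one> \<oplus> \<one>) = (\<one> \<oplus> \<one>) \<otimes> inv (\<one> \<oplus> \<one>)"
    using u by (subst l_distr) (auto simp del: Units_r_inv)
  then show ?thesis
    using u that[of "inv (\<one> \<oplus> \<one>)"] by auto
qed

lemma (in field) double_eq_zero: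
  assumes "\<ominus> \<one> \<noteq> \<one>" "x \<in> carrier R" "\<ominus> x = x"
  shows "x = \<zero>"
proof -
  obtain k where k: "k \<in> carrier R" "k \<oplus> k = \<one>"
    using half_exists[OF assms(1)] .
  have "x = (k \<oplus> k) \<otimes> x" using k assms by simp
  also have "\<dots> = k \<otimes> (x \<oplus> x)" using k(1) assms(2) by (simp add: l_distr r_distr)
  also have "x \<oplus> x = \<zero>" using assms(2,3) by (metis l_neg)
  finally show ?thesis using k by simp
qed

context bicyclic_algebra
begin

text \<open>With anticommuting generators, a basis element with index (i, j) commutes with u_x
  exactly for even j and with u_y exactly for even i.\<close>

lemma mem_center_iff:
  assumes "field F" and c: "c = \<ominus>\<^bsub>F\<^esub> \<one>\<^bsub>F\<^esub>" and "\<ominus>\<^bsub>F\<^esub> \<one>\<^bsub>F\<^esub> \<noteq> \<one>\<^bsub>F\<^esub>" and x: "x \<in> carrier A"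
  shows "x \<in> center A \<longleftrightarrow> (\<forall>g\<in>carrier G. x g \<noteq> \<zero>\<^bsub>F\<^esub> \<longrightarrow> even (fst g) \<and> even (snd g))"
proof (intro iffI ballI impI)
  fix g assume xc: "x \<in> center A" and g: "g \<in> carrier G" and nz: "x g \<noteq> \<zero>\<^bsub>F\<^esub>"
  obtain i j where ij: "i < m" "j < n" "g = (int i, int j)"
    using carrierE[OF g] .
  have "comm_form F \<alpha> g (1, 0) = \<one>\<^bsub>F\<^esub>" "comm_form F \<alpha> g (0, 1) = \<one>\<^bsub>F\<^esub>"
    using center_support[OF assms(1) comm_group_bicyclic xc g _ nz] g by (simp_all add: comm_form_eq_one_iff)
  then have "(\<ominus>\<^bsub>F\<^esub> \<one>\<^bsub>F\<^esub>) [^]\<^bsub>F\<^esub> j = \<one>\<^bsub>F\<^esub>" "(\<ominus>\<^bsub>F\<^esub> \<one>\<^bsub>F\<^esub>) [^]\<^bsub>F\<^esub> i = \<one>\<^bsub>F\<^esub>"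
    using ij by (simp_all add: comm_form_gen1 comm_form_gen2 c F.inv_minus_one)
  then show "even (fst g) \<and> even (snd g)"
    using assms(3) ij(3) by (auto simp: F.minus_one_pow split: if_splits)
next
  assume ev: "\<forall>g\<in>carrier G. x g \<noteq> \<zero>\<^bsub>F\<^esub> \<longrightarrow> even (fst g) \<and> even (snd g)"
  show "x \<in> center A"
  proof (rule mem_centerI[OF comm_group_bicyclic x])
    fix g h assume g: "g \<in> carrier G" and h: "h \<in> carrier G" and nz: "x g \<noteq> \<zero>\<^bsub>F\<^esub>"
    obtain i j where ij: "i < m" "j < n" "g = (int i, int j)"
      using carrierE[OF g] .
    obtain k l where kl: "k < m" "l < n" "h = (int k, int l)"
      using carrierE[OF h] .
    have "even i" "even j" using ev g nz ij(3) by auto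
    have pow: "a [^]\<^bsub>F\<^esub> p = \<one>\<^bsub>F\<^esub>" if "a = \<one>\<^bsub>F\<^esub> \<or> a = \<ominus>\<^bsub>F\<^esub> \<one>\<^bsub>F\<^esub>" "even p" for a and p :: nat
      using that by (auto simp: F.minus_one_pow)
    have hx: "comm_form F \<alpha> (1, 0) h = inv\<^bsub>F\<^esub> (comm_form F \<alpha> h (1, 0))"
      and hy: "comm_form F \<alpha> (0, 1) h = inv\<^bsub>F\<^esub> (comm_form F \<alpha> h (0, 1))"
      using h by (simp_all add: comm_form_swap[of h])
    have "comm_form F \<alpha> (1, 0) h = \<one>\<^bsub>F\<^esub> \<or> comm_form F \<alpha> (1, 0) h = \<ominus>\<^bsub>F\<^esub> \<one>\<^bsub>F\<^esub>"
      "comm_form F \<alpha> (0, 1) h = \<one>\<^bsub>F\<^esub> \<or> comm_form F \<alpha> (0, 1) h = \<ominus>\<^bsub>F\<^esub> \<one>\<^bsub>F\<^esub>"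
      using hx hy comm_form_gen1[OF kl(1,2)] comm_form_gen2[OF kl(1,2)]
      by (simp_all add: kl(3) c F.inv_minus_one F.minus_one_pow)
    then have "comm_form F \<alpha> g h = \<one>\<^bsub>F\<^esub>"
      unfolding ij(3) comm_form_fst[OF ij(1,2) h] using \<open>even i\<close> \<open>even j\<close> by (simp add: pow)
    then show "\<alpha> g h = \<alpha> h g"
      using g h by (simp add: comm_form_eq_one_iff)
  qed
qed

end

text \<open>The conjugations between the components are the sign changes z -> -z and w -> -w, which
  are commuting involutions of the center. An element fixed by both is supported at the identity, so
  the fixed idempotents are scalar and hence 0 or 1, as \<open>sqrt_minus_one_descent\<close>
  requires.\<close>

lemma central_sqrt_minus_one_C4xC4:
  assumes "bicyclic_algebra 4 4 F \<alpha>" and "field F" and ne: "\<ominus>\<^bsub>F\<^esub> \<one>\<^bsub>F\<^esub> \<noteq> \<one>\<^bsub>F\<^esub>"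
    and c: "comm_form F \<alpha> (1, 0) (0, 1) = \<ominus>\<^bsub>F\<^esub> \<one>\<^bsub>F\<^esub>"
  defines "A \<equiv> twisted_group_algebra F (bicyclic 4 4) \<alpha>"
  assumes e: "e \<in> center A" and y: "y \<in> center A"
    and ee: "e \<otimes>\<^bsub>A\<^esub> e = e" and ey: "e \<otimes>\<^bsub>A\<^esub> y = y" and yy: "y \<otimes>\<^bsub>A\<^esub> y \<oplus>\<^bsub>A\<^esub> e = \<zero>\<^bsub>A\<^esub>" and e0: "e \<noteq> \<zero>\<^bsub>A\<^esub>"
  shows "\<exists>u\<in>center A. u \<otimes>\<^bsub>A\<^esub> u \<oplus>\<^bsub>A\<^esub> \<one>\<^bsub>A\<^esub> = \<zero>\<^bsub>A\<^esub>"
proof -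
  interpret field F by fact
  interpret B: bicyclic_algebra 4 4 F \<alpha>
    rewrites A: "twisted_group_algebra F (bicyclic 4 4) \<alpha> = A"
    by (fact, simp add: A_def)
  let ?D = "{(0, 0), (0, 2), (2, 0), (2, 2)} :: (int \<times> int) set"
  define f where "f \<chi> x = (\<lambda>g. \<chi> g \<otimes>\<^bsub>F\<^esub> x g)" for \<chi> x :: "int \<times> int \<Rightarrow> 'a"
  \<comment> \<open>The signs of z and w. They are multiplicative on the even indices
    \<open>?D\<close> but not on the whole group.\<close>
  define p q :: "int \<times> int \<Rightarrow> 'a" where "p g = (if fst g = 2 then \<ominus>\<^bsub>F\<^esub> \<one>\<^bsub>F\<^esub> else \<one>\<^bsub>F\<^esub>)"
    and "q g = (if snd g = 2 then \<ominus>\<^bsub>F\<^esub> \<one>\<^bsub>F\<^esub> else \<one>\<^bsub>F\<^esub>)" for g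
  have iff: "x \<in> center A \<longleftrightarrow> x \<in> carrier A \<and> (\<forall>g\<in>carrier B.G. x g \<noteq> \<zero>\<^bsub>F\<^esub> \<longrightarrow> even (fst g) \<and> even (snd g))" for x
    using B.mem_center_iff[OF \<open>field F\<close> c ne, of x] by (auto simp: center_def)
  have supp: "g \<in> ?D" if "x \<in> center A" "g \<in> carrier B.G" "x g \<noteq> \<zero>\<^bsub>F\<^esub>" for x g
  proof -
    have "even (fst g)" "even (snd g)" "fst g \<in> {0..<4}" "snd g \<in> {0..<4}"
      using that iff by (auto simp: B.carrier_eq)
    then have "fst g = 0 \<or> fst g = 2" "snd g = 0 \<or> snd g = 2"
      by (simp, presburger)+
    then show ?thesis by (cases g) auto
  qed
  interpret C: cring "A\<lparr>carrier := center A\<rparr>"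
    by (rule B.A.center_cring)
  have tw: "f \<chi> x \<in> carrier A" if "x \<in> carrier A" "\<And>g. \<chi> g \<in> carrier F" for \<chi> x
    by (rule B.carrierI) (use that in \<open>simp_all add: f_def B.coeff_outside[OF that(1)]\<close>)
  have hom: "f \<chi> \<in> ring_hom (A\<lparr>carrier := center A\<rparr>) (A\<lparr>carrier := center A\<rparr>)"
    if "\<chi> = p \<or> \<chi> = q" for \<chi>
  proof (rule ring_hom_memI)
    have \<chi> [simp]: "\<chi> g \<in> carrier F" for g using that by (auto simp: p_def q_def)
    have \<chi>_mult: "\<chi> (g \<otimes>\<^bsub>B.G\<^esub> h) = \<chi> g \<otimes>\<^bsub>F\<^esub> \<chi> h" if "g \<in> ?D" "h \<in> ?D" for g h
      using that \<open>\<chi> = p \<or> \<chi> = q\<close> by (auto simp: p_def q_def l_minus)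
    have cc: "x \<in> carrier A" if "x \<in> center A" for x
      using that by (simp add: center_def)
    show "f \<chi> x \<in> carrier (A\<lparr>carrier := center A\<rparr>)" if "x \<in> carrier (A\<lparr>carrier := center A\<rparr>)" for x
    proof -
      have x: "x \<in> center A" using that by simp
      have "even (fst g) \<and> even (snd g)" if "g \<in> carrier B.G" "f \<chi> x g \<noteq> \<zero>\<^bsub>F\<^esub>" for g
      proof -
        have "x g \<noteq> \<zero>\<^bsub>F\<^esub>" using that by (auto simp: f_def)
        then show ?thesis using x that iff by blast
      qed
      then show ?thesis
        using tw[OF cc[OF x], of \<chi>] iff by simp
    qed
    show "f \<chi> (x \<otimes>\<^bsub>A\<lparr>carrier := center A\<rparr>\<^esub> y) = f \<chi> x \<otimes>\<^bsub>A\<lparr>carrier := center A\<rparr>\<^esub> f \<chi> y"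
      if "x \<in> carrier (A\<lparr>carrier := center A\<rparr>)" "y \<in> carrier (A\<lparr>carrier := center A\<rparr>)" for x y
    proof -
      have xy: "x \<in> center A" "y \<in> center A" using that by simp_all
      show ?thesis
        using B.character_twist_mult[where D = ?D and \<chi> = \<chi>, OF \<chi> \<chi>_mult cc[OF xy(1)] supp[OF xy(1)] cc[OF xy(2)] supp[OF xy(2)]]
        by (simp add: f_def)
    qed
    show "f \<chi> (x \<oplus>\<^bsub>A\<lparr>carrier := center A\<rparr>\<^esub> y) = f \<chi> x \<oplus>\<^bsub>A\<lparr>carrier := center A\<rparr>\<^esub> f \<chi> y"
      if "x \<in> carrier (A\<lparr>carrier := center A\<rparr>)" "y \<in> carrier (A\<lparr>carrier := center A\<rparr>)" for x y
    proof -
      have xy: "x \<in> carrier A" "y \<in> carrier A" using that cc by simp_all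
      show ?thesis
        by (rule ext) (use xy in \<open>simp add: f_def r_distr\<close>)
    qed
    show "f \<chi> \<one>\<^bsub>A\<lparr>carrier := center A\<rparr>\<^esub> = \<one>\<^bsub>A\<lparr>carrier := center A\<rparr>\<^esub>"
      by (rule ext) (use that in \<open>auto simp: f_def B.one_coeff p_def q_def\<close>)
  qed
  have "\<exists>u\<in>carrier (A\<lparr>carrier := center A\<rparr>). u \<otimes>\<^bsub>A\<lparr>carrier := center A\<rparr>\<^esub> u \<oplus>\<^bsub>A\<lparr>carrier := center A\<rparr>\<^esub> \<one>\<^bsub>A\<lparr>carrier := center A\<rparr>\<^esub> = \<zero>\<^bsub>A\<lparr>carrier := center A\<rparr>\<^esub>"
  proof (rule C.sqrt_minus_one_descent[of "f p" "f q" e y])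
    fix x assume "x \<in> carrier (A\<lparr>carrier := center A\<rparr>)"
    then have xc: "x \<in> center A" by simp
    then have x [simp]: "x \<in> carrier A" by (simp add: center_def)
    show "f p (f p x) = x" "f q (f q x) = x"
      by (auto simp: f_def p_def q_def fun_eq_iff l_minus)
    show "f p (f q x) = f q (f p x)"
      by (auto simp: f_def p_def q_def fun_eq_iff l_minus r_minus)
    assume xx: "x \<otimes>\<^bsub>A\<lparr>carrier := center A\<rparr>\<^esub> x = x" and px: "f p x = x" and qx: "f q x = x"
    \<comment> \<open>Every nontrivial even index is negated by p or by q, so invariance gives -x(g)
      = x(g), and 2 is invertible.\<close>
    have "x g = \<zero>\<^bsub>F\<^esub>" if g: "g \<noteq> (0, 0)" for g
    proof (rule ccontr)
      assume nz: "x g \<noteq> \<zero>\<^bsub>F\<^esub>"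
      then have "g \<in> ?D"
        using supp[OF xc] B.coeff_outside[OF x] by blast
      then have "\<ominus>\<^bsub>F\<^esub> (x g) = x g"
        using g fun_cong[OF px, of g] fun_cong[OF qx, of g] by (auto simp: f_def p_def q_def l_minus)
      then show False
        using double_eq_zero[OF ne] nz by simp
    qed
    then have x_eq: "x = B.single (0, 0) (x (0, 0))"
      by (auto simp: B.single_def fun_eq_iff)
    define b where "b = x (0, 0)"
    define a where "a = \<alpha> (0, 0) (0, 0)"
    have b: "b \<in> carrier F" and a: "a \<in> Units F" by (simp_all add: b_def a_def)
    have x_eq: "x = B.single (0, 0) b" using x_eq by (simp add: b_def)
    have "B.single (0, 0) (b \<otimes>\<^bsub>F\<^esub> b \<otimes>\<^bsub>F\<^esub> a) (0, 0) = B.single (0, 0) b (0, 0)"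
      using xx b unfolding x_eq by (simp add: a_def)
    then have "b \<otimes>\<^bsub>F\<^esub> (b \<otimes>\<^bsub>F\<^esub> a) = b \<otimes>\<^bsub>F\<^esub> \<one>\<^bsub>F\<^esub>"
      using a b by (simp add: B.single_def m_assoc Units_closed)
    then have "b = \<zero>\<^bsub>F\<^esub> \<or> b \<otimes>\<^bsub>F\<^esub> a = \<one>\<^bsub>F\<^esub>"
      using a b by (metis Units_closed m_closed m_lcancel one_closed)
    then have "x = \<zero>\<^bsub>A\<^esub> \<or> x = \<one>\<^bsub>A\<^esub>"
    proof
      assume "b = \<zero>\<^bsub>F\<^esub>"
      then have "x = \<zero>\<^bsub>A\<^esub>" unfolding x_eq by (simp add: B.single_def fun_eq_iff)
      then show ?thesis ..
    next
      assume "b \<otimes>\<^bsub>F\<^esub> a = \<one>\<^bsub>F\<^esub>"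
      then have "b = inv\<^bsub>F\<^esub> a" using a b by (metis Units_closed comm_inv_char m_comm)
      then have "x = \<one>\<^bsub>A\<^esub>" unfolding x_eq by (simp add: B.single_def B.one_coeff fun_eq_iff a_def)
      then show ?thesis ..
    qed
    then show "x = \<zero>\<^bsub>A\<lparr>carrier := center A\<rparr>\<^esub> \<or> x = \<one>\<^bsub>A\<lparr>carrier := center A\<rparr>\<^esub>" by simp
  qed (use e y ee ey yy e0 in \<open>simp_all add: hom\<close>)
  then show ?thesis by simp
qed

section \<open>Inequivalence over every field\<close>

lemma pow_four_eq_minus_one:
  assumes "field F" and ne: "\<ominus>\<^bsub>F\<^esub> \<one>\<^bsub>F\<^esub> \<noteq> \<one>\<^bsub>F\<^esub>"
    and no: "\<And>i. i \<in> carrier F \<Longrightarrow> i \<otimes>\<^bsub>F\<^esub> i \<noteq> \<ominus>\<^bsub>F\<^esub> \<one>\<^bsub>F\<^esub>"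
    and c: "c \<in> carrier F" "c [^]\<^bsub>F\<^esub> (4::nat) = \<one>\<^bsub>F\<^esub>" "c \<noteq> \<one>\<^bsub>F\<^esub>"
  shows "c = \<ominus>\<^bsub>F\<^esub> \<one>\<^bsub>F\<^esub>"
proof -
  interpret field F by fact
  have "(c [^]\<^bsub>F\<^esub> (2::nat)) [^]\<^bsub>F\<^esub> (2::nat) = \<one>\<^bsub>F\<^esub>"
    using c by (simp add: nat_pow_pow)
  then have "c [^]\<^bsub>F\<^esub> (2::nat) = \<one>\<^bsub>F\<^esub> \<or> c [^]\<^bsub>F\<^esub> (2::nat) = \<ominus>\<^bsub>F\<^esub> \<one>\<^bsub>F\<^esub>"
    using c by (intro pow_two_eq_one) auto
  then have "c [^]\<^bsub>F\<^esub> (2::nat) = \<one>\<^bsub>F\<^esub>"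
    using no[OF c(1)] c(1) by (auto simp: numeral_2_eq_2)
  then show ?thesis
    using pow_two_eq_one[OF c(1)] c(3) by blast
qed

lemma bicyclic_algebraI:
  assumes "field F" "\<alpha> \<in> cocycles (bicyclic m n) F" "m \<ge> 2" "n \<ge> 2"
  shows "bicyclic_algebra m n F \<alpha>"
proof -
  interpret field F by fact
  interpret G: bicyclic_group m n using assms by unfold_locales
  show ?thesis using assms(2) by unfold_locales (auto simp: G.finite_carrier)
qed

lemma twisted_equiv_transfer:
  assumes "twisted_equiv F G H" "group G" "group H" "cring F"
    and \<alpha>: "\<alpha> \<in> cocycles G F"
  obtains \<beta> where "\<beta> \<in> cocycles H F" "twisted_group_algebra F G \<alpha> \<simeq> twisted_group_algebra F H \<beta>"
proof -
  interpret G: cohomology G F using assms by (simp add: cohomology_def)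
  interpret H: cohomology H F using assms by (simp add: cohomology_def)
  obtain \<psi> where \<psi>: "\<psi> \<in> iso (H2 G F) (H2 H F)" and
    eq: "\<And>C \<alpha> \<beta>. C \<in> carrier (H2 G F) \<Longrightarrow> \<alpha> \<in> C \<Longrightarrow> \<beta> \<in> \<psi> C \<Longrightarrow>
      twisted_group_algebra F G \<alpha> \<simeq> twisted_group_algebra F H \<beta>"
    using assms(1) unfolding twisted_equiv_def by blast
  let ?C = "coboundaries G F #>\<^bsub>Z2_group G F\<^esub> \<alpha>"
  have "\<psi> ?C \<in> carrier (H2 H F)"
    using \<psi> G.H2_class(1)[OF \<alpha>] by (auto simp: iso_def hom_def)
  then obtain \<beta> where "\<beta> \<in> cocycles H F" "\<beta> \<in> \<psi> ?C"
    using H.H2_representative by blast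
  then show ?thesis
    using that eq[OF G.H2_class[OF \<alpha>]] by blast
qed

text \<open>Start with a class C mapped to the class of \<beta>. Since \<psi> is a homomorphism, it
  maps C^2 to the square of that class, so \<alpha>^2 and \<beta>^2 are matching representatives for
  any \<alpha> in C.\<close>

lemma twisted_equiv_transfer_square:
  assumes "twisted_equiv F G H" "group G" "group H" "cring F"
    and \<beta>: "\<beta> \<in> cocycles H F"
  obtains \<alpha> where "\<alpha> \<in> cocycles G F"
    "twisted_group_algebra F G (\<lambda>g h. \<alpha> g h \<otimes>\<^bsub>F\<^esub> \<alpha> g h) \<simeq>
      twisted_group_algebra F H (\<lambda>g h. \<beta> g h \<otimes>\<^bsub>F\<^esub> \<beta> g h)"
proof -
  interpret G: cohomology G F using assms by (simp add: cohomology_def)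
  interpret H: cohomology H F using assms by (simp add: cohomology_def)
  obtain \<psi> where \<psi>: "\<psi> \<in> iso (H2 G F) (H2 H F)" and
    eq: "\<And>C \<alpha> \<beta>. C \<in> carrier (H2 G F) \<Longrightarrow> \<alpha> \<in> C \<Longrightarrow> \<beta> \<in> \<psi> C \<Longrightarrow>
      twisted_group_algebra F G \<alpha> \<simeq> twisted_group_algebra F H \<beta>"
    using assms(1) unfolding twisted_equiv_def by blast
  let ?D = "coboundaries H F #>\<^bsub>Z2_group H F\<^esub> \<beta>"
  obtain C where C: "C \<in> carrier (H2 G F)" "\<psi> C = ?D"
  proof -
    have "\<psi> ` carrier (H2 G F) = carrier (H2 H F)"
      using \<psi> by (simp add: iso_def bij_betw_def)
    then have "?D \<in> \<psi> ` carrier (H2 G F)"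
      using H.H2_class(1)[OF \<beta>] by simp
    then show ?thesis using that by (metis imageE)
  qed
  obtain \<alpha> where \<alpha>: "\<alpha> \<in> cocycles G F" "\<alpha> \<in> C"
    using G.H2_representative[OF C(1)] by blast
  have "\<psi> (C \<otimes>\<^bsub>H2 G F\<^esub> C) = ?D \<otimes>\<^bsub>H2 H F\<^esub> ?D"
    using hom_mult[of \<psi> "H2 G F" "H2 H F" C C] \<psi> C by (simp add: iso_def)
  then have "(\<lambda>g h. \<beta> g h \<otimes>\<^bsub>F\<^esub> \<beta> g h) \<in> \<psi> (C \<otimes>\<^bsub>H2 G F\<^esub> C)"
    using H.H2_mult_mem[OF H.H2_class(2)[OF \<beta>] H.H2_class(2)[OF \<beta>]] by simp
  moreover have "C \<otimes>\<^bsub>H2 G F\<^esub> C \<in> carrier (H2 G F)"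
    using C(1) monoid.m_closed[OF group.is_monoid[OF G.H2_group]] by blast
  ultimately show ?thesis
    using that[OF \<alpha>(1)] eq G.H2_mult_mem[OF \<alpha>(2) \<alpha>(2)] by blast
qed

lemma ring_iso_commutes:
  assumes "R \<simeq> S" "\<And>x y. x \<in> carrier R \<Longrightarrow> y \<in> carrier R \<Longrightarrow> x \<otimes>\<^bsub>R\<^esub> y = y \<otimes>\<^bsub>R\<^esub> x"
    and "x \<in> carrier S" "y \<in> carrier S"
  shows "x \<otimes>\<^bsub>S\<^esub> y = y \<otimes>\<^bsub>S\<^esub> x"
proof -
  obtain \<phi> where \<phi>: "\<phi> \<in> ring_iso R S" using assms(1) unfolding is_ring_iso_def by blast
  obtain a b where "a \<in> carrier R" "x = \<phi> a" "b \<in> carrier R" "y = \<phi> b"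
    using assms(3,4) bij_betw_imp_surj_on[OF ring_iso_memE(5)[OF \<phi>]] by blast
  then show ?thesis
    using assms(2)[of a b] by (simp flip: ring_iso_memE(2)[OF \<phi>])
qed

text \<open>Translates commutativity, which every ring isomorphism preserves, into a condition on
  one pair of cocycle values; these values are the coefficients of u_x u_y and u_y u_x at (1,
  1).\<close>

lemma (in bicyclic_algebra) commutative_iff:
  "(\<forall>x\<in>carrier A. \<forall>y\<in>carrier A. x \<otimes>\<^bsub>A\<^esub> y = y \<otimes>\<^bsub>A\<^esub> x) \<longleftrightarrow> \<alpha> (1, 0) (0, 1) = \<alpha> (0, 1) (1, 0)"
proof
  assume "\<forall>x\<in>carrier A. \<forall>y\<in>carrier A. x \<otimes>\<^bsub>A\<^esub> y = y \<otimes>\<^bsub>A\<^esub> x"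
  then have "(single (1, 0) \<one>\<^bsub>F\<^esub> \<otimes>\<^bsub>A\<^esub> single (0, 1) \<one>\<^bsub>F\<^esub>) (1, 1) = (single (0, 1) \<one>\<^bsub>F\<^esub> \<otimes>\<^bsub>A\<^esub> single (1, 0) \<one>\<^bsub>F\<^esub>) (1, 1)"
    by simp
  then show "\<alpha> (1, 0) (0, 1) = \<alpha> (0, 1) (1, 0)"
    using m n by simp (simp add: single_def)
next
  assume "\<alpha> (1, 0) (0, 1) = \<alpha> (0, 1) (1, 0)"
  then show "\<forall>x\<in>carrier A. \<forall>y\<in>carrier A. x \<otimes>\<^bsub>A\<^esub> y = y \<otimes>\<^bsub>A\<^esub> x"
    using symmetric symmetric_commutes[OF _ comm_group_bicyclic] by blast
qed

lemma not_twisted_equiv_sqrt_minus_one: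
  assumes "field F" and ne: "\<ominus>\<^bsub>F\<^esub> \<one>\<^bsub>F\<^esub> \<noteq> \<one>\<^bsub>F\<^esub>" and i: "i \<in> carrier F" "i \<otimes>\<^bsub>F\<^esub> i = \<ominus>\<^bsub>F\<^esub> \<one>\<^bsub>F\<^esub>"
  shows "\<not> twisted_equiv F (bicyclic 8 2) (bicyclic 4 4)"
proof
  assume equiv: "twisted_equiv F (bicyclic 8 2) (bicyclic 4 4)"
  interpret field F by fact
  interpret G: bicyclic_group 8 2 by unfold_locales auto
  interpret H: bicyclic_group 4 4 by unfold_locales auto
  have i4: "i [^]\<^bsub>F\<^esub> (4::nat) = \<one>\<^bsub>F\<^esub>"
  proof -
    have "i [^]\<^bsub>F\<^esub> (4::nat) = (i \<otimes>\<^bsub>F\<^esub> i) \<otimes>\<^bsub>F\<^esub> (i \<otimes>\<^bsub>F\<^esub> i)"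
      using i(1) by (simp add: numeral_eq_Suc m_assoc)
    then show ?thesis by (simp add: i l_minus)
  qed
  have iU: "i \<in> Units F"
    using i by (simp add: field_Units) (metis l_null one_not_zero a_inv_closed minus_minus minus_zero one_closed)
  have \<beta>: "bichar F H.G i \<in> cocycles H.G F"
    using H.bichar_cocycle[OF is_cring iU] i4 by simp
  obtain \<alpha> where \<alpha>: "\<alpha> \<in> cocycles G.G F" and
    eq: "twisted_group_algebra F G.G (\<lambda>g h. \<alpha> g h \<otimes>\<^bsub>F\<^esub> \<alpha> g h) \<simeq>
      twisted_group_algebra F H.G (\<lambda>g h. bichar F H.G i g h \<otimes>\<^bsub>F\<^esub> bichar F H.G i g h)"
    by (rule twisted_equiv_transfer_square[OF equiv G.G.is_group H.G.is_group is_cring \<beta>])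
  interpret CG: cohomology G.G F by unfold_locales
  interpret CH: cohomology H.G F by unfold_locales
  interpret A: bicyclic_algebra 8 2 F \<alpha>
    using \<alpha> by (intro bicyclic_algebraI) (auto intro: field_axioms)
  interpret A2: bicyclic_algebra 8 2 F "\<lambda>g h. \<alpha> g h \<otimes>\<^bsub>F\<^esub> \<alpha> g h"
    using CG.cocycles_mult[OF \<alpha> \<alpha>] by (intro bicyclic_algebraI) (auto intro: field_axioms)
  interpret B2: bicyclic_algebra 4 4 F "\<lambda>g h. bichar F H.G i g h \<otimes>\<^bsub>F\<^esub> bichar F H.G i g h"
    using CH.cocycles_mult[OF \<beta> \<beta>] by (intro bicyclic_algebraI) (auto intro: field_axioms)
  \<comment> \<open>The commutator of the squared cocycle is the square of the commutator
    \<open>A.c\<close>, and that is 1 because the second factor of C_8 x C_2 has order 2.\<close>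
  have "\<alpha> (1, 0) (0, 1) \<otimes>\<^bsub>F\<^esub> \<alpha> (1, 0) (0, 1) = (A.c \<otimes>\<^bsub>F\<^esub> A.c) \<otimes>\<^bsub>F\<^esub> (\<alpha> (0, 1) (1, 0) \<otimes>\<^bsub>F\<^esub> \<alpha> (0, 1) (1, 0))"
    by (subst (1 2) A.comm_form_mult[symmetric]) (simp_all add: m_ac Units_closed)
  also have "A.c \<otimes>\<^bsub>F\<^esub> A.c = A.c [^]\<^bsub>F\<^esub> (2::nat)"
  proof -
    have sq: "x \<otimes>\<^bsub>F\<^esub> x = x [^]\<^bsub>F\<^esub> (2::nat)" if "x \<in> carrier F" for x
      using that by (simp add: numeral_2_eq_2)
    show ?thesis by (rule sq) (simp add: Units_closed)
  qed
  also have "A.c [^]\<^bsub>F\<^esub> (2::nat) = \<one>\<^bsub>F\<^esub>"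
    by (rule A.c_pow_snd)
  finally have "\<forall>x\<in>carrier A2.A. \<forall>y\<in>carrier A2.A. x \<otimes>\<^bsub>A2.A\<^esub> y = y \<otimes>\<^bsub>A2.A\<^esub> x"
    by (subst A2.commutative_iff) simp
  then have "\<forall>x\<in>carrier B2.A. \<forall>y\<in>carrier B2.A. x \<otimes>\<^bsub>B2.A\<^esub> y = y \<otimes>\<^bsub>B2.A\<^esub> x"
    using ring_iso_commutes[OF eq] by blast
  \<comment> \<open>For the squared cocycle on C_4 x C_4 the commutator is i^2 = -1, which differs
    from 1.\<close>
  then show False
    using ne i by (subst (asm) B2.commutative_iff) (simp add: H.bichar_gens is_cring)
qed

lemma not_twisted_equiv_char_two:
  assumes "field F" and two: "\<one>\<^bsub>F\<^esub> \<oplus>\<^bsub>F\<^esub> \<one>\<^bsub>F\<^esub> = \<zero>\<^bsub>F\<^esub>"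
  shows "\<not> twisted_equiv F (bicyclic 8 2) (bicyclic 4 4)"
proof
  assume equiv: "twisted_equiv F (bicyclic 8 2) (bicyclic 4 4)"
  interpret field F by fact
  interpret G: bicyclic_group 8 2 by unfold_locales auto
  interpret H: bicyclic_group 4 4 by unfold_locales auto
  let ?one = "\<lambda>(g :: int \<times> int) (h :: int \<times> int). \<one>\<^bsub>F\<^esub>"
  have one: "?one \<in> cocycles G.G F" by (simp add: cocycles_def)
  obtain \<beta> where \<beta>: "\<beta> \<in> cocycles H.G F" and
    eq: "twisted_group_algebra F G.G ?one \<simeq> twisted_group_algebra F H.G \<beta>"
    by (rule twisted_equiv_transfer[OF equiv G.G.is_group H.G.is_group is_cring one])
  interpret A: bicyclic_algebra 8 2 F ?one
    using one by (intro bicyclic_algebraI) (auto intro: field_axioms)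
  interpret B: bicyclic_algebra 4 4 F \<beta>
    using \<beta> by (intro bicyclic_algebraI) (auto intro: field_axioms)
  have commA: "\<forall>x\<in>carrier A.A. \<forall>y\<in>carrier A.A. x \<otimes>\<^bsub>A.A\<^esub> y = y \<otimes>\<^bsub>A.A\<^esub> x"
    by (subst A.commutative_iff) simp
  then have commB: "x \<otimes>\<^bsub>B.A\<^esub> y = y \<otimes>\<^bsub>B.A\<^esub> x" if "x \<in> carrier B.A" "y \<in> carrier B.A" for x y
    using ring_iso_commutes[OF eq] that by blast
  interpret AC: cring A.A
    using commA by (intro cring.intro A.is_ring comm_monoid.intro comm_monoid_axioms.intro ring.is_monoid) auto
  interpret BC: cring B.A
    using commB by (intro cring.intro B.is_ring comm_monoid.intro comm_monoid_axioms.intro ring.is_monoid) auto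
  \<comment> \<open>Additivity of the Frobenius map, used twice. The statement covers any
    commutative ring with x + x = 0, so that it serves both algebras.\<close>
  have pow4: "(a \<oplus>\<^bsub>R\<^esub> b) [^]\<^bsub>R\<^esub> (4::nat) = a [^]\<^bsub>R\<^esub> (4::nat) \<oplus>\<^bsub>R\<^esub> b [^]\<^bsub>R\<^esub> (4::nat)"
    if "cring R" and a: "a \<in> carrier R" and b: "b \<in> carrier R"
      and dbl: "\<And>x. x \<in> carrier R \<Longrightarrow> x \<oplus>\<^bsub>R\<^esub> x = \<zero>\<^bsub>R\<^esub>" for R :: "(int \<times> int \<Rightarrow> 'a) ring" and a b
  proof -
    interpret R: cring R by fact
    have sq: "(x \<oplus>\<^bsub>R\<^esub> y) [^]\<^bsub>R\<^esub> (2::nat) = x [^]\<^bsub>R\<^esub> (2::nat) \<oplus>\<^bsub>R\<^esub> y [^]\<^bsub>R\<^esub> (2::nat)"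
      if x: "x \<in> carrier R" and y: "y \<in> carrier R" for x y
    proof -
      have "(x \<oplus>\<^bsub>R\<^esub> y) [^]\<^bsub>R\<^esub> (2::nat) = x \<otimes>\<^bsub>R\<^esub> x \<oplus>\<^bsub>R\<^esub> y \<otimes>\<^bsub>R\<^esub> y \<oplus>\<^bsub>R\<^esub> (x \<otimes>\<^bsub>R\<^esub> y \<oplus>\<^bsub>R\<^esub> x \<otimes>\<^bsub>R\<^esub> y)"
        using x y by (simp add: numeral_2_eq_2 R.l_distr R.r_distr R.m_comm R.a_ac)
      then show ?thesis using x y by (simp add: dbl numeral_2_eq_2)
    qed
    have pow: "x [^]\<^bsub>R\<^esub> (4::nat) = (x [^]\<^bsub>R\<^esub> (2::nat)) [^]\<^bsub>R\<^esub> (2::nat)" if "x \<in> carrier R" for x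
      using that by (simp add: R.nat_pow_pow)
    show ?thesis using a b by (simp add: pow sq)
  qed
  have dbl: "c \<oplus>\<^bsub>F\<^esub> c = \<zero>\<^bsub>F\<^esub>" if "c \<in> carrier F" for c
  proof -
    have "c \<oplus>\<^bsub>F\<^esub> c = (\<one>\<^bsub>F\<^esub> \<oplus>\<^bsub>F\<^esub> \<one>\<^bsub>F\<^esub>) \<otimes>\<^bsub>F\<^esub> c" using that by (simp add: l_distr)
    then show ?thesis using that by (simp add: two)
  qed
  have dblA: "x \<oplus>\<^bsub>A.A\<^esub> x = \<zero>\<^bsub>A.A\<^esub>" if "x \<in> carrier A.A" for x
    by (rule ext) (use that in \<open>simp add: dbl\<close>)
  have dblB: "x \<oplus>\<^bsub>B.A\<^esub> x = \<zero>\<^bsub>B.A\<^esub>" if "x \<in> carrier B.A" for x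
    by (rule ext) (use that in \<open>simp add: dbl\<close>)
  obtain \<phi> where \<phi>: "\<phi> \<in> ring_iso A.A B.A"
    using eq unfolding is_ring_iso_def by blast
  have oneA: "\<one>\<^bsub>A.A\<^esub> = A.single (0, 0) \<one>\<^bsub>F\<^esub>"
    using twisted_algebra.one_eq[OF A.twisted_algebra_axioms] by simp
  define u where "u = A.single (1, 0) \<one>\<^bsub>F\<^esub>"
  have u: "u \<in> carrier A.A" by (simp add: u_def)
  have u_pow: "u [^]\<^bsub>A.A\<^esub> n = A.single (int n mod 8, 0) \<one>\<^bsub>F\<^esub>" for n :: nat
    by (simp add: u_def A.single_pow pow_const_def)
  \<comment> \<open>With u of order 8, x^4 = u^4 + 1 is nonzero. Already x^8 = u^8 + 1 vanishes; the
    exponent 16 = 4 * 4 is taken so that \<open>pow4\<close> can simply be applied twice.\<close>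
  define x where "x = u \<oplus>\<^bsub>A.A\<^esub> \<one>\<^bsub>A.A\<^esub>"
  have x: "x \<in> carrier A.A" using u by (simp add: x_def)
  have x4: "x [^]\<^bsub>A.A\<^esub> (4::nat) = u [^]\<^bsub>A.A\<^esub> (4::nat) \<oplus>\<^bsub>A.A\<^esub> \<one>\<^bsub>A.A\<^esub>"
    unfolding x_def using pow4[OF AC.is_cring u A.A.one_closed dblA] by simp
  have "(x [^]\<^bsub>A.A\<^esub> (4::nat)) (4, 0) = \<one>\<^bsub>F\<^esub>"
    unfolding x4 by (simp add: u_pow A.one_coeff) (simp add: A.single_def)
  then have x4_nz: "x [^]\<^bsub>A.A\<^esub> (4::nat) \<noteq> \<zero>\<^bsub>A.A\<^esub>" by auto
  have "x [^]\<^bsub>A.A\<^esub> (16::nat) = (u [^]\<^bsub>A.A\<^esub> (4::nat) \<oplus>\<^bsub>A.A\<^esub> \<one>\<^bsub>A.A\<^esub>) [^]\<^bsub>A.A\<^esub> (4::nat)"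
    using x by (simp add: A.A.nat_pow_pow flip: x4)
  also have "\<dots> = u [^]\<^bsub>A.A\<^esub> (16::nat) \<oplus>\<^bsub>A.A\<^esub> \<one>\<^bsub>A.A\<^esub>"
    using pow4[OF AC.is_cring A.A.nat_pow_closed[OF u] A.A.one_closed dblA] u by (simp add: A.A.nat_pow_pow)
  also have "\<dots> = \<zero>\<^bsub>A.A\<^esub>"
    using dblA[OF A.A.one_closed] by (simp add: u_pow oneA)
  finally have x16: "x [^]\<^bsub>A.A\<^esub> (16::nat) = \<zero>\<^bsub>A.A\<^esub>" .
  define w where "w = \<phi> x"
  have w: "w \<in> carrier B.A" using ring_iso_memE(1)[OF \<phi> x] by (simp add: w_def)
  have w4_nz: "w [^]\<^bsub>B.A\<^esub> (4::nat) \<noteq> \<zero>\<^bsub>B.A\<^esub>"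
  proof
    assume "w [^]\<^bsub>B.A\<^esub> (4::nat) = \<zero>\<^bsub>B.A\<^esub>"
    then have "\<phi> (x [^]\<^bsub>A.A\<^esub> (4::nat)) = \<phi> \<zero>\<^bsub>A.A\<^esub>"
      using ring_iso_nat_pow[OF \<phi> A.is_ring x, of 4] ring_iso_zero[OF \<phi> A.is_ring B.is_ring] by (simp add: w_def)
    then show False
      using x4_nz ring_iso_memE(5)[OF \<phi>] x by (metis A.A.nat_pow_closed A.A.zero_closed bij_betw_def inj_onD)
  qed
  have w16: "w [^]\<^bsub>B.A\<^esub> (16::nat) = \<zero>\<^bsub>B.A\<^esub>"
    using ring_iso_nat_pow[OF \<phi> A.is_ring x, of 16] ring_iso_zero[OF \<phi> A.is_ring B.is_ring] x16 by (simp add: w_def)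
  \<comment> \<open>Fourth powers are additive, and every h in C_4 x C_4 satisfies h^4 = 1, so each
    homogeneous summand contributes a multiple of u_1.\<close>
  have "\<exists>d\<in>carrier F. (\<Oplus>\<^bsub>B.A\<^esub>h\<in>D. B.single h (w h)) [^]\<^bsub>B.A\<^esub> (4::nat) = B.single (0, 0) d"
    if "finite D" "D \<subseteq> carrier H.G" for D
    using that
  proof (induction D rule: finite_induct)
    case empty
    have "B.single (0, 0) \<zero>\<^bsub>F\<^esub> = \<zero>\<^bsub>B.A\<^esub>" by (rule ext) (simp add: B.single_def)
    then have "(\<Oplus>\<^bsub>B.A\<^esub>h\<in>{}. B.single h (w h)) [^]\<^bsub>B.A\<^esub> (4::nat) = B.single (0, 0) \<zero>\<^bsub>F\<^esub>"
      using B.A.nat_pow_zero[of 4] by (simp only: B.A.finsum_empty)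
    then show ?case
      by (rule bexI) (rule zero_closed)
  next
    case (insert h D)
    then obtain d where d: "d \<in> carrier F" "(\<Oplus>\<^bsub>B.A\<^esub>h\<in>D. B.single h (w h)) [^]\<^bsub>B.A\<^esub> (4::nat) = B.single (0, 0) d"
      by auto
    have mem: "B.single g (w g) \<in> carrier B.A" if "g \<in> insert h D" for g
      using that insert.prems w by (intro B.single_closed) auto
    have h: "h \<in> carrier H.G" using insert.prems by simp
    have sum: "(\<Oplus>\<^bsub>B.A\<^esub>h\<in>D. B.single h (w h)) \<in> carrier B.A"
      using mem by (intro B.A.finsum_closed) auto
    have "h [^]\<^bsub>H.G\<^esub> (4::nat) = (0, 0)" by (cases h) simp
    note h4 = this
    define d' where "d' = w h [^]\<^bsub>F\<^esub> (4::nat) \<otimes>\<^bsub>F\<^esub> pow_const H.G F \<beta> h 4 \<otimes>\<^bsub>F\<^esub> inv\<^bsub>F\<^esub> (\<beta> \<one>\<^bsub>H.G\<^esub> \<one>\<^bsub>H.G\<^esub>)"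
    have d': "d' \<in> carrier F" "B.single h (w h) [^]\<^bsub>B.A\<^esub> (4::nat) = B.single (0, 0) d'"
      using B.single_pow[OF h, of "w h" 4] w h B.pow_const_unit[OF h, of 4]
      unfolding h4 d'_def by (simp_all add: Units_closed)
    have "(\<Oplus>\<^bsub>B.A\<^esub>h\<in>insert h D. B.single h (w h)) = B.single h (w h) \<oplus>\<^bsub>B.A\<^esub> (\<Oplus>\<^bsub>B.A\<^esub>h\<in>D. B.single h (w h))"
      using insert.hyps mem by (intro B.A.finsum_insert) auto
    then have "(\<Oplus>\<^bsub>B.A\<^esub>h\<in>insert h D. B.single h (w h)) [^]\<^bsub>B.A\<^esub> (4::nat) = B.single (0, 0) (d' \<oplus>\<^bsub>F\<^esub> d)"
      using pow4[OF BC.is_cring mem[of h] sum dblB] d d' by (simp add: B.single_add)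
    then show ?case using d(1) d'(1) by blast
  qed
  from this[OF H.finite_carrier subset_refl] obtain d where d: "d \<in> carrier F" "w [^]\<^bsub>B.A\<^esub> (4::nat) = B.single (0, 0) d"
    using B.single_expansion[OF w] by metis
  \<comment> \<open>The fourth power of d u_1 is d^4 times a unit times u_1, so its vanishing forces
    d = 0 in the field.\<close>
  have "B.single (0, 0) d [^]\<^bsub>B.A\<^esub> (4::nat) = \<zero>\<^bsub>B.A\<^esub>"
    using w16 w by (simp add: B.A.nat_pow_pow flip: d(2))
  then have "(B.single (0, 0) d [^]\<^bsub>B.A\<^esub> (4::nat)) (0, 0) = \<zero>\<^bsub>F\<^esub>" by simp
  then have "d [^]\<^bsub>F\<^esub> (4::nat) \<otimes>\<^bsub>F\<^esub> pow_const H.G F \<beta> (0, 0) 4 \<otimes>\<^bsub>F\<^esub> inv\<^bsub>F\<^esub> (\<beta> (0, 0) (0, 0)) = \<zero>\<^bsub>F\<^esub>"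
    unfolding B.single_pow[OF H.gen_mem(3) d(1)] by (simp add: B.single_def)
  moreover have "pow_const H.G F \<beta> (0, 0) 4 \<in> Units F" "inv\<^bsub>F\<^esub> (\<beta> (0, 0) (0, 0)) \<in> Units F"
    by (simp_all add: B.pow_const_unit)
  ultimately have "d [^]\<^bsub>F\<^esub> (4::nat) = \<zero>\<^bsub>F\<^esub>"
    using d(1) by (auto simp: field_Units integral_iff)
  then have "d = \<zero>\<^bsub>F\<^esub>"
    using d(1) by (metis field_Units Units_nat_pow Diff_iff singletonI singletonD)
  then have "w [^]\<^bsub>B.A\<^esub> (4::nat) = \<zero>\<^bsub>B.A\<^esub>"
    unfolding d(2) by (simp add: B.single_def fun_eq_iff)
  with w4_nz show False ..
qed

lemma not_twisted_equiv_no_sqrt_minus_one: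
  assumes "field F" and ne: "\<ominus>\<^bsub>F\<^esub> \<one>\<^bsub>F\<^esub> \<noteq> \<one>\<^bsub>F\<^esub>"
    and no: "\<And>i. i \<in> carrier F \<Longrightarrow> i \<otimes>\<^bsub>F\<^esub> i \<noteq> \<ominus>\<^bsub>F\<^esub> \<one>\<^bsub>F\<^esub>"
  shows "\<not> twisted_equiv F (bicyclic 8 2) (bicyclic 4 4)"
proof
  assume equiv: "twisted_equiv F (bicyclic 8 2) (bicyclic 4 4)"
  interpret field F by fact
  interpret G: bicyclic_group 8 2 by unfold_locales auto
  interpret H: bicyclic_group 4 4 by unfold_locales auto
  define \<alpha> where "\<alpha> = bichar F G.G (\<ominus>\<^bsub>F\<^esub> \<one>\<^bsub>F\<^esub>)"
  have \<alpha>: "\<alpha> \<in> cocycles G.G F"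
    unfolding \<alpha>_def by (intro G.bichar_cocycle is_cring) (auto simp: minus_one_pow)
  obtain \<beta> where \<beta>: "\<beta> \<in> cocycles H.G F" and
    eq: "twisted_group_algebra F G.G \<alpha> \<simeq> twisted_group_algebra F H.G \<beta>"
    by (rule twisted_equiv_transfer[OF equiv G.G.is_group H.G.is_group is_cring \<alpha>])
  interpret A: bicyclic_algebra 8 2 F \<alpha>
    using \<alpha> by (intro bicyclic_algebraI) (auto intro: field_axioms)
  interpret B: bicyclic_algebra 4 4 F \<beta>
    using \<beta> by (intro bicyclic_algebraI) (auto intro: field_axioms)
  obtain \<phi> where \<phi>: "\<phi> \<in> ring_iso A.A B.A"
    using eq unfolding is_ring_iso_def by blast
  have \<phi>': "inv_into (carrier A.A) \<phi> \<in> ring_iso B.A A.A"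
    using ring_iso_set_sym[OF A.is_ring \<phi>] .
  have \<alpha>_gens: "\<alpha> (1, 0) (0, 1) = \<ominus>\<^bsub>F\<^esub> \<one>\<^bsub>F\<^esub>" "\<alpha> (0, 1) (1, 0) = \<one>\<^bsub>F\<^esub>"
    unfolding \<alpha>_def by (simp_all add: G.bichar_gens is_cring)
  have Ac: "A.c = \<ominus>\<^bsub>F\<^esub> \<one>\<^bsub>F\<^esub>"
    by (simp add: comm_form_def \<alpha>_gens)
  have "B.c \<noteq> \<one>\<^bsub>F\<^esub>"
  proof
    assume "B.c = \<one>\<^bsub>F\<^esub>"
    then have "\<forall>x\<in>carrier B.A. \<forall>y\<in>carrier B.A. x \<otimes>\<^bsub>B.A\<^esub> y = y \<otimes>\<^bsub>B.A\<^esub> x"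
      by (subst B.commutative_iff) (simp add: B.comm_form_eq_one_iff)
    then have "\<forall>x\<in>carrier A.A. \<forall>y\<in>carrier A.A. x \<otimes>\<^bsub>A.A\<^esub> y = y \<otimes>\<^bsub>A.A\<^esub> x"
      using ring_iso_commutes[of B.A A.A] \<phi>' unfolding is_ring_iso_def by blast
    then show False
      using ne by (subst (asm) A.commutative_iff) (simp add: \<alpha>_gens)
  qed
  \<comment> \<open>The value 1 is excluded because the partner algebra is noncommutative; among the
    remaining solutions of c^4 = 1 only -1 exists without a square root of -1.\<close>
  then have Bc: "B.c = \<ominus>\<^bsub>F\<^esub> \<one>\<^bsub>F\<^esub>"
    using pow_four_eq_minus_one[OF \<open>field F\<close> ne no _ B.c_pow_snd] by (simp add: Units_closed)
  obtain k where k: "k \<in> carrier F" "k \<oplus>\<^bsub>F\<^esub> k = \<one>\<^bsub>F\<^esub>"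
    using half_exists[OF ne] .
  have kk: "k \<otimes>\<^bsub>F\<^esub> k \<oplus>\<^bsub>F\<^esub> k \<otimes>\<^bsub>F\<^esub> k = k"
    using k by (simp flip: r_distr)
  have kk': "\<ominus>\<^bsub>F\<^esub> (k \<otimes>\<^bsub>F\<^esub> k) \<oplus>\<^bsub>F\<^esub> \<ominus>\<^bsub>F\<^esub> (k \<otimes>\<^bsub>F\<^esub> k) = \<ominus>\<^bsub>F\<^esub> k"
    using k by (simp add: kk flip: minus_add)
  have \<alpha>_even: "\<alpha> (int a, 0) (int b, 0) = \<one>\<^bsub>F\<^esub>" if "a < 8" "b < 8" for a b
    using that by (simp add: \<alpha>_def bichar_def G.carrier_eq)
  have mem [simp]: "(int a, 0) \<in> carrier G.G" if "a < 8" for a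
    using that by (simp add: G.carrier_eq)
  define M where "M a = A.single (int a, 0)" for a
  have M_closed [simp]: "M a b \<in> carrier A.A" if "a < 8" "b \<in> carrier F" for a b
    using that by (simp add: M_def)
  have M_mult: "M a b \<otimes>\<^bsub>A.A\<^esub> M a' b' = M ((a + a') mod 8) (b \<otimes>\<^bsub>F\<^esub> b')"
    if "a < 8" "a' < 8" "b \<in> carrier F" "b' \<in> carrier F" for a a' b b'
    using that by (simp add: M_def \<alpha>_even zmod_int)
  have M_add: "M a b \<oplus>\<^bsub>A.A\<^esub> M a b' = M a (b \<oplus>\<^bsub>F\<^esub> b')" if "b \<in> carrier F" "b' \<in> carrier F" for a b b'
    using that by (simp add: M_def A.single_add)
  \<comment> \<open>With x = u_x these are e = (1 - x^4) / 2, the projection to the part where x^4 =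
    -1, and y = x^2 e, a square root of -1 on that part. Both use even powers only, so they are
    central. In \<open>prod\<close> the factors are x^a e and x^b e with product x^(a+b) e.\<close>
  define e y where "e = M 0 k \<oplus>\<^bsub>A.A\<^esub> M 4 (\<ominus>\<^bsub>F\<^esub> k)" and "y = M 2 k \<oplus>\<^bsub>A.A\<^esub> M 6 (\<ominus>\<^bsub>F\<^esub> k)"
  have prod: "(M a k \<oplus>\<^bsub>A.A\<^esub> M (a + 4) (\<ominus>\<^bsub>F\<^esub> k)) \<otimes>\<^bsub>A.A\<^esub> (M b k \<oplus>\<^bsub>A.A\<^esub> M (b + 4) (\<ominus>\<^bsub>F\<^esub> k)) =
      M (a + b) k \<oplus>\<^bsub>A.A\<^esub> M ((a + b + 4) mod 8) (\<ominus>\<^bsub>F\<^esub> k)" if ab: "a < 4" "b < 4" for a b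
  proof -
    have "(a + 4 + (b + 4)) mod 8 = (a + b + 8) mod 8" by (simp only: ac_simps) simp
    then have mods: "(a + 4 + (b + 4)) mod 8 = a + b"
      using ab by simp
    have mods': "(a + b) mod 8 = a + b"
      "(a + (b + 4)) mod 8 = (a + b + 4) mod 8" "(a + 4 + b) mod 8 = (a + b + 4) mod 8"
      using ab by (simp_all add: ac_simps)
    have [simp]: "a < 8" "b < 8" using ab by simp_all
    have "(M a k \<oplus>\<^bsub>A.A\<^esub> M (a + 4) (\<ominus>\<^bsub>F\<^esub> k)) \<otimes>\<^bsub>A.A\<^esub> (M b k \<oplus>\<^bsub>A.A\<^esub> M (b + 4) (\<ominus>\<^bsub>F\<^esub> k)) =
      (M a k \<otimes>\<^bsub>A.A\<^esub> M b k \<oplus>\<^bsub>A.A\<^esub> M (a + 4) (\<ominus>\<^bsub>F\<^esub> k) \<otimes>\<^bsub>A.A\<^esub> M (b + 4) (\<ominus>\<^bsub>F\<^esub> k)) \<oplus>\<^bsub>A.A\<^esub>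
      (M a k \<otimes>\<^bsub>A.A\<^esub> M (b + 4) (\<ominus>\<^bsub>F\<^esub> k) \<oplus>\<^bsub>A.A\<^esub> M (a + 4) (\<ominus>\<^bsub>F\<^esub> k) \<otimes>\<^bsub>A.A\<^esub> M b k)"
      using ab k by (simp add: A.A.l_distr A.A.r_distr A.A.a_ac del: M_mult)
    also have "\<dots> = M (a + b) k \<oplus>\<^bsub>A.A\<^esub> M ((a + b + 4) mod 8) (\<ominus>\<^bsub>F\<^esub> k)"
      using ab k by (simp add: M_mult mods mods' M_add l_minus r_minus kk kk')
    finally show ?thesis .
  qed
  have ee: "e \<otimes>\<^bsub>A.A\<^esub> e = e" and ey: "e \<otimes>\<^bsub>A.A\<^esub> y = y"
    using prod[of 0 0] prod[of 0 2] by (simp_all add: e_def y_def del: add_2_eq_Suc add_2_eq_Suc')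
  have "y \<otimes>\<^bsub>A.A\<^esub> y = M 4 k \<oplus>\<^bsub>A.A\<^esub> M 0 (\<ominus>\<^bsub>F\<^esub> k)"
    using prod[of 2 2] by (simp add: y_def)
  then have yy: "y \<otimes>\<^bsub>A.A\<^esub> y \<oplus>\<^bsub>A.A\<^esub> e = \<zero>\<^bsub>A.A\<^esub>"
    using k by (auto simp: e_def M_def A.single_def fun_eq_iff l_neg r_neg)
  have k0: "k \<noteq> \<zero>\<^bsub>F\<^esub>" using k by auto
  have "e (0, 0) = k" using k by (simp add: e_def M_def A.single_def)
  then have e0: "e \<noteq> \<zero>\<^bsub>A.A\<^esub>" using k0 by auto
  have ey_carrier: "e \<in> carrier A.A" "y \<in> carrier A.A" using k by (simp_all add: e_def y_def)
  have supp: "even (fst g) \<and> even (snd g)" if "e g \<noteq> \<zero>\<^bsub>F\<^esub> \<or> y g \<noteq> \<zero>\<^bsub>F\<^esub>" for g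
    using that k by (auto simp: e_def y_def M_def A.single_def split: if_splits)
  have "e \<in> center A.A" "y \<in> center A.A"
    using supp by (subst A.mem_center_iff[OF \<open>field F\<close> Ac ne], simp_all add: ey_carrier)+
  then have "\<exists>u\<in>center B.A. u \<otimes>\<^bsub>B.A\<^esub> u \<oplus>\<^bsub>B.A\<^esub> \<one>\<^bsub>B.A\<^esub> = \<zero>\<^bsub>B.A\<^esub>"
  proof (intro central_sqrt_minus_one_C4xC4[OF B.bicyclic_algebra_axioms \<open>field F\<close> ne Bc, of "\<phi> e" "\<phi> y"])
    have mult: "\<phi> a \<otimes>\<^bsub>B.A\<^esub> \<phi> b = \<phi> (a \<otimes>\<^bsub>A.A\<^esub> b)" if "a \<in> carrier A.A" "b \<in> carrier A.A" for a b
      using ring_iso_memE(2)[OF \<phi> that] by simp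
    show "\<phi> e \<otimes>\<^bsub>B.A\<^esub> \<phi> e = \<phi> e" "\<phi> e \<otimes>\<^bsub>B.A\<^esub> \<phi> y = \<phi> y"
      by (simp_all add: mult ey_carrier ee ey)
    have zero: "\<phi> \<zero>\<^bsub>A.A\<^esub> = \<zero>\<^bsub>B.A\<^esub>" by (rule ring_iso_zero[OF \<phi> A.is_ring B.is_ring])
    show "\<phi> y \<otimes>\<^bsub>B.A\<^esub> \<phi> y \<oplus>\<^bsub>B.A\<^esub> \<phi> e = \<zero>\<^bsub>B.A\<^esub>"
      using ring_iso_memE(3)[OF \<phi> A.mult_closed[OF ey_carrier(2) ey_carrier(2)] ey_carrier(1)]
      by (simp only: mult ey_carrier yy zero)
    show "\<phi> e \<noteq> \<zero>\<^bsub>B.A\<^esub>"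
      using e0 ey_carrier(1) ring_iso_memE(5)[OF \<phi>] zero A.zero_closed by (metis bij_betw_def inj_onD)
  qed (auto intro: ring_iso_center[OF \<phi>])
  then obtain v where v: "v \<in> center B.A" "v \<otimes>\<^bsub>B.A\<^esub> v \<oplus>\<^bsub>B.A\<^esub> \<one>\<^bsub>B.A\<^esub> = \<zero>\<^bsub>B.A\<^esub>" by blast
  define u where "u = inv_into (carrier A.A) \<phi> v"
  have uc: "u \<in> center A.A"
    unfolding u_def using ring_iso_center[OF \<phi>' v(1)] .
  have vB: "v \<in> carrier B.A" using v(1) by (simp add: center_def)
  have u [simp]: "u \<in> carrier A.A" using uc by (simp add: center_def)
  have uu: "u \<otimes>\<^bsub>A.A\<^esub> u \<oplus>\<^bsub>A.A\<^esub> \<one>\<^bsub>A.A\<^esub> = \<zero>\<^bsub>A.A\<^esub>"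
    using ring_iso_memE(3)[OF \<phi>' B.mult_closed[OF vB vB] B.one_closed] ring_iso_memE(2)[OF \<phi>' vB vB]
      ring_iso_memE(4)[OF \<phi>'] ring_iso_zero[OF \<phi>' B.is_ring A.is_ring] v(2)
    by (simp only: u_def)
  \<comment> \<open>A central element has even second coordinates in its support, and the only even
    residue modulo 2 is 0.\<close>
  have u_supp: "snd g = 0" if "g \<in> carrier G.G" "u g \<noteq> \<zero>\<^bsub>F\<^esub>" for g
  proof -
    have "even (snd g)"
      using uc that by (subst (asm) A.mem_center_iff[OF \<open>field F\<close> Ac ne]) auto
    moreover have "0 \<le> snd g" "snd g < 2"
      using that(1) by (auto simp: G.carrier_eq)
    ultimately show ?thesis by presburger
  qed
  \<comment> \<open>The sum of coefficients is not multiplicative on the anticommuting algebra. But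
    u is supported on powers of u_x, against which the cocycle is trivial, so u satisfies the same
    equation in the untwisted algebra.\<close>
  let ?one = "\<lambda>(g :: int \<times> int) (h :: int \<times> int). \<one>\<^bsub>F\<^esub>"
  interpret T: bicyclic_algebra 8 2 F ?one
    by (intro bicyclic_algebraI) (auto intro: field_axioms simp: cocycles_def)
  have uT: "u \<in> carrier T.A"
    by (rule T.carrierI) (use u in \<open>simp_all add: A.coeff_outside[OF u]\<close>)
  have \<alpha>_one: "\<alpha> g h = \<one>\<^bsub>F\<^esub>" if "g \<in> carrier G.G" "h \<in> carrier G.G" "u h \<noteq> \<zero>\<^bsub>F\<^esub>" for g h
    using u_supp[OF that(2,3)] that(1,2) by (simp add: \<alpha>_def bichar_def)
  have "u \<otimes>\<^bsub>T.A\<^esub> u = u \<otimes>\<^bsub>A.A\<^esub> u"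
  proof
    fix g
    show "(u \<otimes>\<^bsub>T.A\<^esub> u) g = (u \<otimes>\<^bsub>A.A\<^esub> u) g"
    proof (cases "g \<in> carrier G.G")
      case True
      have "u h \<otimes>\<^bsub>F\<^esub> u l \<otimes>\<^bsub>F\<^esub> \<one>\<^bsub>F\<^esub> = u h \<otimes>\<^bsub>F\<^esub> u l \<otimes>\<^bsub>F\<^esub> \<alpha> h l" if "h \<in> carrier G.G" "l \<in> carrier G.G" for h l
        using \<alpha>_one[OF that] that by (cases "u l = \<zero>\<^bsub>F\<^esub>") auto
      then show ?thesis
        unfolding T.mult_coeff[OF True] A.mult_coeff[OF True] using True
        by (intro finsum_cong') (auto simp del: r_one)
    qed (simp add: T.mult_coeff_outside A.mult_coeff_outside)
  qed
  moreover have "\<one>\<^bsub>T.A\<^esub> = \<one>\<^bsub>A.A\<^esub>"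
  proof -
    have "\<alpha> (0, 0) (0, 0) = \<one>\<^bsub>F\<^esub>" by (simp add: \<alpha>_def bichar_def)
    then show ?thesis by (intro ext) (simp add: T.one_coeff A.one_coeff)
  qed
  ultimately have uuT: "u \<otimes>\<^bsub>T.A\<^esub> u \<oplus>\<^bsub>T.A\<^esub> \<one>\<^bsub>T.A\<^esub> = \<zero>\<^bsub>T.A\<^esub>"
    using fun_cong[OF uu] by (intro ext) (simp only: A.add_coeff T.add_coeff A.zero_coeff T.zero_coeff)
  \<comment> \<open>The augmentation: every basis element is sent to 1, so the image of u is a
    square root of -1 in F itself.\<close>
  have "(\<lambda>x. \<Oplus>\<^bsub>F\<^esub>g\<in>carrier G.G. id (x g) \<otimes>\<^bsub>F\<^esub> \<one>\<^bsub>F\<^esub>) \<in> ring_hom T.A F"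
    by (rule T.lift_ring_hom) (auto intro: is_cring simp: ring_hom_def)
  then obtain \<epsilon> where \<epsilon>: "\<epsilon> \<in> ring_hom T.A F" by blast
  interpret \<epsilon>: ring_hom_ring T.A F \<epsilon>
    using \<epsilon> T.is_ring is_ring by (intro ring_hom_ringI2)
  have "\<epsilon> u \<otimes>\<^bsub>F\<^esub> \<epsilon> u \<oplus>\<^bsub>F\<^esub> \<one>\<^bsub>F\<^esub> = \<zero>\<^bsub>F\<^esub>"
    using arg_cong[OF uuT, of \<epsilon>] uT T.mult_closed[OF uT uT] T.one_closed by simp
  then have "\<epsilon> u \<otimes>\<^bsub>F\<^esub> \<epsilon> u = \<ominus>\<^bsub>F\<^esub> \<one>\<^bsub>F\<^esub>"
    using \<epsilon>.hom_closed[OF uT] by (metis m_closed minus_equality one_closed)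
  then show False
    using no \<epsilon>.hom_closed[OF uT] by blast
qed

lemma finite_field_card_mod_4_iso:
  fixes F :: "('a, 'b) ring_scheme"
  assumes "field F" "finite (carrier F)" "card (carrier F) mod 4 = 3"
  shows "group_algebra F C8xC2 \<simeq> group_algebra F C4xC4" "H2 C8xC2 F \<cong> H2 C4xC4 F"
  using group_algebra_iso_odd_exponent_field H2_iso_odd_exponent_field
    field.odd_exponent_if_card_mod_4[OF assms] assms(2) by blast+

theorem theorem2:
  shows "(\<exists>F :: int ring. field F \<and>
            group_algebra F C8xC2 \<simeq> group_algebra F C4xC4 \<and> H2 C8xC2 F \<cong> H2 C4xC4 F)
       \<and> (\<forall>F :: ('a, 'b) ring_scheme. field F \<and> finite (carrier F) \<and> card (carrier F) mod 4 = 3 \<longrightarrow>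
            group_algebra F C8xC2 \<simeq> group_algebra F C4xC4 \<and> H2 C8xC2 F \<cong> H2 C4xC4 F)
       \<and> (\<forall>K :: ('c, 'd) ring_scheme. field K \<longrightarrow> \<not> twisted_equiv K C8xC2 C4xC4)"
proof (intro conjI allI impI)
  \<comment> \<open>The integers modulo 3 are the smallest field of order congruent to 3 modulo
    4.\<close>
  interpret R: residues_prime 3 "residue_ring (int 3)"
    by unfold_locales simp_all
  have R: "field (residue_ring (int 3))" by (rule R.is_field)
  have "carrier (residue_ring (int 3)) = {0..2}" by (simp add: residue_ring_def)
  then have "finite (carrier (residue_ring (int 3)))" "card (carrier (residue_ring (int 3))) mod 4 = 3"
    by simp_all
  from R finite_field_card_mod_4_iso[OF R this]
  show "\<exists>F :: int ring. field F \<and>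
      group_algebra F C8xC2 \<simeq> group_algebra F C4xC4 \<and> H2 C8xC2 F \<cong> H2 C4xC4 F"
    by blast
next
  fix F :: "('a, 'b) ring_scheme"
  assume "field F \<and> finite (carrier F) \<and> card (carrier F) mod 4 = 3"
  then show "group_algebra F C8xC2 \<simeq> group_algebra F C4xC4" "H2 C8xC2 F \<cong> H2 C4xC4 F"
    using finite_field_card_mod_4_iso by blast+
next
  fix K :: "('c, 'd) ring_scheme"
  assume K: "field K"
  interpret field K by fact
  show "\<not> twisted_equiv K C8xC2 C4xC4"
    unfolding C8xC2_eq C4xC4_eq
  proof (cases "\<ominus>\<^bsub>K\<^esub> \<one>\<^bsub>K\<^esub> = \<one>\<^bsub>K\<^esub>")
    case True
    then have "\<one>\<^bsub>K\<^esub> \<oplus>\<^bsub>K\<^esub> \<one>\<^bsub>K\<^esub> = \<zero>\<^bsub>K\<^esub>" by (metis l_neg one_closed)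
    then show "\<not> twisted_equiv K (bicyclic 8 2) (bicyclic 4 4)"
      by (rule not_twisted_equiv_char_two[OF K])
  next
    case False
    then show "\<not> twisted_equiv K (bicyclic 8 2) (bicyclic 4 4)"
      using not_twisted_equiv_sqrt_minus_one[OF K] not_twisted_equiv_no_sqrt_minus_one[OF K] by blast
  qed
qed

end
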